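(* Let $p$ be a prime, let $G$ be the Vilenkin group associated with $p$, $H$ its discrete subgroup, $G^*$ its dual group, $U^*$ the basic neighbourhood of $\theta$ in $G^*$, and $B$ the shift automorphism of $G^*$. Let $\Omega$ be a measurable subset of $G^*$. Then $\Omega$ is a wavelet set if and only if both of the following conditions hold: (a) $\{B^n\Omega : n\in\mathbb{Z}\}$ tiles $G^*$ up to sets of measure zero (i.e. the sets $B^n\Omega$, $n \in \mathbb{Z}$, are pairwise disjoint up to null sets and their union is $G^*$ up to a null set); and (b) $\Omega$ is $H^\perp$-translation congruent to $U^*$ up to sets of measure zero.
   Context: Vilenkin group: for a prime $p$, $G$ is the group of sequences $x=(x_j)_{j\in\mathbb{Z}}$ with $x_j\in\{0,\dots,p-1\}$ and $x_j=0$ for all $j<k(x)$, under coordinatewise addition mod $p$, denoted $\oplus$ (inverse operation $\ominus$); identity $\theta$. A basis of neighbourhoods of $\theta$ is $U_l=\{x\in G: x_j=0 \text{ for } j\le l\}$, $l\in\mathbb{Z}$; $U=U_0$; Haar measure $\mu$ is normalized by $\mu(U)=1$. The dual group $G^*$ consists of sequences $\omega=(\omega_j)_{j\in\mathbb{Z}}$ of the same form, with the same operations, neighbourhoods $U_l^*$, $U^*=U_0^*=\{\omega : \omega_j=0 \text{ for } j\le 0\}$, and Haar measure $\mu^*$ with $\mu^*(U^* )=1$. The pairing is $\chi(x,\omega)=\exp\big(\frac{2\pi i}{p}\sum_{j\in\mathbb{Z}}x_j\omega_{1-j}\big)$. $H=\{x\in G: x_j=0 \text{ for } j>0\}$; its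 annihilator is $H^\perp=\{\omega\in G^*:\omega_j=0\text{ for }j>0\}$. $A\in\mathrm{Aut}(G)$, $(Ax)_j=x_{j+1}$; $B\in\mathrm{Aut}(G^* )$, $(B\omega)_j=\omega_{j+1}$. A function $\psi\in L^2(G)$ is a wavelet if $\{p^{j/2}\psi(A^jx\ominus h): j\in\mathbb{Z},h\in H\}$ is an orthonormal basis of $L^2(G)$. A measurable $\Omega\subset G^*$ is a wavelet set if $\psi=\check{1}_\Omega$ (the inverse Fourier transform of the characteristic function of $\Omega$) is a wavelet in $L^2(G)$. Measurable sets $E,F\subset G^*$ are $H^\perp$-translation congruent if there is a measurable partition $\{E_h\}_{h\in H^\perp}$ of $E$ (pieces possibly empty) such that $\{E_h\oplus h\}_{h\in H^\perp}$ is a partition of $F$; "up to sets of measure zero" means that the partitions are understood modulo null sets. *)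

theory Defs
  imports "HOL-Analysis.Analysis" "HOL-Computational_Algebra.Primes"
begin

text \<open>
  The Vilenkin group for \<open>p\<close>, as a set of integer sequences. The dual group consists of sequences
  of the same form with the same operations and neighbourhoods, so \<open>vilenkin p\<close>, \<open>vadd p\<close>,
  \<open>vnbhd p\<close> and \<open>vshift\<close> serve both for the group and for its dual; the two are kept apart by
  using two Haar measures and by the pairing \<open>vchar\<close>.
\<close>

definition vilenkin :: "nat \<Rightarrow> (int \<Rightarrow> int) set" where
  "vilenkin p = {x. (\<forall>j. x j \<in> {0..<int p}) \<and> (\<exists>k. \<forall>j<k. x j = 0)}"

definition vadd :: "nat \<Rightarrow> (int \<Rightarrow> int) \<Rightarrow> (int \<Rightarrow> int) \<Rightarrow> (int \<Rightarrow> int)" where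
  "vadd p x y = (\<lambda>j. (x j + y j) mod int p)"

definition vminus :: "nat \<Rightarrow> (int \<Rightarrow> int) \<Rightarrow> (int \<Rightarrow> int) \<Rightarrow> (int \<Rightarrow> int)" where
  "vminus p x y = (\<lambda>j. (x j - y j) mod int p)"

definition vnbhd :: "nat \<Rightarrow> int \<Rightarrow> (int \<Rightarrow> int) set" where
  "vnbhd p l = {x \<in> vilenkin p. \<forall>j\<le>l. x j = 0}"

definition vcoset :: "nat \<Rightarrow> (int \<Rightarrow> int) \<Rightarrow> int \<Rightarrow> (int \<Rightarrow> int) set" where
  "vcoset p x l = vadd p x ` vnbhd p l"

definition vtopology :: "nat \<Rightarrow> (int \<Rightarrow> int) topology" where
  "vtopology p = topology_generated_by {vcoset p x l | x l. x \<in> vilenkin p}"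

definition vborel :: "nat \<Rightarrow> (int \<Rightarrow> int) measure" where
  "vborel p = sigma (vilenkin p) {S. openin (vtopology p) S}"

text \<open>
  The normalized Haar measure on the Borel sets. Finiteness on compact sets and regularity need
  not be required: they follow from the normalization, since \<open>vnbhd p 0\<close> is compact and open and
  the group is metrizable and a countable union of translates of \<open>vnbhd p 0\<close>.
\<close>

definition haar_measure :: "nat \<Rightarrow> (int \<Rightarrow> int) measure \<Rightarrow> bool" where
  "haar_measure p M \<longleftrightarrow>
     space M = vilenkin p \<and> sets M = sets (vborel p) \<and>
     (\<forall>x\<in>vilenkin p. \<forall>E\<in>sets M. emeasure M (vadd p x ` E) = emeasure M E) \<and>
     emeasure M (vnbhd p 0) = 1"

definition vH :: "nat \<Rightarrow> (int \<Rightarrow> int) set" where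
  "vH p = {x \<in> vilenkin p. \<forall>j>0. x j = 0}"

definition vH_perp :: "nat \<Rightarrow> (int \<Rightarrow> int) set" where
  "vH_perp p = {\<omega> \<in> vilenkin p. \<forall>j>0. \<omega> j = 0}"

text \<open>The sum in the pairing runs over the finitely many indices with a nonzero term.\<close>

definition vchar :: "nat \<Rightarrow> (int \<Rightarrow> int) \<Rightarrow> (int \<Rightarrow> int) \<Rightarrow> complex" where
  "vchar p x \<omega> =
     exp (2 * of_real pi * \<i> / of_nat p * of_int (\<Sum>j | x j * \<omega> (1 - j) \<noteq> 0. x j * \<omega> (1 - j)))"

text \<open>
  \<open>vshift 1\<close> is the automorphism \<open>A\<close> of the group and also the automorphism \<open>B\<close> of its dual;
  \<open>vshift n\<close> is the power \<open>A\<^sup>n\<close> resp. \<open>B\<^sup>n\<close> for every integer \<open>n\<close>.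
\<close>

definition vshift :: "int \<Rightarrow> (int \<Rightarrow> int) \<Rightarrow> (int \<Rightarrow> int)" where
  "vshift n x = (\<lambda>j. x (j + n))"

lemma vshift_funpow: "vshift 1 ^^ n = vshift (int n)"
  by (induction n) (auto simp: vshift_def fun_eq_iff algebra_simps)

lemma vshift_uminus: "vshift (- n) \<circ> vshift n = id" "vshift n \<circ> vshift (- n) = id"
  by (auto simp: vshift_def fun_eq_iff)

text \<open>Square-integrable functions are represented by functions rather than by classes modulo
  null sets.\<close>

definition L2 :: "'a measure \<Rightarrow> ('a \<Rightarrow> complex) set" where
  "L2 M = {f \<in> borel_measurable M. integrable M (\<lambda>x. (norm (f x))\<^sup>2)}"

definition l2_inner :: "'a measure \<Rightarrow> ('a \<Rightarrow> complex) \<Rightarrow> ('a \<Rightarrow> complex) \<Rightarrow> complex" where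
  "l2_inner M f g = (LINT x|M. f x * cnj (g x))"

definition l2_norm :: "'a measure \<Rightarrow> ('a \<Rightarrow> complex) \<Rightarrow> real" where
  "l2_norm M f = sqrt (LINT x|M. (norm (f x))\<^sup>2)"

text \<open>An orthonormal family whose finite linear combinations are dense.\<close>

definition orthonormal_basis_L2 :: "'a measure \<Rightarrow> 'i set \<Rightarrow> ('i \<Rightarrow> 'a \<Rightarrow> complex) \<Rightarrow> bool" where
  "orthonormal_basis_L2 M I e \<longleftrightarrow>
     (\<forall>i\<in>I. e i \<in> L2 M) \<and>
     (\<forall>i\<in>I. \<forall>j\<in>I. l2_inner M (e i) (e j) = (if i = j then 1 else 0)) \<and>
     (\<forall>f\<in>L2 M. \<forall>\<epsilon>>0. \<exists>J c. finite J \<and> J \<subseteq> I \<and>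
        l2_norm M (\<lambda>x. f x - (\<Sum>i\<in>J. c i * e i x)) < \<epsilon>)"

definition wavelet :: "nat \<Rightarrow> (int \<Rightarrow> int) measure \<Rightarrow> ((int \<Rightarrow> int) \<Rightarrow> complex) \<Rightarrow> bool" where
  "wavelet p M \<psi> \<longleftrightarrow> \<psi> \<in> L2 M \<and>
     orthonormal_basis_L2 M (UNIV \<times> vH p)
       (\<lambda>(j, h) x. of_real (real p powr (real_of_int j / 2)) * \<psi> (vminus p (vshift j x) h))"

text \<open>
  The inverse Fourier transform, with \<open>N\<close> the measure on the dual group. The integral formula
  is valid for functions in \<open>L\<^sup>1 \<inter> L\<^sup>2\<close>. This is all that is needed below, since an
  indicator function in \<open>L\<^sup>2\<close> is also in \<open>L\<^sup>1\<close>.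
\<close>

definition inverse_fourier ::
  "nat \<Rightarrow> (int \<Rightarrow> int) measure \<Rightarrow> ((int \<Rightarrow> int) \<Rightarrow> complex) \<Rightarrow> (int \<Rightarrow> int) \<Rightarrow> complex" where
  "inverse_fourier p N f x = (LINT \<omega>|N. f \<omega> * vchar p x \<omega>)"

text \<open>The second conjunct says that the indicator function has an \<open>L\<^sup>2\<close> inverse Fourier transform.\<close>

definition wavelet_set ::
  "nat \<Rightarrow> (int \<Rightarrow> int) measure \<Rightarrow> (int \<Rightarrow> int) measure \<Rightarrow> (int \<Rightarrow> int) set \<Rightarrow> bool" where
  "wavelet_set p M N \<Omega> \<longleftrightarrow>
     \<Omega> \<in> sets N \<and> indicator \<Omega> \<in> L2 N \<and> wavelet p M (inverse_fourier p N (indicator \<Omega>))"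

text \<open>Measurable partitions (tilings) of \<open>E\<close> up to null sets; pieces may be empty.\<close>

definition partition_mod_null :: "'a measure \<Rightarrow> 'i set \<Rightarrow> ('i \<Rightarrow> 'a set) \<Rightarrow> 'a set \<Rightarrow> bool" where
  "partition_mod_null M I P E \<longleftrightarrow>
     (\<forall>i\<in>I. P i \<in> sets M) \<and>
     (\<forall>i\<in>I. \<forall>j\<in>I. i \<noteq> j \<longrightarrow> P i \<inter> P j \<in> null_sets M) \<and>
     (\<Union>i\<in>I. P i) - E \<in> null_sets M \<and> E - (\<Union>i\<in>I. P i) \<in> null_sets M"

definition translation_congruent ::
  "nat \<Rightarrow> (int \<Rightarrow> int) measure \<Rightarrow> (int \<Rightarrow> int) set \<Rightarrow> (int \<Rightarrow> int) set \<Rightarrow> bool" where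
  "translation_congruent p N E F \<longleftrightarrow>
     (\<exists>P. partition_mod_null N (vH_perp p) P E \<and>
          partition_mod_null N (vH_perp p) (\<lambda>h. vadd p h ` P h) F)"

end

theory Submission
  imports Defs
begin

text \<open>
  A Haar measure is determined by its values on cosets, so the group and its dual are one and the
  same measure space. By Plancherel the wavelet system of the inverse transform of \<open>1\<^sub>\<Omega>\<close> is an
  orthonormal basis iff the functions \<open>p\<^bsup>-j/2\<^esup> 1\<^sub>\<Omega>(B\<^bsup>-j\<^esup>\<omega>) cnj (\<chi>(h, B\<^bsup>-j\<^esup>\<omega>))\<close> form one.
  Across scales, the inner products for \<open>h = \<theta>\<close> are multiples of the measures of
  \<open>B\<^sup>i\<Omega> \<inter> B\<^sup>j\<Omega>\<close>, and whatever lives outside all dilates is orthogonal to the system; this is (a).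
  On one scale, orthonormality says that \<open>\<Omega>\<close>, reduced modulo the annihilator of \<open>H\<close>, has the
  Fourier coefficients of \<open>U\<^sup>*\<close>; this is (b). Conversely (b) carries the Walsh basis of
  \<open>L\<^sup>2(U\<^sup>*)\<close> over to \<open>L\<^sup>2(\<Omega>)\<close>, and (a) assembles the scales.

  Plancherel itself is an explicit computation for characters restricted to cosets, and
  extends to indicators of arbitrary sets of finite measure by Fatou's lemma.
\<close>

subsection \<open>Cosets and Borel sets\<close>

text \<open>The obstacle is that \<open>inverse_fourier\<close> is a pointwise integral: it makes
  sense for integrable functions, while bases live in L2. No unitary operator on all of L2 is built.
  The transform is studied on functions that steps approximate in both norms (\<open>L12\<close>),
  and two facts carry the argument: it preserves inner products there, and it sends each restricted
  character \<open>vgen\<close> to a multiple of another one, so its range is dense. Together they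
  move density of a family through the transform in either direction.

  The sets in question are measurable for the completed measure. Borel statements come first, via
  the countable intersection-stable family of cosets, and are then lifted through null sets.

  Finiteness of the measure of \<Omega> has two sources: square-integrability of the indicator in
  one direction, and (b), which forces measure 1, in the other.\<close>

abbreviation "vzero \<equiv> \<lambda>_ :: int. 0 :: int"

lemma vilenkin_iff: "x \<in> vilenkin p \<longleftrightarrow> (\<forall>j. 0 \<le> x j \<and> x j < int p) \<and> (\<exists>k. \<forall>j<k. x j = 0)"
  by (auto simp: vilenkin_def)

lemma vilenkin_mod: "x \<in> vilenkin p \<Longrightarrow> x j mod int p = x j"
  by (auto simp: vilenkin_iff)

lemma vilenkin_common_zero:
  assumes "x \<in> vilenkin p" "y \<in> vilenkin p"
  obtains k where "\<forall>j<k. x j = 0 \<and> y j = 0"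
proof -
  obtain k l where "\<forall>j<k. x j = 0" "\<forall>j<l. y j = 0"
    using assms by (auto simp: vilenkin_iff)
  then have "\<forall>j<min k l. x j = 0 \<and> y j = 0" by auto
  then show ?thesis using that by blast
qed

lemma zero_in_vilenkin: "p > 0 \<Longrightarrow> vzero \<in> vilenkin p"
  by (auto simp: vilenkin_iff)

lemma vadd_in_vilenkin: "p > 0 \<Longrightarrow> x \<in> vilenkin p \<Longrightarrow> y \<in> vilenkin p \<Longrightarrow> vadd p x y \<in> vilenkin p"
  by (rule vilenkin_common_zero[of x p y]) (auto simp: vilenkin_iff vadd_def intro!: exI)

lemma vminus_in_vilenkin: "p > 0 \<Longrightarrow> x \<in> vilenkin p \<Longrightarrow> y \<in> vilenkin p \<Longrightarrow> vminus p x y \<in> vilenkin p"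
  by (rule vilenkin_common_zero[of x p y]) (auto simp: vilenkin_iff vminus_def intro!: exI)

lemma vadd_commute: "vadd p x y = vadd p y x"
  by (simp add: vadd_def add.commute)

lemma vadd_assoc: "vadd p (vadd p x y) z = vadd p x (vadd p y z)"
  by (simp add: vadd_def fun_eq_iff mod_simps add.assoc)

lemma vadd_zero: "x \<in> vilenkin p \<Longrightarrow> vadd p x vzero = x"
  by (simp add: vadd_def fun_eq_iff vilenkin_mod)

lemma vminus_zero: "x \<in> vilenkin p \<Longrightarrow> vminus p x vzero = x"
  by (simp add: vminus_def fun_eq_iff vilenkin_mod)

lemma vadd_vminus_cancel: "x \<in> vilenkin p \<Longrightarrow> vadd p y (vminus p x y) = x"
  by (simp add: vadd_def vminus_def fun_eq_iff mod_simps vilenkin_mod)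

lemma vminus_vadd_cancel: "x \<in> vilenkin p \<Longrightarrow> vminus p (vadd p y x) y = x"
  by (simp add: vadd_def vminus_def fun_eq_iff mod_simps vilenkin_mod)

lemma vadd_cancel_vminus: "x \<in> vilenkin p \<Longrightarrow> vadd p y (vadd p (vminus p vzero y) x) = x"
  by (simp add: vadd_def vminus_def fun_eq_iff mod_simps vilenkin_mod)

lemma vadd_vminus_self: "vadd p (vminus p vzero y) y = vzero"
  by (simp add: vadd_def vminus_def fun_eq_iff mod_simps)

lemma inj_on_vadd: "inj_on (vadd p a) (vilenkin p)"
  by (metis inj_onI vminus_vadd_cancel)

lemma mod_eq_bound_cancel:
  fixes x y a :: int
  assumes "0 \<le> x" "x < p" "0 \<le> y" "y < p"
  shows "(x - y) mod p = 0 \<longleftrightarrow> x = y"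
  using assms by (metis diff_self mod_0 mod_eq_dvd_iff mod_pos_pos_trivial mod_0_imp_dvd)

lemma vminus_eq_0_iff: "x \<in> vilenkin p \<Longrightarrow> y \<in> vilenkin p \<Longrightarrow> vminus p x y j = 0 \<longleftrightarrow> x j = y j"
  unfolding vminus_def by (rule mod_eq_bound_cancel) (auto simp: vilenkin_iff)

lemma mem_vnbhd: "x \<in> vnbhd p l \<longleftrightarrow> x \<in> vilenkin p \<and> (\<forall>j\<le>l. x j = 0)"
  by (auto simp: vnbhd_def)

text \<open>Addition has no carries, so adding a sequence that vanishes up to \<open>l\<close>
  leaves those coordinates alone. Cosets are cylinder sets, and later claims about them become
  comparisons of coordinates.\<close>

lemma mem_vcoset:
  assumes "p > 0" "a \<in> vilenkin p"
  shows "y \<in> vcoset p a l \<longleftrightarrow> y \<in> vilenkin p \<and> (\<forall>j\<le>l. y j = a j)"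
proof
  assume "y \<in> vcoset p a l"
  then obtain u where u: "u \<in> vnbhd p l" "y = vadd p a u"
    by (auto simp: vcoset_def)
  then have "\<forall>j\<le>l. y j = a j"
    using assms(2) by (simp add: vadd_def mem_vnbhd vilenkin_mod)
  then show "y \<in> vilenkin p \<and> (\<forall>j\<le>l. y j = a j)"
    using u assms by (auto simp: mem_vnbhd vadd_in_vilenkin)
next
  assume y: "y \<in> vilenkin p \<and> (\<forall>j\<le>l. y j = a j)"
  then have "vminus p y a \<in> vnbhd p l"
    using assms by (auto simp: mem_vnbhd vminus_in_vilenkin vminus_eq_0_iff)
  then show "y \<in> vcoset p a l"
    unfolding vcoset_def using y by (metis imageI vadd_vminus_cancel)
qed

lemma mem_vcoset_vminus:
  assumes "p > 0" "a \<in> vilenkin p" "y \<in> vilenkin p"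
  shows "y \<in> vcoset p a l \<longleftrightarrow> vminus p y a \<in> vnbhd p l"
  using assms by (auto simp: mem_vcoset mem_vnbhd vminus_in_vilenkin vminus_eq_0_iff)

lemma vcoset_subset: "p > 0 \<Longrightarrow> a \<in> vilenkin p \<Longrightarrow> vcoset p a l \<subseteq> vilenkin p"
  by (auto simp: mem_vcoset)

lemma vcoset_self: "p > 0 \<Longrightarrow> a \<in> vilenkin p \<Longrightarrow> a \<in> vcoset p a l"
  by (auto simp: mem_vcoset)

lemma vcoset_zero: "p > 0 \<Longrightarrow> vcoset p vzero l = vnbhd p l"
  by (auto simp: mem_vcoset zero_in_vilenkin mem_vnbhd)

text \<open>The ultrametric alternative: two cosets are nested or disjoint. It makes the cosets,
  together with the empty set, intersection-stable.\<close>

lemma vcoset_Int: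
  assumes "p > 0" "a \<in> vilenkin p" "b \<in> vilenkin p" "l \<le> m"
  shows "vcoset p a l \<inter> vcoset p b m = (if b \<in> vcoset p a l then vcoset p b m else {})"
  using assms by (auto simp: mem_vcoset)

definition vcosets :: "nat \<Rightarrow> (int \<Rightarrow> int) set set" where
  "vcosets p = {vcoset p x l | x l. x \<in> vilenkin p}"

lemma vcosets_Int:
  assumes "p > 0" "A \<in> vcosets p" "B \<in> vcosets p"
  shows "A \<inter> B \<in> insert {} (vcosets p)"
proof -
  obtain a l b m where ab: "A = vcoset p a l" "B = vcoset p b m" "a \<in> vilenkin p" "b \<in> vilenkin p"
    using assms by (auto simp: vcosets_def)
  show ?thesis
  proof (cases "l \<le> m")
    case True
    then show ?thesis using ab vcoset_Int[of p a b l m] assms by (auto simp: vcosets_def)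
  next
    case False
    then show ?thesis using ab vcoset_Int[of p b a m l] assms by (auto simp: vcosets_def Int_commute)
  qed
qed

lemma Int_stable_vcosets: "p > 0 \<Longrightarrow> Int_stable (insert {} (vcosets p))"
  unfolding Int_stable_def using vcosets_Int by blast

lemma vcosets_Pow: "p > 0 \<Longrightarrow> vcosets p \<subseteq> Pow (vilenkin p)"
  unfolding vcosets_def using vcoset_subset by blast

text \<open>Only the coordinates up to \<open>l\<close> matter, and all of them before some
  \<open>k\<close> vanish, so a starting index, a finite list of digits and \<open>l\<close> encode
  the coset.\<close>

lemma countable_vcosets:
  assumes "p > 0"
  shows "countable (vcosets p)"
proof -
  define F :: "int \<times> int list \<Rightarrow> int \<Rightarrow> int" where
    "F = (\<lambda>(k, xs) j. if k \<le> j \<and> j < k + int (length xs) then xs ! nat (j - k) else 0)"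
  have "\<exists>z l. A = vcoset p (F z) l" if A: "A \<in> vcosets p" for A
  proof -
    obtain a l where a: "A = vcoset p a l" "a \<in> vilenkin p"
      using A by (auto simp: vcosets_def)
    obtain k where k: "\<forall>j<k. a j = 0" using a by (auto simp: vilenkin_iff)
    \<comment> \<open>The digits at positions \<open>k\<close> to \<open>l\<close>; the list is
      empty when \<open>l < k\<close>, and the representative is then zero.\<close>
    let ?xs = "map (\<lambda>i. a (k + int i)) [0..<nat (l + 1 - k)]"
    have F: "F (k, ?xs) j = (if k \<le> j \<and> j \<le> l then a j else 0)" for j
      by (auto simp: F_def)
    have "F (k, ?xs) \<in> vilenkin p"
      unfolding vilenkin_iff F using a assms by (auto simp: vilenkin_iff)
    moreover have "F (k, ?xs) j = a j" if "j \<le> l" for j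
      unfolding F using that k by auto
    ultimately have "A = vcoset p (F (k, ?xs)) l"
      using a assms by (auto simp: mem_vcoset)
    then show ?thesis by blast
  qed
  then have "vcosets p \<subseteq> (\<lambda>(z, l). vcoset p (F z) l) ` UNIV" by force
  then show ?thesis by (rule countable_subset) auto
qed

text \<open>The generating cosets are a base and not just a subbase: by nesting, the finer of two
  cosets around a point lies in both.\<close>

lemma openin_vtopology_vcoset:
  assumes "p > 0" "openin (vtopology p) S" "x \<in> S"
  shows "S \<subseteq> vilenkin p \<and> (\<exists>l. vcoset p x l \<subseteq> S)"
proof -
  have "generate_topology_on (vcosets p) S"
    using assms(2) by (simp add: vtopology_def openin_topology_generated_by_iff vcosets_def)
  then have "S \<subseteq> vilenkin p \<and> (\<forall>x\<in>S. \<exists>l. vcoset p x l \<subseteq> S)"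
  proof induction
    case (Int a b)
    then have sub: "a \<inter> b \<subseteq> vilenkin p" by auto
    have "\<exists>l. vcoset p x l \<subseteq> a \<inter> b" if x: "x \<in> a \<inter> b" for x
    proof -
      obtain l m where "vcoset p x l \<subseteq> a" "vcoset p x m \<subseteq> b" using Int x by blast
      moreover have "vcoset p x (max l m) \<subseteq> vcoset p x l \<inter> vcoset p x m"
        using sub x assms(1) by (auto simp: mem_vcoset subset_iff)
      ultimately show ?thesis by blast
    qed
    then show ?case using sub by blast
  next
    case (Basis s)
    then obtain a l where s: "s = vcoset p a l" "a \<in> vilenkin p" by (auto simp: vcosets_def)
    have *: "vcoset p x l \<subseteq> s" if "x \<in> s" for x
    proof -
      have "x \<in> vilenkin p" using s that assms by (auto simp: mem_vcoset)
      then show ?thesis using s that assms by (auto simp: mem_vcoset)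
    qed
    show ?case using * vcoset_subset[OF assms(1) s(2), of l] s(1) by blast
  qed (auto, blast)
  then show ?thesis using assms by blast
qed

text \<open>Such a set is the union of the cosets inside it, and there are only countably many
  cosets.\<close>

lemma locally_vcoset_in_sigma_sets:
  assumes "p > 0" "S \<subseteq> vilenkin p" "\<And>x. x \<in> S \<Longrightarrow> \<exists>l. vcoset p x l \<subseteq> S"
  shows "S \<in> sigma_sets (vilenkin p) (insert {} (vcosets p))"
proof -
  have "S = \<Union>{C \<in> vcosets p. C \<subseteq> S}"
  proof (intro equalityI subsetI)
    fix x assume "x \<in> S"
    then obtain l where "vcoset p x l \<subseteq> S" "x \<in> vilenkin p"
      using assms by blast
    then show "x \<in> \<Union>{C \<in> vcosets p. C \<subseteq> S}"
      using vcoset_self[OF assms(1)] by (auto simp: vcosets_def)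
  qed auto
  moreover have "countable {C \<in> vcosets p. C \<subseteq> S}"
    using countable_vcosets[OF assms(1)] by (rule countable_subset[rotated]) auto
  ultimately show ?thesis
    by (metis (no_types, lifting) mem_Collect_eq insertI2 sigma_sets.Basic sigma_sets_UNION)
qed

lemma sets_vborel:
  assumes "p > 0"
  shows "sets (vborel p) = sigma_sets (vilenkin p) (insert {} (vcosets p))"
proof -
  have sub: "{S. openin (vtopology p) S} \<subseteq> Pow (vilenkin p)"
    using openin_vtopology_vcoset[OF assms] by auto
  have "sigma_sets (vilenkin p) {S. openin (vtopology p) S} = sigma_sets (vilenkin p) (insert {} (vcosets p))"
  proof (rule sigma_sets_eqI)
    fix S assume "S \<in> {S. openin (vtopology p) S}"
    then show "S \<in> sigma_sets (vilenkin p) (insert {} (vcosets p))"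
      using openin_vtopology_vcoset[OF assms, of S] assms
      by (intro locally_vcoset_in_sigma_sets) auto
  next
    fix C assume "C \<in> insert {} (vcosets p)"
    then have "openin (vtopology p) C"
      unfolding vtopology_def openin_topology_generated_by_iff vcosets_def
      by (auto intro: generate_topology_on.Empty generate_topology_on.Basis)
    then show "C \<in> sigma_sets (vilenkin p) {S. openin (vtopology p) S}"
      by (intro sigma_sets.Basic) simp
  qed
  then show ?thesis
    unfolding vborel_def using sub by (simp add: sets_measure_of)
qed

lemma space_vborel: "space (vborel p) = vilenkin p"
  by (simp add: vborel_def space_measure_of_conv)

lemma Un_vnbhd: "(\<Union>k::nat. vnbhd p (- int k)) = vilenkin p"
proof (intro equalityI subsetI)
  fix x assume x: "x \<in> vilenkin p"
  then obtain k where "\<forall>j<k. x j = 0" by (auto simp: vilenkin_iff)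
  then have "x \<in> vnbhd p (- int (nat (1 - k)))"
    using x by (auto simp: mem_vnbhd)
  then show "x \<in> (\<Union>k::nat. vnbhd p (- int k))" by blast
qed (auto simp: mem_vnbhd)

lemma vnbhd_mono: "m \<le> l \<Longrightarrow> vnbhd p l \<subseteq> vnbhd p m"
  by (auto simp: mem_vnbhd)

lemma incseq_vnbhd: "incseq (\<lambda>k::nat. vnbhd p (- int k))"
  by (auto simp: incseq_def intro!: vnbhd_mono)

lemma vcoset_in_vborel: "p > 0 \<Longrightarrow> a \<in> vilenkin p \<Longrightarrow> vcoset p a l \<in> sets (vborel p)"
  by (subst sets_vborel) (auto simp: vcosets_def)

section \<open>Measurability of locally constant functions, translations and shifts\<close>

lemma borel_measurable_locally_constant:
  fixes f :: "(int \<Rightarrow> int) \<Rightarrow> 'a :: topological_space"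
  assumes "p > 0" "\<And>x. x \<in> vilenkin p \<Longrightarrow> \<exists>l. \<forall>y\<in>vcoset p x l. f y = f x"
  shows "f \<in> borel_measurable (vborel p)"
proof (rule measurableI)
  fix B :: "'a set"
  have "f -` B \<inter> vilenkin p \<in> sigma_sets (vilenkin p) (insert {} (vcosets p))"
  proof (rule locally_vcoset_in_sigma_sets[OF assms(1)])
    fix x assume x: "x \<in> f -` B \<inter> vilenkin p"
    then obtain l where "\<forall>y\<in>vcoset p x l. f y = f x" using assms(2) by blast
    then show "\<exists>l. vcoset p x l \<subseteq> f -` B \<inter> vilenkin p"
      using x vcoset_subset[OF assms(1), of x l] by auto
  qed auto
  then show "f -` B \<inter> space (vborel p) \<in> sets (vborel p)"
    by (simp add: space_vborel sets_vborel[OF assms(1)])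
qed simp

lemma measurable_vborelI:
  assumes "p > 0" "f \<in> space M \<rightarrow> vilenkin p"
    and "\<And>a l. a \<in> vilenkin p \<Longrightarrow> f -` vcoset p a l \<inter> space M \<in> sets M"
  shows "f \<in> M \<rightarrow>\<^sub>M vborel p"
proof -
  have "f \<in> M \<rightarrow>\<^sub>M sigma (vilenkin p) (insert {} (vcosets p))"
    using assms by (intro measurable_measure_of) (auto simp: vcosets_def mem_vcoset)
  moreover have "sets (sigma (vilenkin p) (insert {} (vcosets p))) = sets (vborel p)"
    using vcosets_Pow[of p] assms by (simp add: sets_vborel)
  ultimately show ?thesis using measurable_cong_sets by blast
qed

lemma vadd_vimage_vcoset:
  assumes "p > 0" "a \<in> vilenkin p" "b \<in> vilenkin p"
  shows "vadd p a -` vcoset p b l \<inter> vilenkin p = vcoset p (vminus p b a) l"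
proof -
  have "y \<in> vadd p a -` vcoset p b l \<inter> vilenkin p \<longleftrightarrow> y \<in> vcoset p (vminus p b a) l" for y
  proof (cases "y \<in> vilenkin p")
    case True
    have "vminus p (vadd p a y) b = vminus p y (vminus p b a)"
      by (simp add: vminus_def vadd_def mod_simps) (simp add: algebra_simps)
    then show ?thesis
      using True assms by (simp add: mem_vcoset_vminus vadd_in_vilenkin vminus_in_vilenkin)
  qed (use assms in \<open>auto simp: mem_vcoset vminus_in_vilenkin\<close>)
  then show ?thesis by blast
qed

lemma measurable_vadd:
  assumes "p > 0" "a \<in> vilenkin p"
  shows "vadd p a \<in> vborel p \<rightarrow>\<^sub>M vborel p"
proof (rule measurable_vborelI[OF assms(1)])
  show "vadd p a \<in> space (vborel p) \<rightarrow> vilenkin p"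
    using assms by (simp add: space_vborel vadd_in_vilenkin)
  show "vadd p a -` vcoset p b l \<inter> space (vborel p) \<in> sets (vborel p)" if "b \<in> vilenkin p" for b l
    using assms that by (simp only: space_vborel vadd_vimage_vcoset vcoset_in_vborel vminus_in_vilenkin)
qed

lemma vshift_in_vilenkin [simp]: "vshift n x \<in> vilenkin p \<longleftrightarrow> x \<in> vilenkin p"
proof -
  have *: "vshift n x \<in> vilenkin p" if x: "x \<in> vilenkin p" for n x
  proof -
    obtain k where "\<forall>j<k. x j = 0" using x by (auto simp: vilenkin_iff)
    then have "\<forall>j<k - n. vshift n x j = 0" by (simp add: vshift_def)
    moreover have "\<forall>j. 0 \<le> vshift n x j \<and> vshift n x j < int p"
      using x by (simp add: vilenkin_iff vshift_def)
    ultimately show ?thesis unfolding vilenkin_iff by blast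
  qed
  have "vshift (- n) (vshift n x) = x" by (simp add: vshift_def)
  then show ?thesis using *[of x n] *[of "vshift n x" "- n"] by metis
qed

lemma vshift_vshift [simp]: "vshift m (vshift n x) = vshift (m + n) x"
  by (simp add: vshift_def algebra_simps)

lemma vshift_0 [simp]: "vshift 0 x = x"
  by (simp add: vshift_def)

lemma mem_vshift_image: "x \<in> vshift n ` A \<longleftrightarrow> vshift (- n) x \<in> A"
  by (metis (no_types, lifting) add.left_inverse add.right_inverse image_iff vshift_0 vshift_vshift)

lemma vshift_vimage_vcoset:
  assumes "p > 0" "a \<in> vilenkin p"
  shows "vshift n -` vcoset p a l = vcoset p (vshift (- n) a) (l + n)"
proof -
  have "(\<forall>j\<le>l. x (j + n) = a j) \<longleftrightarrow> (\<forall>j\<le>l + n. x j = a (j - n))" for x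
    by (metis add.commute add_diff_cancel_right' diff_add_cancel add_le_cancel_right le_diff_eq)
  then have "x \<in> vshift n -` vcoset p a l \<longleftrightarrow> x \<in> vcoset p (vshift (- n) a) (l + n)" for x
    using assms by (simp add: mem_vcoset) (simp add: vshift_def)
  then show ?thesis by blast
qed

lemma measurable_vshift: 
  assumes "p > 0"
  shows "vshift n \<in> vborel p \<rightarrow>\<^sub>M vborel p"
proof (rule measurable_vborelI[OF assms])
  fix a l assume a: "a \<in> vilenkin p"
  have "vshift n -` vcoset p a l \<inter> vilenkin p = vcoset p (vshift (- n) a) (l + n)"
    using vshift_vimage_vcoset[OF assms a] vcoset_subset[OF assms, of "vshift (- n) a" "l + n"] a by simp blast
  then show "vshift n -` vcoset p a l \<inter> space (vborel p) \<in> sets (vborel p)"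
    using assms a by (simp add: space_vborel vcoset_in_vborel)
qed (auto simp: space_vborel)

subsection \<open>Square-integrable functions\<close>

lemmas LINT_cong = Bochner_Integration.integral_cong

abbreviation "l1_dist N f g \<equiv> LINT x|N. norm (f x - g x :: complex)"
abbreviation "l2_dist N f g \<equiv> l2_norm N (\<lambda>x. f x - g x)"
abbreviation "lincomb J c e x \<equiv> \<Sum>i\<in>J. c i * e i x :: complex"
abbreviation "l2_err N f J c e \<equiv> l2_norm N (\<lambda>x. f x - lincomb J c e x)"

lemma L2_measurable [measurable_dest]: "f \<in> L2 M \<Longrightarrow> f \<in> borel_measurable M"
  and L2_integrable_square: "f \<in> L2 M \<Longrightarrow> integrable M (\<lambda>x. (norm (f x))\<^sup>2)"
  by (simp_all add: L2_def)

lemma L2_cong: "(\<And>x. x \<in> space M \<Longrightarrow> f x = g x) \<Longrightarrow> f \<in> L2 M \<longleftrightarrow> g \<in> L2 M"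
  unfolding L2_def using measurable_cong[of M f g borel] Bochner_Integration.integrable_cong[of M M "\<lambda>x. (norm (f x))\<^sup>2" "\<lambda>x. (norm (g x))\<^sup>2"]
  by simp

lemma l2_inner_cong:
  "(\<And>x. x \<in> space M \<Longrightarrow> f x = f' x) \<Longrightarrow> (\<And>x. x \<in> space M \<Longrightarrow> g x = g' x)
    \<Longrightarrow> l2_inner M f g = l2_inner M f' g'"
  unfolding l2_inner_def by (intro LINT_cong) auto

lemma l2_norm_cong: "(\<And>x. x \<in> space M \<Longrightarrow> f x = g x) \<Longrightarrow> l2_norm M f = l2_norm M g"
  unfolding l2_norm_def by (simp cong: LINT_cong)

lemma norm_add_square_le: "(norm (x + y :: 'a :: real_normed_vector))\<^sup>2 \<le> 2 * (norm x)\<^sup>2 + 2 * (norm y)\<^sup>2"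
proof -
  have "(norm (x + y))\<^sup>2 \<le> (norm x + norm y)\<^sup>2"
    by (intro power_mono norm_triangle_ineq) simp
  also have "\<dots> \<le> 2 * (norm x)\<^sup>2 + 2 * (norm y)\<^sup>2"
    using zero_le_power2[of "norm x - norm y"] by (simp add: power2_eq_square algebra_simps)
  finally show ?thesis .
qed

lemma L2_add:
  assumes "f \<in> L2 M" "g \<in> L2 M" shows "(\<lambda>x. f x + g x) \<in> L2 M"
proof -
  have "integrable M (\<lambda>x. (norm (f x + g x))\<^sup>2)"
  proof (rule Bochner_Integration.integrable_bound)
    show "integrable M (\<lambda>x. 2 * (norm (f x))\<^sup>2 + 2 * (norm (g x))\<^sup>2)"
      using assms by (auto simp: L2_def)
    show "AE x in M. norm ((norm (f x + g x))\<^sup>2) \<le> norm (2 * (norm (f x))\<^sup>2 + 2 * (norm (g x))\<^sup>2)"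
      using norm_add_square_le by (intro AE_I2) simp
  qed (use assms in \<open>measurable; auto simp: L2_def\<close>)
  then show ?thesis using assms by (auto simp: L2_def)
qed

lemma L2_cmult: "f \<in> L2 M \<Longrightarrow> (\<lambda>x. c * f x) \<in> L2 M"
  by (auto simp: L2_def norm_mult power_mult_distrib)

lemma L2_zero [simp]: "(\<lambda>x. 0) \<in> L2 M"
  by (simp add: L2_def)

lemma L2_diff: "f \<in> L2 M \<Longrightarrow> g \<in> L2 M \<Longrightarrow> (\<lambda>x. f x - g x) \<in> L2 M"
  using L2_add[of f M "\<lambda>x. -1 * g x"] L2_cmult[of g M "-1"] by simp

lemma L2_sum: "(\<And>i. i \<in> I \<Longrightarrow> f i \<in> L2 M) \<Longrightarrow> (\<lambda>x. \<Sum>i\<in>I. f i x) \<in> L2 M"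
  by (induction I rule: infinite_finite_induct) (auto intro: L2_add)

lemma L2_indicator: "A \<in> sets M \<Longrightarrow> emeasure M A < \<infinity> \<Longrightarrow> indicator A \<in> L2 M"
proof -
  assume A: "A \<in> sets M" "emeasure M A < \<infinity>"
  have "(\<lambda>x. (norm (indicator A x :: complex))\<^sup>2) = indicator A"
    by (auto simp: indicator_def)
  then show ?thesis using A by (auto simp: L2_def)
qed

lemma emeasure_finite_of_L2_indicator:
  assumes "A \<in> sets M" "indicator A \<in> L2 M" shows "emeasure M A < \<infinity>"
proof -
  have "(\<lambda>x. (norm (indicator A x :: complex))\<^sup>2) = indicator A"
    by (auto simp: indicator_def)
  then have "integrable M (indicator A :: _ \<Rightarrow> real)" using assms by (simp add: L2_def)
  then show ?thesis using assms sets.sets_into_space[OF assms(1)] by (simp add: integrable_indicator_iff Int_absorb2)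
qed

lemma emeasure_subset_finite:
  "A \<subseteq> B \<Longrightarrow> B \<in> sets N \<Longrightarrow> emeasure N B < \<infinity> \<Longrightarrow> emeasure N A < \<infinity>"
  by (meson emeasure_mono le_less_trans)

lemma measure_Diff_incseq:
  assumes A: "\<And>n::nat. A n \<in> sets N" "incseq A" and fin: "emeasure N (\<Union>n. A n) < \<infinity>"
  shows "(\<lambda>n. measure N ((\<Union>n. A n) - A n)) \<longlonglongrightarrow> 0"
proof -
  let ?U = "\<Union>n. A n"
  have U: "?U \<in> sets N" using A(1) by auto
  have finA: "emeasure N (A n) \<noteq> \<infinity>" for n
    using emeasure_subset_finite[OF _ U fin, of "A n"] by (intro less_imp_neq) auto
  have "(\<lambda>n. measure N (A n)) \<longlonglongrightarrow> measure N ?U"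
    using A less_imp_neq[OF fin] by (intro Lim_measure_incseq) auto
  then have "(\<lambda>n. measure N ?U - measure N (A n)) \<longlonglongrightarrow> measure N ?U - measure N ?U"
    by (intro tendsto_intros)
  moreover have "measure N (?U - A n) = measure N ?U - measure N (A n)" for n
    using A(1) U less_imp_neq[OF fin] finA[of n] by (intro measure_Diff) auto
  ultimately show ?thesis by simp
qed

lemma l2_norm_nonneg [simp]: "0 \<le> l2_norm M f"
  by (simp add: l2_norm_def)

lemma l2_norm_square: "(l2_norm M f)\<^sup>2 = (LINT x|M. (norm (f x))\<^sup>2)"
  by (simp add: l2_norm_def)

lemma l2_inner_self: "l2_inner M f f = of_real ((l2_norm M f)\<^sup>2)"
proof -
  have "f x * cnj (f x) = complex_of_real ((norm (f x))\<^sup>2)" for x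
    by (rule complex_norm_square[symmetric])
  then show ?thesis by (simp only: l2_inner_def l2_norm_square integral_complex_of_real)
qed

lemma l2_norm_eqI: "l2_inner M f f = l2_inner M g g \<Longrightarrow> l2_norm M f = l2_norm M g"
  by (rule power2_eq_imp_eq) (simp_all only: l2_inner_self of_real_eq_iff l2_norm_nonneg)

text \<open>Lets \<open>eps / (norm c + 1)\<close> serve as tolerance when scaling by
  \<open>c\<close>; the added 1 covers \<open>c = 0\<close>.\<close>

lemma norm_mult_less:
  "eps > 0 \<Longrightarrow> r < eps / (norm c + 1) \<Longrightarrow> norm c * r < (eps :: real)"
  using mult_left_mono[of r "eps / (norm c + 1)" "norm c"]
    mult_strict_right_mono[of "norm c" "norm c + 1" "eps / (norm c + 1)"] add_nonneg_pos[of "norm c" 1]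
  by simp

lemma l2_norm_cmult: "l2_norm M (\<lambda>x. c * f x) = norm c * l2_norm M f"
  unfolding l2_norm_def by (simp add: norm_mult power_mult_distrib real_sqrt_mult)

lemma l2_norm_zero [simp]: "l2_norm M (\<lambda>x. 0) = 0"
  by (simp add: l2_norm_def)

lemma l2_norm_minus_commute: "l2_dist M f g = l2_dist M g f"
  by (simp add: l2_norm_def norm_minus_commute)

lemma L2_norm_mult_integrable:
  assumes "f \<in> L2 M" "g \<in> L2 M" shows "integrable M (\<lambda>x. norm (f x) * norm (g x))"
proof (rule Bochner_Integration.integrable_bound)
  show "integrable M (\<lambda>x. (norm (f x))\<^sup>2 + (norm (g x))\<^sup>2)"
    using assms by (auto simp: L2_def)
  have "norm (f x) * norm (g x) \<le> (norm (f x))\<^sup>2 + (norm (g x))\<^sup>2" for x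
  proof -
    have "2 * (norm (f x) * norm (g x)) \<le> (norm (f x))\<^sup>2 + (norm (g x))\<^sup>2"
      using sum_squares_bound[of "norm (f x)" "norm (g x)"] by (simp add: mult.assoc)
    moreover have "0 \<le> norm (f x) * norm (g x)" by simp
    ultimately show ?thesis by linarith
  qed
  then show "AE x in M. norm (norm (f x) * norm (g x)) \<le> norm ((norm (f x))\<^sup>2 + (norm (g x))\<^sup>2)"
    by (intro AE_I2) simp
qed (use assms in \<open>auto simp: L2_def\<close>)

lemma L2_mult_cnj_integrable:
  assumes "f \<in> L2 M" "g \<in> L2 M" shows "integrable M (\<lambda>x. f x * cnj (g x))"
  using L2_norm_mult_integrable[OF assms]
proof (rule Bochner_Integration.integrable_bound)
  have "g \<in> borel_measurable M" using assms by (simp add: L2_def)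
  then have "(\<lambda>x. cnj (g x)) \<in> borel_measurable M"
    by (rule borel_measurable_continuous_on[rotated]) (intro continuous_intros)
  then show "(\<lambda>x. f x * cnj (g x)) \<in> borel_measurable M"
    using assms by (auto simp: L2_def)
qed (auto simp: norm_mult)

text \<open>Cauchy-Schwarz by the discriminant argument: the integral of
  \<open>(s * norm (f x) - norm (g x))\<^sup>2\<close> is a quadratic in \<open>s\<close> that is
  never negative.\<close>

lemma integral_norm_mult_le:
  assumes f: "f \<in> L2 M" and g: "g \<in> L2 M"
  shows "(LINT x|M. norm (f x) * norm (g x)) \<le> l2_norm M f * l2_norm M g"
proof -
  define F G I where "F = (LINT x|M. (norm (f x))\<^sup>2)" and "G = (LINT x|M. (norm (g x))\<^sup>2)"
    and "I = (LINT x|M. norm (f x) * norm (g x))"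
  have nn: "F \<ge> 0" "G \<ge> 0" "I \<ge> 0" unfolding F_def G_def I_def by simp_all
  have ge: "0 \<le> s\<^sup>2 * F - 2 * s * I + G" for s :: real
  proof -
    have "0 \<le> (LINT x|M. (s * norm (f x) - norm (g x))\<^sup>2)" by simp
    also have "\<dots> = (LINT x|M. s\<^sup>2 * (norm (f x))\<^sup>2 - 2 * s * (norm (f x) * norm (g x)) + (norm (g x))\<^sup>2)"
      by (intro LINT_cong) (auto simp: power2_eq_square algebra_simps)
    also have "\<dots> = s\<^sup>2 * F - 2 * s * I + G"
      unfolding F_def G_def I_def
      using L2_integrable_square[OF f] L2_integrable_square[OF g] L2_norm_mult_integrable[OF f g] by simp
    finally show ?thesis .
  qed
  have "I\<^sup>2 \<le> F * G"
  proof (cases "F = 0")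
    case True
    have "I = 0"
    proof (rule ccontr)
      assume "I \<noteq> 0"
      \<comment> \<open>With \<open>F = 0\<close> the quadratic is affine in \<open>s\<close>; this
        value of \<open>s\<close> makes it -1.\<close>
      then show False using ge[of "(G + 1) / (2 * I)"] True by simp
    qed
    then show ?thesis using nn by simp
  next
    case False
    \<comment> \<open>The minimum of the quadratic is attained at \<open>I / F\<close>.\<close>
    then have "0 \<le> G - I\<^sup>2 / F" using ge[of "I / F"] by (simp add: power2_eq_square field_simps)
    then show ?thesis using False nn by (simp add: field_simps)
  qed
  then have "sqrt (I\<^sup>2) \<le> sqrt (F * G)" by (rule real_sqrt_le_mono)
  then show ?thesis using nn by (simp add: real_sqrt_mult F_def G_def I_def l2_norm_def)
qed

lemma l2_Cauchy_Schwarz: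
  assumes "f \<in> L2 M" "g \<in> L2 M"
  shows "norm (l2_inner M f g) \<le> l2_norm M f * l2_norm M g"
proof -
  have "norm (l2_inner M f g) \<le> (LINT x|M. norm (f x * cnj (g x)))"
    unfolding l2_inner_def by simp
  also have "\<dots> = (LINT x|M. norm (f x) * norm (g x))"
    by (simp add: norm_mult)
  also have "\<dots> \<le> l2_norm M f * l2_norm M g"
    using assms by (rule integral_norm_mult_le)
  finally show ?thesis .
qed

lemma l2_norm_triangle:
  assumes f: "f \<in> L2 M" and g: "g \<in> L2 M"
  shows "l2_norm M (\<lambda>x. f x + g x) \<le> l2_norm M f + l2_norm M g"
proof (rule power2_le_imp_le)
  have "(l2_norm M (\<lambda>x. f x + g x))\<^sup>2 = (LINT x|M. (norm (f x + g x))\<^sup>2)"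
    by (rule l2_norm_square)
  also have "\<dots> \<le> (LINT x|M. (norm (f x))\<^sup>2 + 2 * (norm (f x) * norm (g x)) + (norm (g x))\<^sup>2)"
  proof (rule integral_mono)
    show "integrable M (\<lambda>x. (norm (f x + g x))\<^sup>2)"
      using L2_integrable_square[OF L2_add[OF f g]] .
    show "integrable M (\<lambda>x. (norm (f x))\<^sup>2 + 2 * (norm (f x) * norm (g x)) + (norm (g x))\<^sup>2)"
      using L2_integrable_square[OF f] L2_integrable_square[OF g] L2_norm_mult_integrable[OF f g] by simp
    fix x
    have "(norm (f x + g x))\<^sup>2 \<le> (norm (f x) + norm (g x))\<^sup>2"
      by (intro power_mono norm_triangle_ineq) simp
    then show "(norm (f x + g x))\<^sup>2 \<le> (norm (f x))\<^sup>2 + 2 * (norm (f x) * norm (g x)) + (norm (g x))\<^sup>2"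
      by (simp add: power2_sum)
  qed
  also have "\<dots> = (l2_norm M f)\<^sup>2 + 2 * (LINT x|M. norm (f x) * norm (g x)) + (l2_norm M g)\<^sup>2"
    using L2_integrable_square[OF f] L2_integrable_square[OF g] L2_norm_mult_integrable[OF f g]
    by (simp add: l2_norm_square)
  also have "\<dots> \<le> (l2_norm M f)\<^sup>2 + 2 * (l2_norm M f * l2_norm M g) + (l2_norm M g)\<^sup>2"
    using integral_norm_mult_le[OF f g] by simp
  also have "\<dots> = (l2_norm M f + l2_norm M g)\<^sup>2"
    by (simp add: power2_sum)
  finally show "(l2_norm M (\<lambda>x. f x + g x))\<^sup>2 \<le> (l2_norm M f + l2_norm M g)\<^sup>2" .
qed simp

lemma l2_norm_triangle_diff:
  assumes "f \<in> L2 M" "g \<in> L2 M" "h \<in> L2 M"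
  shows "l2_dist M f h \<le> l2_dist M f g + l2_dist M g h"
  using l2_norm_triangle[OF L2_diff[OF assms(1,2)] L2_diff[OF assms(2,3)]] by simp

lemma l2_inner_add_left:
  "f \<in> L2 M \<Longrightarrow> g \<in> L2 M \<Longrightarrow> h \<in> L2 M \<Longrightarrow>
    l2_inner M (\<lambda>x. f x + g x) h = l2_inner M f h + l2_inner M g h"
  unfolding l2_inner_def
  using L2_mult_cnj_integrable[of f M h] L2_mult_cnj_integrable[of g M h] by (simp add: distrib_right)

lemma l2_inner_cmult_left: "l2_inner M (\<lambda>x. c * f x) g = c * l2_inner M f g"
  unfolding l2_inner_def by (simp add: mult.assoc)

lemma l2_inner_cnj: "cnj (l2_inner M f g) = l2_inner M g f"
  unfolding l2_inner_def by (subst Bochner_Integration.integral_cnj[symmetric]) (simp add: mult.commute)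

lemma l2_inner_add_right:
  assumes "f \<in> L2 M" "g \<in> L2 M" "h \<in> L2 M"
  shows "l2_inner M h (\<lambda>x. f x + g x) = l2_inner M h f + l2_inner M h g"
  using l2_inner_add_left[OF assms] by (metis complex_cnj_add l2_inner_cnj)

lemma l2_inner_cmult_right: "l2_inner M f (\<lambda>x. c * g x) = cnj c * l2_inner M f g"
  using l2_inner_cmult_left[of M c g f] by (metis complex_cnj_mult l2_inner_cnj)

lemma l2_inner_zero [simp]: "l2_inner M (\<lambda>x. 0) g = 0" "l2_inner M f (\<lambda>x. 0) = 0"
  by (simp_all add: l2_inner_def)

lemma l2_inner_diff_left:
  "f \<in> L2 M \<Longrightarrow> g \<in> L2 M \<Longrightarrow> h \<in> L2 M \<Longrightarrow>
    l2_inner M (\<lambda>x. f x - g x) h = l2_inner M f h - l2_inner M g h"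
  using l2_inner_add_left[of f M "\<lambda>x. -1 * g x" h] L2_cmult[of g M "-1"] l2_inner_cmult_left[of M "-1" g h]
  by simp

lemma l2_inner_diff_right:
  "f \<in> L2 M \<Longrightarrow> g \<in> L2 M \<Longrightarrow> h \<in> L2 M \<Longrightarrow>
    l2_inner M h (\<lambda>x. f x - g x) = l2_inner M h f - l2_inner M h g"
  using l2_inner_diff_left[of f M g h] by (metis complex_cnj_diff l2_inner_cnj)

lemma l2_inner_sum_right:
  "f \<in> L2 M \<Longrightarrow> (\<And>i. i \<in> I \<Longrightarrow> g i \<in> L2 M) \<Longrightarrow>
    l2_inner M f (\<lambda>x. \<Sum>i\<in>I. g i x) = (\<Sum>i\<in>I. l2_inner M f (g i))"
  by (induction I rule: infinite_finite_induct) (auto simp: l2_inner_add_right L2_sum)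

lemma l2_norm_diff_le:
  assumes "f \<in> L2 M" "g \<in> L2 M"
  shows "\<bar>l2_norm M f - l2_norm M g\<bar> \<le> l2_dist M f g"
  using l2_norm_triangle[OF L2_diff[OF assms] assms(2)]
    l2_norm_triangle[OF L2_diff[OF assms(2,1)] assms(1)] l2_norm_minus_commute[of M f g] by simp

text \<open>Joint continuity of the inner product, by splitting the difference into one term per
  argument. It carries Plancherel from steps to their limits.\<close>

lemma l2_inner_tendsto:
  assumes f: "f \<in> L2 M" "\<And>n. f' n \<in> L2 M" "(\<lambda>n. l2_dist M (f' n) f) \<longlonglongrightarrow> 0"
    and g: "g \<in> L2 M" "\<And>n. g' n \<in> L2 M" "(\<lambda>n. l2_dist M (g' n) g) \<longlonglongrightarrow> 0"
  shows "(\<lambda>n. l2_inner M (f' n) (g' n)) \<longlonglongrightarrow> l2_inner M f g"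
proof -
  let ?d = "\<lambda>n. l2_dist M (f' n) f" and ?e = "\<lambda>n. l2_dist M (g' n) g"
  have le: "norm (l2_inner M (f' n) (g' n) - l2_inner M f g) \<le> ?d n * (?e n + l2_norm M g) + l2_norm M f * ?e n" for n
  proof -
    have "l2_inner M (f' n) (g' n) - l2_inner M f g
        = l2_inner M (\<lambda>x. f' n x - f x) (g' n) + l2_inner M f (\<lambda>x. g' n x - g x)"
      using f g by (simp add: l2_inner_diff_left l2_inner_diff_right)
    also have "norm \<dots> \<le> ?d n * l2_norm M (g' n) + l2_norm M f * ?e n"
      using l2_Cauchy_Schwarz[OF L2_diff[OF f(2) f(1)] g(2), of n n]
        l2_Cauchy_Schwarz[OF f(1) L2_diff[OF g(2) g(1)], of n]
      by (intro norm_triangle_mono)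
    also have "l2_norm M (g' n) \<le> ?e n + l2_norm M g"
      using l2_norm_diff_le[OF g(2) g(1), of n] by simp
    finally show ?thesis by (simp add: mult_left_mono)
  qed
  have "(\<lambda>n. ?d n * (?e n + l2_norm M g) + l2_norm M f * ?e n) \<longlonglongrightarrow> 0 * (0 + l2_norm M g) + l2_norm M f * 0"
    by (intro tendsto_intros f g)
  then have "(\<lambda>n. ?d n * (?e n + l2_norm M g) + l2_norm M f * ?e n) \<longlonglongrightarrow> 0" by simp
  with always_eventually[OF allI[OF le]] have "(\<lambda>n. l2_inner M (f' n) (g' n) - l2_inner M f g) \<longlonglongrightarrow> 0"
    by (rule Lim_null_comparison)
  then show ?thesis by (simp add: LIM_zero_iff)
qed

section \<open>Closed linear spans\<close>

definition l2_span :: "'a measure \<Rightarrow> 'i set \<Rightarrow> ('i \<Rightarrow> 'a \<Rightarrow> complex) \<Rightarrow> ('a \<Rightarrow> complex) set" where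
  "l2_span M I e = {f \<in> L2 M. \<forall>eps>0. \<exists>J c. finite J \<and> J \<subseteq> I \<and>
        l2_err M f J c e < eps}"

lemma l2_spanI:
  assumes "f \<in> L2 M"
    and "\<And>eps. eps > 0 \<Longrightarrow> \<exists>J c. finite J \<and> J \<subseteq> I \<and> l2_err M f J c e < eps"
  shows "f \<in> l2_span M I e"
  using assms by (auto simp: l2_span_def)

lemma l2_spanE:
  assumes "f \<in> l2_span M I e" "eps > 0"
  obtains J c where "finite J" "J \<subseteq> I" "l2_err M f J c e < eps"
  using assms by (auto simp: l2_span_def)

lemma l2_span_L2: "f \<in> l2_span M I e \<Longrightarrow> f \<in> L2 M"
  by (simp add: l2_span_def)

text \<open>\<open>l2_span\<close> copies the approximation clause of
  \<open>orthonormal_basis_L2\<close>, so completeness turns into an inclusion and can be attacked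
  by closure properties of the span.\<close>

lemma orthonormal_basis_L2_iff:
  "orthonormal_basis_L2 M I e \<longleftrightarrow> (\<forall>i\<in>I. e i \<in> L2 M) \<and>
     (\<forall>i\<in>I. \<forall>j\<in>I. l2_inner M (e i) (e j) = (if i = j then 1 else 0)) \<and> L2 M \<subseteq> l2_span M I e"
  by (auto simp: orthonormal_basis_L2_def l2_span_def subset_iff)

lemma l2_span_sum:
  assumes "\<And>i. i \<in> I \<Longrightarrow> e i \<in> L2 M" "finite J" "J \<subseteq> I"
  shows "(\<lambda>x. \<Sum>i\<in>J. c i * e i x) \<in> l2_span M I e"
proof (rule l2_spanI)
  show "(\<lambda>x. \<Sum>i\<in>J. c i * e i x) \<in> L2 M"
    using assms by (intro L2_sum L2_cmult) auto
qed (use assms in \<open>auto intro!: exI[of _ J] exI[of _ c]\<close>)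

lemma l2_span_add:
  assumes e: "\<And>i. i \<in> I \<Longrightarrow> e i \<in> L2 M"
    and f: "f \<in> l2_span M I e" and g: "g \<in> l2_span M I e"
  shows "(\<lambda>x. f x + g x) \<in> l2_span M I e"
proof (rule l2_spanI)
  show "(\<lambda>x. f x + g x) \<in> L2 M" using f g by (intro L2_add l2_span_L2)
  fix eps :: real assume "eps > 0"
  then have eps: "eps / 2 > 0" by simp
  obtain J c where J: "finite J" "J \<subseteq> I" "l2_err M f J c e < eps / 2"
    using f eps by (rule l2_spanE)
  obtain K d where K: "finite K" "K \<subseteq> I" "l2_err M g K d e < eps / 2"
    using g eps by (rule l2_spanE)
  \<comment> \<open>\<open>J\<close> and \<open>K\<close> may overlap; on the union the two
    coefficient families are added after extension by 0.\<close>
  define b where "b i = (if i \<in> J then c i else 0) + (if i \<in> K then d i else 0)" for i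
  have b: "(\<Sum>i\<in>J \<union> K. b i * e i x) = lincomb J c e x + lincomb K d e x" for x
  proof -
    have "(\<Sum>i\<in>J \<union> K. b i * e i x) = (\<Sum>i\<in>J \<union> K. if i \<in> J then c i * e i x else 0) + (\<Sum>i\<in>J \<union> K. if i \<in> K then d i * e i x else 0)"
      unfolding sum.distrib[symmetric] by (intro sum.cong) (auto simp: b_def algebra_simps)
    also have "\<dots> = (\<Sum>i\<in>(J \<union> K) \<inter> J. c i * e i x) + (\<Sum>i\<in>(J \<union> K) \<inter> K. d i * e i x)"
      using J K by (simp only: sum.inter_restrict finite_Un)
    finally show ?thesis by (simp add: Int_absorb1)
  qed
  have "l2_norm M (\<lambda>x. (f x - lincomb J c e x) + (g x - lincomb K d e x)) < eps"
    using l2_norm_triangle[of "\<lambda>x. f x - lincomb J c e x" M "\<lambda>x. g x - lincomb K d e x"] J K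
      L2_diff[OF l2_span_L2[OF f] l2_span_L2[OF l2_span_sum[of I e M J c]]]
      L2_diff[OF l2_span_L2[OF g] l2_span_L2[OF l2_span_sum[of I e M K d]]] e by simp
  also have "(\<lambda>x. (f x - lincomb J c e x) + (g x - lincomb K d e x))
     = (\<lambda>x. f x + g x - (\<Sum>i\<in>J \<union> K. b i * e i x))"
    by (simp add: b fun_eq_iff)
  finally show "\<exists>J c. finite J \<and> J \<subseteq> I \<and> l2_norm M (\<lambda>x. f x + g x - lincomb J c e x) < eps"
    using J K by (intro exI[of _ "J \<union> K"] exI[of _ b]) auto
qed

lemma l2_span_cmult:
  assumes f: "f \<in> l2_span M I e"
  shows "(\<lambda>x. a * f x) \<in> l2_span M I e"
proof (rule l2_spanI)
  show "(\<lambda>x. a * f x) \<in> L2 M" using f by (intro L2_cmult l2_span_L2)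
  fix eps :: real assume "eps > 0"
  then have eps: "eps / (norm a + 1) > 0" by (simp add: add_nonneg_pos)
  obtain J c where J: "finite J" "J \<subseteq> I" "l2_err M f J c e < eps / (norm a + 1)"
    using f eps by (rule l2_spanE)
  have "l2_norm M (\<lambda>x. a * f x - (\<Sum>i\<in>J. (a * c i) * e i x)) = l2_norm M (\<lambda>x. a * (f x - lincomb J c e x))"
    by (simp add: right_diff_distrib sum_distrib_left mult.assoc)
  also have "\<dots> = norm a * l2_err M f J c e"
    by (rule l2_norm_cmult)
  also have "\<dots> < eps" using norm_mult_less[OF \<open>eps > 0\<close> J(3)] .
  finally show "\<exists>J c. finite J \<and> J \<subseteq> I \<and> l2_norm M (\<lambda>x. a * f x - lincomb J c e x) < eps"
    using J by (intro exI[of _ J] exI[of _ "\<lambda>i. a * c i"]) auto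
qed

lemma l2_span_closed:
  assumes e: "\<And>i. i \<in> I \<Longrightarrow> e i \<in> L2 M" and f: "f \<in> L2 M"
    and lim: "\<And>eps. eps > 0 \<Longrightarrow> \<exists>g\<in>l2_span M I e. l2_dist M f g < eps"
  shows "f \<in> l2_span M I e"
proof (rule l2_spanI[OF f])
  fix eps :: real assume "eps > 0"
  then have eps: "eps / 2 > 0" by simp
  obtain g where g: "g \<in> l2_span M I e" "l2_dist M f g < eps / 2"
    using lim[OF eps] by blast
  obtain J c where J: "finite J" "J \<subseteq> I" "l2_err M g J c e < eps / 2"
    using g(1) eps by (rule l2_spanE)
  have "l2_err M f J c e < eps"
    using l2_norm_triangle_diff[OF f l2_span_L2[OF g(1)] l2_span_L2[OF l2_span_sum[of I e M J c]]]
      g J e by simp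
  then show "\<exists>J c. finite J \<and> J \<subseteq> I \<and> l2_err M f J c e < eps"
    using J by blast
qed

text \<open>Reduces completeness to indicators: \<open>f\<close> is a pointwise limit of simple
  functions bounded by \<open>2 * norm (f x)\<close>, hence an L2 limit by dominated
  convergence.\<close>

lemma L2_subset_closed_span:
  assumes e: "\<And>i. i \<in> I \<Longrightarrow> e i \<in> L2 M"
    and ind: "\<And>A. A \<in> sets M \<Longrightarrow> emeasure M A < \<infinity> \<Longrightarrow> indicator A \<in> l2_span M I e"
  shows "L2 M \<subseteq> l2_span M I e"
proof
  fix f assume f: "f \<in> L2 M"
  then have "f \<in> borel_measurable M" by (rule L2_measurable)
  then obtain s where s: "\<And>i. simple_function M (s i)"
      "\<And>x. x \<in> space M \<Longrightarrow> (\<lambda>i. s i x) \<longlonglongrightarrow> f x"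
      "\<And>i x. x \<in> space M \<Longrightarrow> norm (s i x) \<le> 2 * norm (f x)"
    using borel_measurable_implies_sequence_metric[of f M 0] unfolding norm_conv_dist by metis
  have sm: "s i \<in> borel_measurable M" for i using s(1) by (rule borel_measurable_simple_function)
  have sL2: "s i \<in> L2 M" for i
  proof -
    have "integrable M (\<lambda>x. (norm (s i x))\<^sup>2)"
    proof (rule Bochner_Integration.integrable_bound)
      show "integrable M (\<lambda>x. 4 * (norm (f x))\<^sup>2)" using L2_integrable_square[OF f] by simp
      have "(norm (s i x))\<^sup>2 \<le> (2 * norm (f x))\<^sup>2" if "x \<in> space M" for x
        using s(3)[OF that] by (intro power_mono) auto
      then show "AE x in M. norm ((norm (s i x))\<^sup>2) \<le> norm (4 * (norm (f x))\<^sup>2)"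
        by (intro AE_I2) (simp add: power_mult_distrib)
    qed (use sm in auto)
    then show ?thesis using sm by (simp add: L2_def)
  qed
  have ss: "\<exists>g\<in>l2_span M I e. \<forall>x\<in>space M. g x = s i x" for i
  proof -
    let ?A = "\<lambda>y. s i -` {y} \<inter> space M"
    have A: "?A y \<in> sets M" for y using sm by (auto intro: measurable_sets)
    \<comment> \<open>A Chebyshev bound. The level set of 0 may have infinite measure, but its term
      in the simple function is 0.\<close>
    have "emeasure M (?A y) < \<infinity>" if "y \<noteq> 0" for y
    proof -
      have "integrable M (\<lambda>x. indicator (?A y) x :: real)"
      proof (rule Bochner_Integration.integrable_bound)
        show "integrable M (\<lambda>x. (1 / (norm y)\<^sup>2) * (norm (s i x))\<^sup>2)"
          using L2_integrable_square[OF sL2] by simp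
        show "(\<lambda>x. indicator (?A y) x :: real) \<in> borel_measurable M"
          using A by (intro borel_measurable_indicator)
      qed (use that in \<open>auto simp: indicator_def\<close>)
      then show ?thesis using A by (simp add: integrable_indicator_iff)
    qed
    then have "(\<lambda>x. y * indicator (?A y) x) \<in> l2_span M I e" for y
      using l2_span_cmult[OF ind[OF A]] l2_span_sum[of I e M "{}"] e by (cases "y = 0") auto
    then have ind': "(\<lambda>x. y * indicator (?A y) x) \<in> l2_span M I e" for y by blast
    have "(\<lambda>x. \<Sum>y\<in>Y. y * indicator (?A y) x) \<in> l2_span M I e" if "finite Y" for Y
      using that
    proof induction
      case empty
      show ?case using l2_span_sum[of I e M "{}"] e by simp
    next
      case (insert y Y)
      show ?case
        unfolding sum.insert[OF insert.hyps] by (rule l2_span_add[OF e ind' insert.IH])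
    qed
    from this[OF simple_functionD(1)[OF s(1)]]
    have g: "(\<lambda>x. \<Sum>y\<in>s i ` space M. y * indicator (?A y) x) \<in> l2_span M I e" .
    have g':  "(\<Sum>y\<in>s i ` space M. y * indicator (?A y) x) = s i x" if x: "x \<in> space M" for x
    proof -
      have "(\<Sum>y\<in>s i ` space M. y * indicator (?A y) x) = (\<Sum>y\<in>s i ` space M. if y = s i x then y else 0)"
        using x by (intro sum.cong) auto
      also have "\<dots> = s i x"
        using x simple_functionD(1)[OF s(1)] by (subst sum.delta) auto
      finally show ?thesis .
    qed
    show ?thesis using g' by (intro bexI[OF _ g] ballI)
  qed
  have lim: "(\<lambda>i. LINT x|M. (norm (f x - s i x))\<^sup>2) \<longlonglongrightarrow> (LINT x|M. 0)"
  proof (rule integral_dominated_convergence)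
    \<comment> \<open>The 9 is the square of 1 + 2: the difference has norm at most
      \<open>norm (f x) + 2 * norm (f x)\<close>.\<close>
    show "integrable M (\<lambda>x. 9 * (norm (f x))\<^sup>2)" using L2_integrable_square[OF f] by simp
    show "AE x in M. (\<lambda>i. (norm (f x - s i x))\<^sup>2) \<longlonglongrightarrow> 0"
    proof (rule AE_I2)
      fix x assume "x \<in> space M"
      then have "(\<lambda>i. (norm (f x - s i x))\<^sup>2) \<longlonglongrightarrow> (norm (f x - f x))\<^sup>2"
        by (intro tendsto_intros s(2))
      then show "(\<lambda>i. (norm (f x - s i x))\<^sup>2) \<longlonglongrightarrow> 0" by simp
    qed
    fix i
    have "(norm (f x - s i x))\<^sup>2 \<le> (3 * norm (f x))\<^sup>2" if "x \<in> space M" for x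
      using s(3)[OF that, of i] norm_triangle_ineq4[of "f x" "s i x"] by (intro power_mono) auto
    then show "AE x in M. norm ((norm (f x - s i x))\<^sup>2) \<le> 9 * (norm (f x))\<^sup>2"
      by (intro AE_I2) (simp add: power_mult_distrib)
  qed (use sm f in \<open>auto simp: L2_def\<close>)
  show "f \<in> l2_span M I e"
  proof (rule l2_span_closed[OF e f])
    fix eps :: real assume eps: "eps > 0"
    then obtain i where "(LINT x|M. (norm (f x - s i x))\<^sup>2) < eps\<^sup>2"
      using order_tendstoD(2)[OF lim, of "eps\<^sup>2"] by (auto simp: eventually_sequentially)
    then have *: "l2_norm M (\<lambda>x. f x - s i x) < eps"
      using eps by (simp add: l2_norm_def real_less_lsqrt)
    obtain g where g: "g \<in> l2_span M I e" "\<forall>x\<in>space M. g x = s i x" using ss by blast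
    have "l2_dist M f g = l2_norm M (\<lambda>x. f x - s i x)"
      using g(2) by (intro l2_norm_cong) auto
    with * have "l2_dist M f g < eps" by linarith
    then show "\<exists>g\<in>l2_span M I e. l2_dist M f g < eps"
      using g(1) by (rule bexI)
  qed
qed

lemma integral_indicator_complex:
  assumes "A \<in> sets N"
  shows "(LINT w|N. indicator A w :: complex) = of_real (measure N A)"
proof -
  have "(LINT w|N. indicator A w :: complex) = (LINT w|N. of_real (indicator A w))"
    by (intro LINT_cong) (auto simp: indicator_def)
  then show ?thesis
    using sets.sets_into_space[OF assms] by (simp add: Int_absorb2 del: of_real_indicator)
qed

lemma L2_bounded_support:
  fixes f :: "'a \<Rightarrow> complex"
  assumes "f \<in> borel_measurable M" "A \<in> sets M" "emeasure M A < \<infinity>"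
    and "\<And>x. x \<in> space M \<Longrightarrow> norm (f x) \<le> indicator A x"
  shows "f \<in> L2 M" "integrable M f"
proof -
  have A: "integrable M (indicator A :: _ \<Rightarrow> real)"
    using assms sets.sets_into_space[OF assms(2)] by (simp add: integrable_indicator_iff Int_absorb2)
  show "integrable M f"
    using A assms(1)
  proof (rule Bochner_Integration.integrable_bound)
    show "AE x in M. norm (f x) \<le> norm (indicator A x :: real)"
      using assms(4) by (intro AE_I2) simp
  qed
  have "integrable M (\<lambda>x. (norm (f x))\<^sup>2)"
    using A
  proof (rule Bochner_Integration.integrable_bound)
    show "(\<lambda>x. (norm (f x))\<^sup>2) \<in> borel_measurable M" using assms(1) by measurable
    have "(norm (f x))\<^sup>2 \<le> indicator A x" if "x \<in> space M" for x
      using assms(4)[OF that] by (auto simp: indicator_def power_le_one split: if_splits)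
    then show "AE x in M. norm ((norm (f x))\<^sup>2) \<le> norm (indicator A x :: real)"
      by (intro AE_I2) simp
  qed
  then show "f \<in> L2 M" using assms(1) by (simp add: L2_def)
qed

lemma l2_norm_indicator_diff:
  assumes "A \<in> sets M" "B \<in> sets M"
  shows "l2_dist M (indicator A) (indicator B) = sqrt (measure M (A - B \<union> (B - A)))"
    and "(LINT x|M. norm (indicator A x - indicator B x :: complex)) = measure M (A - B \<union> (B - A))"
proof -
  have D: "A - B \<union> (B - A) \<in> sets M" "(A - B \<union> (B - A)) \<inter> space M = A - B \<union> (B - A)"
    using assms sets.sets_into_space[of "A - B \<union> (B - A)" M] by auto
  have *: "norm (indicator A x - indicator B x :: complex) = indicator (A - B \<union> (B - A)) x"
      "(norm (indicator A x - indicator B x :: complex))\<^sup>2 = indicator (A - B \<union> (B - A)) x" for x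
    by (auto simp: indicator_def)
  show "l2_dist M (indicator A) (indicator B) = sqrt (measure M (A - B \<union> (B - A)))"
    unfolding l2_norm_def *(2) using D by simp
  show "(LINT x|M. norm (indicator A x - indicator B x :: complex)) = measure M (A - B \<union> (B - A))"
    unfolding *(1) using D by simp
qed

lemma l1_norm_triangle:
  fixes f g :: "'a \<Rightarrow> complex"
  assumes "integrable N f" "integrable N g"
  shows "(LINT x|N. norm (f x + g x)) \<le> (LINT x|N. norm (f x)) + (LINT x|N. norm (g x))"
proof -
  have "(LINT x|N. norm (f x + g x)) \<le> (LINT x|N. norm (f x) + norm (g x))"
    using assms by (intro integral_mono) (auto intro: norm_triangle_ineq)
  then show ?thesis using assms by simp
qed

text \<open>\<open>f\<close> is orthogonal to every finite combination \<open>g\<close>, so its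
  squared norm is the inner product with \<open>f - g\<close>, at most the norm of \<open>f\<close>
  times that of \<open>f - g\<close>. A \<open>g\<close> closer to \<open>f\<close> than the norm of
  \<open>f\<close> gives a contradiction.\<close>

lemma l2_norm_eq_0_orthogonal:
  assumes e: "\<And>i. i \<in> I \<Longrightarrow> e i \<in> L2 N" and f: "f \<in> l2_span N I e"
    and orth: "\<And>i. i \<in> I \<Longrightarrow> l2_inner N f (e i) = 0"
  shows "l2_norm N f = 0"
proof (rule ccontr)
  assume "l2_norm N f \<noteq> 0"
  then have pos: "l2_norm N f > 0" using l2_norm_nonneg[of N f] by linarith
  have fL: "f \<in> L2 N" using f by (rule l2_span_L2)
  obtain J c where J: "finite J" "J \<subseteq> I" "l2_err N f J c e < l2_norm N f"
    using f pos by (rule l2_spanE)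
  let ?g = "\<lambda>x. \<Sum>i\<in>J. c i * e i x"
  have g: "?g \<in> L2 N" using J e by (intro L2_sum L2_cmult) auto
  have "l2_inner N f ?g = (\<Sum>i\<in>J. l2_inner N f (\<lambda>x. c i * e i x))"
    using J e by (intro l2_inner_sum_right fL L2_cmult) auto
  also have "\<dots> = 0" using orth J by (intro sum.neutral) (auto simp: l2_inner_cmult_right)
  finally have "l2_inner N f f = l2_inner N f (\<lambda>x. f x - ?g x)"
    using l2_inner_diff_right[OF fL g fL] by simp
  then have "(l2_norm N f)\<^sup>2 = norm (l2_inner N f (\<lambda>x. f x - ?g x))"
    using l2_inner_self[of N f] by (metis abs_of_nonneg norm_of_real zero_le_power2)
  also have "\<dots> \<le> l2_norm N f * l2_norm N (\<lambda>x. f x - ?g x)"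
    by (rule l2_Cauchy_Schwarz[OF fL L2_diff[OF fL g]])
  also have "\<dots> < l2_norm N f * l2_norm N f" using J(3) pos by (rule mult_strict_left_mono)
  finally show False by (simp add: power2_eq_square)
qed

lemma l2_span_cong:
  assumes "f \<in> l2_span N I e" "\<And>x. x \<in> space N \<Longrightarrow> g x = f x"
  shows "g \<in> l2_span N I e"
proof (rule l2_spanI)
  show "g \<in> L2 N" using L2_cong[of N g f] assms l2_span_L2 by blast
  fix eps :: real assume "eps > 0"
  then obtain J c where J: "finite J" "J \<subseteq> I" "l2_err N f J c e < eps"
    by (rule l2_spanE[OF assms(1)])
  have "l2_err N g J c e = l2_err N f J c e"
    using assms(2) by (intro l2_norm_cong) simp
  then have "l2_err N g J c e < eps" using J(3) by linarith
  then show "\<exists>J c. finite J \<and> J \<subseteq> I \<and> l2_err N g J c e < eps"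
    using J(1,2) by blast
qed

text \<open>The formulas for transforms hold only at arguments in the group, whereas the functions
  are defined on all integer sequences.\<close>

lemma orthonormal_basis_L2_cong:
  assumes "\<And>i x. i \<in> I \<Longrightarrow> x \<in> space N \<Longrightarrow> e i x = e' i x"
  shows "orthonormal_basis_L2 N I e \<longleftrightarrow> orthonormal_basis_L2 N I e'"
proof -
  have "e i \<in> L2 N \<longleftrightarrow> e' i \<in> L2 N" if "i \<in> I" for i
    using assms[OF that] by (rule L2_cong)
  moreover have "l2_inner N (e i) (e j) = l2_inner N (e' i) (e' j)" if "i \<in> I" "j \<in> I" for i j
    using assms[OF that(1)] assms[OF that(2)] by (rule l2_inner_cong)
  moreover have "l2_err N f J c e = l2_norm N (\<lambda>x. f x - (\<Sum>i\<in>J. c i * e' i x))"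
    if "J \<subseteq> I" for f J c
    using that assms by (intro l2_norm_cong arg_cong2[where f = minus] sum.cong) auto
  ultimately show ?thesis unfolding orthonormal_basis_L2_def by (simp cong: conj_cong)
qed

text \<open>Covers two uses: exhaustion of a set by an increasing sequence, and, with a constant
  sequence, replacement of a set by one that differs from it by a null set.\<close>

lemma indicator_incseq_in_closed_span:
  assumes e: "\<And>i. i \<in> I \<Longrightarrow> e i \<in> L2 N"
    and A: "\<And>n::nat. A n \<in> sets N" "incseq A" "\<And>n. indicator (A n) \<in> l2_span N I e"
    and B: "B \<in> sets N" "emeasure N B < \<infinity>" "AE x in N. x \<in> B \<longleftrightarrow> x \<in> (\<Union>n. A n)"
  shows "indicator B \<in> l2_span N I e"
proof (rule l2_span_closed[OF e L2_indicator[OF B(1,2)]])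
  fix eps :: real assume eps: "eps > 0"
  let ?U = "\<Union>n. A n"
  have U: "?U \<in> sets N" using A(1) by auto
  have BU: "emeasure N B = emeasure N ?U" using B(3,1) U by (rule emeasure_eq_AE)
  note lim = measure_Diff_incseq[OF A(1,2) B(2)[unfolded BU]]
  have "eps\<^sup>2 > 0" using eps by simp
  from order_tendstoD(2)[OF lim this] obtain n where n: "measure N (?U - A n) < eps\<^sup>2"
    unfolding eventually_sequentially by blast
  have "measure N (B - A n \<union> (A n - B)) = measure N (?U - A n)"
  proof (rule measure_eq_AE)
    show "AE x in N. x \<in> B - A n \<union> (A n - B) \<longleftrightarrow> x \<in> ?U - A n"
      using B(3) by eventually_elim blast
  qed (use A(1) B(1) U in auto)
  then have "l2_dist N (indicator B) (indicator (A n)) < eps"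
    unfolding l2_norm_indicator_diff(1)[OF B(1) A(1)] using n eps by (simp add: real_less_lsqrt)
  then show "\<exists>g\<in>l2_span N I e. l2_dist N (indicator B) g < eps"
    using A(3) by blast
qed

subsection \<open>Haar measure\<close>

text \<open>The cosets are an intersection-stable generator, and the sets
  \<open>vnbhd p (- int k)\<close> exhaust the group with finite measure, so uniqueness of measures
  on a generator applies.\<close>

lemma vborel_measure_eqI:
  assumes "p > 0" "sets M = sets (vborel p)" "sets N = sets (vborel p)"
    and "\<And>a l. a \<in> vilenkin p \<Longrightarrow> emeasure M (vcoset p a l) = emeasure N (vcoset p a l)"
    and "\<And>l. emeasure M (vnbhd p l) \<noteq> \<infinity>"
  shows "M = N"
proof (rule measure_eqI_generator_eq[where A = "\<lambda>k::nat. vnbhd p (- int k)"])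
  show "range (\<lambda>k::nat. vnbhd p (- int k)) \<subseteq> insert {} (vcosets p)"
    using vcoset_zero[OF assms(1)] zero_in_vilenkin[OF assms(1)] unfolding vcosets_def by blast
  show "Int_stable (insert {} (vcosets p))" by (rule Int_stable_vcosets[OF assms(1)])
  show "insert {} (vcosets p) \<subseteq> Pow (vilenkin p)" using vcosets_Pow[OF assms(1)] by blast
  show "emeasure M X = emeasure N X" if "X \<in> insert {} (vcosets p)" for X
    using that assms(4) unfolding vcosets_def by auto
qed (simp_all only: assms(2,3) sets_vborel[OF assms(1)] Un_vnbhd assms(5) not_False_eq_True)

text \<open>Serves twice: as representative when a neighbourhood is split by its next digit, and,
  with digit 1, as a test element that reads off one coordinate through the pairing.\<close>

definition vsingle :: "int \<Rightarrow> int \<Rightarrow> int \<Rightarrow> int" where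
  "vsingle k c = (\<lambda>j. if j = k then c else 0)"

lemma vsingle_in_vilenkin: "0 \<le> c \<Longrightarrow> c < int p \<Longrightarrow> vsingle k c \<in> vilenkin p"
  unfolding vilenkin_iff vsingle_def by (auto intro!: exI[of _ k])

locale vilenkin_haar =
  fixes p :: nat and \<mu> :: "(int \<Rightarrow> int) measure"
  assumes prime_p: "prime p" and haar: "haar_measure p \<mu>"
begin

abbreviation "G \<equiv> vilenkin p"

lemma p_pos: "p > 0" and p_gt_1: "p > 1"
  using prime_p prime_gt_0_nat prime_gt_1_nat by auto

lemmas zero_in_G = zero_in_vilenkin[OF p_pos]
  and vminus_in_G = vminus_in_vilenkin[OF p_pos] and vadd_in_G = vadd_in_vilenkin[OF p_pos]

lemma space_mu [simp]: "space \<mu> = G" and sets_mu: "sets \<mu> = sets (vborel p)"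
  using haar by (auto simp: haar_measure_def)

lemma vcoset_in_mu: "a \<in> G \<Longrightarrow> vcoset p a l \<in> sets \<mu>"
  using vcoset_in_vborel[OF p_pos] sets_mu by simp

lemma vnbhd_in_mu: "vnbhd p l \<in> sets \<mu>"
  using vcoset_in_mu[OF zero_in_G] vcoset_zero[OF p_pos] by simp

lemma emeasure_vcoset_eq: "a \<in> G \<Longrightarrow> emeasure \<mu> (vcoset p a l) = emeasure \<mu> (vnbhd p l)"
  using haar vnbhd_in_mu unfolding haar_measure_def vcoset_def by blast

text \<open>The digit at \<open>l + 1\<close> splits the neighbourhood into \<open>p\<close> cosets
  of the next one, all of equal measure by invariance.\<close>

lemma emeasure_vnbhd_step: "emeasure \<mu> (vnbhd p l) = of_nat p * emeasure \<mu> (vnbhd p (l + 1))"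
proof -
  let ?C = "\<lambda>c. vcoset p (vsingle (l + 1) c) (l + 1)"
  have mem: "x \<in> ?C c \<longleftrightarrow> x \<in> vnbhd p l \<and> x (l + 1) = c" if "c \<in> {0..<int p}" for x c
  proof -
    have "vsingle (l + 1) c \<in> G" using vsingle_in_vilenkin that by simp
    moreover have "(\<forall>j\<le>l + 1. x j = vsingle (l + 1) c j) \<longleftrightarrow> (\<forall>j\<le>l. x j = 0) \<and> x (l + 1) = c"
    proof -
      have "j \<le> l + 1 \<longleftrightarrow> j \<le> l \<or> j = l + 1" for j by arith
      then show ?thesis by (auto simp: vsingle_def)
    qed
    ultimately show ?thesis by (auto simp: mem_vcoset[OF p_pos] mem_vnbhd)
  qed
  have "vnbhd p l = (\<Union>c\<in>{0..<int p}. ?C c)"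
  proof (intro equalityI subsetI)
    fix x assume x: "x \<in> vnbhd p l"
    then have "x (l + 1) \<in> {0..<int p}" unfolding mem_vnbhd vilenkin_def by blast
    moreover from this have "x \<in> ?C (x (l + 1))" using mem x by simp
    ultimately show "x \<in> (\<Union>c\<in>{0..<int p}. ?C c)" by (rule UN_I)
  next
    fix x assume "x \<in> (\<Union>c\<in>{0..<int p}. ?C c)"
    then show "x \<in> vnbhd p l" using mem by blast
  qed
  then have "emeasure \<mu> (vnbhd p l) = (\<Sum>c\<in>{0..<int p}. emeasure \<mu> (?C c))"
  proof (simp only:, intro sum_emeasure[symmetric])
    show "?C ` {0..<int p} \<subseteq> sets \<mu>"
      using vcoset_in_mu vsingle_in_vilenkin by fastforce
    show "disjoint_family_on ?C {0..<int p}"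
      unfolding disjoint_family_on_def
    proof (intro ballI impI equals0I)
      fix c d x assume "c \<in> {0..<int p}" "d \<in> {0..<int p}" "c \<noteq> d" "x \<in> ?C c \<inter> ?C d"
      then show False using mem[of c x] mem[of d x] by simp
    qed
  qed simp
  also have "\<dots> = (\<Sum>c\<in>{0..<int p}. emeasure \<mu> (vnbhd p (l + 1)))"
    by (intro sum.cong emeasure_vcoset_eq vsingle_in_vilenkin) auto
  finally show ?thesis by simp
qed

lemma emeasure_vnbhd: "emeasure \<mu> (vnbhd p l) = ennreal (real p powi (- l))"
proof (induction l rule: int_induct[where k = 0])
  case base
  then show ?case using haar by (simp add: haar_measure_def)
next
  case (step1 i)
  have "ennreal (real p) * emeasure \<mu> (vnbhd p (i + 1)) = ennreal (real p powi (- i))"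
    using emeasure_vnbhd_step[of i] step1 by (simp add: ennreal_of_nat_eq_real_of_nat)
  also have "real p powi (- i) = real p * real p powi (- (i + 1))"
    using p_pos power_int_add_1'[of "real p" "- (i + 1)"] by simp
  also have "ennreal \<dots> = ennreal (real p) * ennreal (real p powi (- (i + 1)))"
    by (simp add: ennreal_mult)
  finally show ?case using p_pos by (simp add: ennreal_mult_cancel_left)
next
  case (step2 i)
  have "emeasure \<mu> (vnbhd p (i - 1)) = ennreal (real p) * ennreal (real p powi (- i))"
    using emeasure_vnbhd_step[of "i - 1"] step2 by (simp add: ennreal_of_nat_eq_real_of_nat)
  also have "\<dots> = ennreal (real p * real p powi (- i))"
    by (simp add: ennreal_mult)
  also have "real p * real p powi (- i) = real p powi (- (i - 1))"
    using p_pos power_int_add_1'[of "real p" "- i"] by simp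
  finally show ?case .
qed

lemma emeasure_vcoset: "a \<in> G \<Longrightarrow> emeasure \<mu> (vcoset p a l) = ennreal (real p powi (- l))"
  by (simp add: emeasure_vcoset_eq emeasure_vnbhd)

lemma mu_eqI:
  assumes "sets N = sets (vborel p)"
    and "\<And>a l. a \<in> G \<Longrightarrow> emeasure N (vcoset p a l) = ennreal (real p powi (- l))"
  shows "\<mu> = N"
  by (rule vborel_measure_eqI[OF p_pos]) (simp_all add: assms sets_mu emeasure_vcoset emeasure_vnbhd)

lemma haar_unique: "haar_measure p \<nu> \<Longrightarrow> \<mu> = \<nu>"
proof (rule mu_eqI)
  assume "haar_measure p \<nu>"
  then interpret \<nu>: vilenkin_haar p \<nu> using prime_p by unfold_locales
  show "sets \<nu> = sets (vborel p)" by (rule \<nu>.sets_mu)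
  show "emeasure \<nu> (vcoset p a l) = ennreal (real p powi (- l))" if "a \<in> G" for a l
    using that by (rule \<nu>.emeasure_vcoset)
qed

section \<open>Translations and shifts on the completed measure\<close>

abbreviation "M \<equiv> completion \<mu>"

lemma measurable_vadd_mu: "a \<in> G \<Longrightarrow> vadd p a \<in> \<mu> \<rightarrow>\<^sub>M \<mu>"
  using measurable_vadd[OF p_pos] measurable_cong_sets[OF sets_mu sets_mu] by simp

lemma measurable_vshift_mu: "vshift n \<in> \<mu> \<rightarrow>\<^sub>M \<mu>"
  using measurable_vshift[OF p_pos] measurable_cong_sets[OF sets_mu sets_mu] by simp

lemma distr_vadd_mu: assumes a: "a \<in> G" shows "distr \<mu> \<mu> (vadd p a) = \<mu>"
proof (rule mu_eqI[symmetric])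
  fix b l assume b: "b \<in> G"
  show "emeasure (distr \<mu> \<mu> (vadd p a)) (vcoset p b l) = ennreal (real p powi - l)"
    using a b by (simp only: emeasure_distr measurable_vadd_mu vcoset_in_mu space_mu
        vadd_vimage_vcoset[OF p_pos] emeasure_vcoset vminus_in_G)
qed (simp add: sets_mu)

text \<open>The modulus of the automorphism: the preimage of a coset of level \<open>l\<close> is a
  coset of level \<open>l + n\<close>, which changes its measure by the factor in the
  density.\<close>

lemma distr_vshift_mu: "distr \<mu> \<mu> (vshift n) = density \<mu> (\<lambda>_. ennreal (real p powi (- n)))"
proof -
  have *: "emeasure (distr \<mu> \<mu> (vshift n)) (vcoset p a l) = ennreal (real p powi (- l - n))"
    if a: "a \<in> G" for a l
  proof -
    have "emeasure (distr \<mu> \<mu> (vshift n)) (vcoset p a l) = emeasure \<mu> (vcoset p (vshift (- n) a) (l + n))"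
      using a vcoset_subset[OF p_pos, of "vshift (- n) a" "l + n"]
      by (subst emeasure_distr[OF measurable_vshift_mu vcoset_in_mu])
         (simp_all add: vshift_vimage_vcoset[OF p_pos] space_mu Int_absorb2)
    then show ?thesis using a by (simp add: emeasure_vcoset)
  qed
  show ?thesis
  proof (rule vborel_measure_eqI[OF p_pos])
    fix a l assume a: "a \<in> G"
    have "emeasure (density \<mu> (\<lambda>_. ennreal (real p powi (- n)))) (vcoset p a l)
        = ennreal (real p powi (- n)) * ennreal (real p powi (- l))"
      using a by (simp add: emeasure_density_const vcoset_in_mu emeasure_vcoset)
    also have "\<dots> = ennreal (real p powi (- l - n))"
      using p_pos by (simp add: ennreal_mult[symmetric] power_int_add[symmetric] add.commute)
    finally show "emeasure (distr \<mu> \<mu> (vshift n)) (vcoset p a l) =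
             emeasure (density \<mu> (\<lambda>_. ennreal (real p powi (- n)))) (vcoset p a l)"
      using *[OF a] by simp
  next
    fix l
    show "emeasure (distr \<mu> \<mu> (vshift n)) (vnbhd p l) \<noteq> \<infinity>"
      using *[OF zero_in_G, of l] by (simp add: vcoset_zero[OF p_pos])
  qed (simp_all add: sets_mu)
qed

lemma null_sets_density_const:
  assumes "c \<noteq> 0" shows "null_sets (density \<mu> (\<lambda>_. c)) = null_sets \<mu>"
  using assms by (auto simp: null_sets_def emeasure_density_const)

lemma measurable_vadd_M: "a \<in> G \<Longrightarrow> vadd p a \<in> M \<rightarrow>\<^sub>M M"
  and distr_vadd: "a \<in> G \<Longrightarrow> distr M M (vadd p a) = M"
proof -
  assume a: "a \<in> G"
  have X: "vadd p a \<in> M \<rightarrow>\<^sub>M \<mu>" using measurable_vadd_mu[OF a] by (rule measurable_completion)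
  have d: "distr M \<mu> (vadd p a) = \<mu>" 
    using distr_completion[OF measurable_vadd_mu[OF a]] distr_vadd_mu[OF a] by simp
  \<comment> \<open>Between completions measurability also needs preimages of null sets to be null;
    this follows because the push-forward is the measure itself.\<close>
  show "vadd p a \<in> M \<rightarrow>\<^sub>M M"
    by (rule completion.measurable_completion2[OF X]) (simp add: d)
  show "distr M M (vadd p a) = M"
    using completion.completion_distr_eq[OF X] by (simp add: d)
qed

lemma measurable_vshift_M: "vshift n \<in> M \<rightarrow>\<^sub>M M"
  and distr_vshift: "distr M M (vshift n) = density M (\<lambda>_. ennreal (real p powi (- n)))"
proof -
  have X: "vshift n \<in> M \<rightarrow>\<^sub>M \<mu>" using measurable_vshift_mu by (rule measurable_completion)
  have d: "distr M \<mu> (vshift n) = density \<mu> (\<lambda>_. ennreal (real p powi (- n)))" 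
    using distr_completion[OF measurable_vshift_mu] distr_vshift_mu by simp
  \<comment> \<open>Here the push-forward is only a positive multiple of the measure, which still
    has the same null sets.\<close>
  have n: "null_sets (distr M \<mu> (vshift n)) = null_sets \<mu>"
    unfolding d using p_pos by (intro null_sets_density_const) simp
  show "vshift n \<in> M \<rightarrow>\<^sub>M M"
    by (rule completion.measurable_completion2[OF X]) (simp add: n)
  show "distr M M (vshift n) = density M (\<lambda>_. ennreal (real p powi (- n)))"
    using completion.completion_distr_eq[OF X n, symmetric] p_pos
    by (simp add: d completion_density_eq)
qed

lemma vadd_image_eq_vimage:
  assumes "a \<in> G" "A \<subseteq> G"
  shows "vadd p a ` A = vadd p (vminus p vzero a) -` A \<inter> G"
proof -
  have z: "vminus p vzero a \<in> G"
    using assms zero_in_G vminus_in_G by blast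
  have "vadd p (vminus p vzero a) (vadd p a x) = x" if "x \<in> A" for x
    using that assms vadd_vminus_self[of p a] vadd_zero[of x p]
    by (metis subsetD vadd_assoc vadd_commute)
  moreover have "vadd p a (vadd p (vminus p vzero a) x) = x" if "x \<in> G" for x
    using that by (rule vadd_cancel_vminus)
  ultimately show ?thesis using assms vadd_in_G by (auto simp: image_iff) metis
qed

lemma sets_vadd_image: "a \<in> G \<Longrightarrow> A \<in> sets M \<Longrightarrow> vadd p a ` A \<in> sets M"
  and emeasure_vadd_image: "a \<in> G \<Longrightarrow> A \<in> sets M \<Longrightarrow> emeasure M (vadd p a ` A) = emeasure M A"
proof -
  assume a: "a \<in> G" and A: "A \<in> sets M"
  have z: "vminus p vzero a \<in> G"
    using a zero_in_G vminus_in_G by blast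
  have sub: "A \<subseteq> G" using sets.sets_into_space[OF A] by simp
  have eq: "vadd p a ` A = vadd p (vminus p vzero a) -` A \<inter> space M"
    using vadd_image_eq_vimage[OF a sub] by simp
  show "vadd p a ` A \<in> sets M"
    unfolding eq using measurable_vadd_M[OF z] A by (rule measurable_sets)
  show "emeasure M (vadd p a ` A) = emeasure M A"
    unfolding eq using emeasure_distr[OF measurable_vadd_M[OF z] A] distr_vadd[OF z] by simp
qed

text \<open>The image under \<open>vshift n\<close> is the preimage under
  \<open>vshift (- n)\<close>; hence the sign of the exponent opposite to that for
  preimages.\<close>

lemma sets_vshift_image: "A \<in> sets M \<Longrightarrow> vshift n ` A \<in> sets M"
  and emeasure_vshift_image: "A \<in> sets M \<Longrightarrow> emeasure M (vshift n ` A) = ennreal (real p powi n) * emeasure M A"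
proof -
  assume A: "A \<in> sets M"
  have eq: "vshift n ` A = vshift (- n) -` A \<inter> space M"
    using sets.sets_into_space[OF A] by (auto simp: mem_vshift_image)
  show "vshift n ` A \<in> sets M"
    unfolding eq using measurable_vshift_M A by (rule measurable_sets)
  show "emeasure M (vshift n ` A) = ennreal (real p powi n) * emeasure M A"
    unfolding eq using emeasure_distr[OF measurable_vshift_M A, of "- n"] distr_vshift[of "- n"]
      emeasure_density_const[OF A] by simp
qed

lemma integral_vadd:
  fixes f :: "(int \<Rightarrow> int) \<Rightarrow> complex"
  assumes "a \<in> G" "f \<in> borel_measurable M"
  shows "(LINT x|M. f (vadd p a x)) = (LINT x|M. f x)"
  using integral_distr[OF measurable_vadd_M[OF assms(1)] assms(2)] distr_vadd[OF assms(1)] by simp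

lemma integral_vshift:
  fixes f :: "(int \<Rightarrow> int) \<Rightarrow> 'b :: {banach, second_countable_topology}"
  assumes "f \<in> borel_measurable M"
  shows "(LINT x|M. f (vshift n x)) = real p powi (- n) *\<^sub>R (LINT x|M. f x)"
proof -
  have "(LINT x|M. f (vshift n x)) = (LINT x|density M (\<lambda>_. ennreal (real p powi (- n))). f x)"
    using integral_distr[OF measurable_vshift_M assms, of n] by (simp only: distr_vshift)
  also have "\<dots> = (LINT x|M. real p powi (- n) *\<^sub>R f x)"
    using assms by (subst integral_density) auto
  finally show ?thesis by simp
qed

lemma integrable_vshift:
  fixes f :: "(int \<Rightarrow> int) \<Rightarrow> 'b :: {banach, second_countable_topology}"
  assumes "integrable M f"
  shows "integrable M (\<lambda>x. f (vshift n x))"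
proof -
  have "integrable (distr M M (vshift n)) f"
    unfolding distr_vshift using assms by (subst integrable_density) auto
  then show ?thesis
    using integrable_distr_eq[OF measurable_vshift_M] assms borel_measurable_integrable by blast
qed

end

subsection \<open>Characters\<close>

definition vexp :: "nat \<Rightarrow> int \<Rightarrow> complex" where
  "vexp p n = exp (2 * of_real pi * \<i> / of_nat p * of_int n)"

lemma vexp_add: "vexp p (m + n) = vexp p m * vexp p n"
  by (simp add: vexp_def exp_add[symmetric] distrib_left add_divide_distrib)

lemma vexp_0 [simp]: "vexp p 0 = 1"
  by (simp add: vexp_def)

lemma norm_vexp: "norm (vexp p n) = 1"
proof -
  have "2 * of_real pi * \<i> / of_nat p * of_int n = \<i> * complex_of_real (2 * pi * of_int n / of_nat p)"
    by simp
  then show ?thesis unfolding vexp_def by (simp only: norm_exp_i_times)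
qed

lemma vexp_eq_1_iff:
  assumes "p > 0"
  shows "vexp p n = 1 \<longleftrightarrow> int p dvd n"
proof
  assume "vexp p n = 1"
  then obtain k :: int where "2 * pi * of_int n / of_nat p = of_int (2 * k) * pi"
    unfolding vexp_def exp_eq_1 by auto
  then have "real_of_int n = real_of_int (k * int p)"
    using assms by (simp add: field_simps)
  then have "n = k * int p" by (simp only: of_int_eq_iff)
  then show "int p dvd n" by simp
next
  assume "int p dvd n"
  then obtain k where k: "n = int p * k" by (auto simp: dvd_def)
  show "vexp p n = 1"
    unfolding vexp_def exp_eq_1 using assms by (auto simp: k intro!: exI[of _ k])
qed

lemma vexp_mod_cong:
  assumes "p > 0" "m mod int p = n mod int p"
  shows "vexp p m = vexp p n"
proof -
  have "vexp p (m - n) = 1" using assms by (simp add: vexp_eq_1_iff mod_eq_dvd_iff)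
  then show ?thesis using vexp_add[of p "m - n" n] by simp
qed

text \<open>The sum in the pairing runs over a set that depends on both arguments. A fixed range
  containing the support of several pairs lets their sums be added; a nonzero term needs
  \<open>j \<ge> k\<close> and \<open>1 - j \<ge> l\<close>.\<close>

lemma vchar_eq_vexp:
  assumes "\<forall>j<k. x j = 0" "\<forall>j<l. w j = 0"
  shows "vchar p x w = vexp p (\<Sum>j\<in>{k..1 - l}. x j * w (1 - j))"
proof -
  have "{j. x j * w (1 - j) \<noteq> 0} \<subseteq> {k..1 - l}"
  proof
    fix j assume "j \<in> {j. x j * w (1 - j) \<noteq> 0}"
    then have "x j \<noteq> 0" "w (1 - j) \<noteq> 0" by auto
    then have "\<not> j < k" "\<not> 1 - j < l" using assms by blast+
    then show "j \<in> {k..1 - l}" by simp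
  qed
  then have "(\<Sum>j | x j * w (1 - j) \<noteq> 0. x j * w (1 - j)) = (\<Sum>j\<in>{k..1 - l}. x j * w (1 - j))"
    by (intro sum.mono_neutral_left) auto
  then show ?thesis by (simp add: vchar_def vexp_def)
qed

lemma vchar_commute: "vchar p x w = vchar p w x"
proof -
  have "(\<Sum>j | x j * w (1 - j) \<noteq> 0. x j * w (1 - j)) = (\<Sum>j | w j * x (1 - j) \<noteq> 0. w j * x (1 - j))"
    by (rule sum.reindex_bij_witness[where i = "\<lambda>j. 1 - j" and j = "\<lambda>j. 1 - j"]) (auto simp: mult.commute)
  then show ?thesis by (simp add: vchar_def)
qed

text \<open>The index \<open>1 - j\<close> reverses direction, so a shift crosses the pairing
  without changing sign.\<close>

lemma vchar_vshift: "vchar p x (vshift n w) = vchar p (vshift n x) w"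
proof -
  have "(\<Sum>j | x j * vshift n w (1 - j) \<noteq> 0. x j * vshift n w (1 - j))
      = (\<Sum>j | vshift n x j * w (1 - j) \<noteq> 0. vshift n x j * w (1 - j))"
    by (rule sum.reindex_bij_witness[where i = "\<lambda>j. j + n" and j = "\<lambda>j. j - n"])
      (auto simp: vshift_def algebra_simps)
  then show ?thesis by (simp add: vchar_def)
qed

lemma norm_vchar [simp]: "norm (vchar p x w) = 1"
  using norm_vexp by (simp add: vchar_def vexp_def)

lemma vchar_vadd_left:
  assumes "p > 0" "x \<in> vilenkin p" "y \<in> vilenkin p" "w \<in> vilenkin p"
  shows "vchar p (vadd p x y) w = vchar p x w * vchar p y w"
proof -
  obtain k where k: "\<forall>j<k. x j = 0 \<and> y j = 0" using assms by (auto elim: vilenkin_common_zero)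
  obtain l where l: "\<forall>j<l. w j = 0" using assms by (auto simp: vilenkin_iff)
  have "vchar p (vadd p x y) w = vexp p (\<Sum>j\<in>{k..1 - l}. (x j + y j) mod int p * w (1 - j))"
    using k l by (subst vchar_eq_vexp[of k _ l]) (auto simp: vadd_def)
  also have "\<dots> = vexp p (\<Sum>j\<in>{k..1 - l}. (x j + y j) * w (1 - j))"
  proof (rule vexp_mod_cong[OF assms(1)])
    have "(\<Sum>j\<in>{k..1 - l}. (x j + y j) mod int p * w (1 - j)) mod int p
        = (\<Sum>j\<in>{k..1 - l}. ((x j + y j) mod int p * w (1 - j)) mod int p) mod int p"
      by (rule mod_sum_eq[symmetric])
    also have "\<dots> = (\<Sum>j\<in>{k..1 - l}. ((x j + y j) * w (1 - j)) mod int p) mod int p"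
      by (simp only: mod_mult_left_eq)
    also have "\<dots> = (\<Sum>j\<in>{k..1 - l}. (x j + y j) * w (1 - j)) mod int p"
      by (rule mod_sum_eq)
    finally show "(\<Sum>j\<in>{k..1 - l}. (x j + y j) mod int p * w (1 - j)) mod int p
        = (\<Sum>j\<in>{k..1 - l}. (x j + y j) * w (1 - j)) mod int p" .
  qed
  also have "\<dots> = vchar p x w * vchar p y w"
    using k l vchar_eq_vexp[of k x l w p] vchar_eq_vexp[of k y l w p]
    by (simp add: distrib_right sum.distrib vexp_add)
  finally show ?thesis .
qed

lemma vchar_zero_left [simp]: "vchar p vzero w = 1"
  by (simp add: vchar_def)

lemma vchar_mult_cnj [simp]: "vchar p x w * cnj (vchar p x w) = 1"
  by (simp add: complex_norm_square[symmetric])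

lemma vchar_nz [simp]: "vchar p x w \<noteq> 0"
  using norm_vchar[of p x w] by (metis norm_zero zero_neq_one)

lemma vchar_vminus_left:
  assumes "p > 0" "x \<in> vilenkin p" "y \<in> vilenkin p" "w \<in> vilenkin p"
  shows "vchar p (vminus p x y) w = vchar p x w * cnj (vchar p y w)"
proof -
  have "vchar p y w * vchar p (vminus p x y) w = vchar p x w"
    using assms vchar_vadd_left[of p y "vminus p x y" w] by (simp add: vminus_in_vilenkin vadd_vminus_cancel)
  then have "cnj (vchar p y w) * (vchar p y w * vchar p (vminus p x y) w) = cnj (vchar p y w) * vchar p x w"
    by simp
  then show ?thesis
    using vchar_mult_cnj[of p y w] by (simp add: mult.assoc[symmetric] mult.commute)
qed

lemma vchar_vadd_right:
  assumes "p > 0" "x \<in> vilenkin p" "y \<in> vilenkin p" "w \<in> vilenkin p"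
  shows "vchar p w (vadd p x y) = vchar p w x * vchar p w y"
  using vchar_vadd_left[OF assms] by (simp only: vchar_commute[of p w])

lemma vchar_vminus_right:
  assumes "p > 0" "x \<in> vilenkin p" "y \<in> vilenkin p" "w \<in> vilenkin p"
  shows "vchar p w (vminus p x y) = vchar p w x * cnj (vchar p w y)"
  using vchar_vminus_left[OF assms] by (simp only: vchar_commute[of p w])

text \<open>For \<open>j \<le> - l\<close> the first factor vanishes, and otherwise
  \<open>1 - j \<le> l\<close> and the second does. The offset 1 in the pairing makes the two cases
  meet without a gap.\<close>

lemma vchar_annihilator:
  assumes "x \<in> vnbhd p (- l)" "w \<in> vnbhd p l"
  shows "vchar p x w = 1"
proof -
  have "x j * w (1 - j) = 0" for j
  proof (cases "j \<le> - l")
    case False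
    then have "1 - j \<le> l" by simp
    then show ?thesis using assms by (simp add: mem_vnbhd)
  qed (use assms in \<open>simp add: mem_vnbhd\<close>)
  then show ?thesis by (simp add: vchar_def)
qed

lemma vchar_vsingle:
  assumes "p > 0" "x \<in> vilenkin p"
  shows "vchar p x (vsingle k 1) = 1 \<longleftrightarrow> x (1 - k) = 0"
proof -
  have "(\<Sum>j | x j * vsingle k 1 (1 - j) \<noteq> 0. x j * vsingle k 1 (1 - j)) = (\<Sum>j\<in>{1 - k}. x j * vsingle k 1 (1 - j))"
    by (rule sum.mono_neutral_left) (auto simp: vsingle_def)
  then have "vchar p x (vsingle k 1) = vexp p (x (1 - k))"
    by (simp add: vchar_def vexp_def vsingle_def)
  then show ?thesis
    using assms zdvd_not_zless[of "x (1 - k)" "int p"] by (auto simp: vexp_eq_1_iff vilenkin_iff le_less)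
qed

text \<open>With \<open>vchar_annihilator\<close>, this identifies the annihilator of
  \<open>vnbhd p l\<close> as exactly \<open>vnbhd p (- l)\<close>: a nonzero coordinate of
  \<open>x\<close> is detected by a single digit placed opposite to it.\<close>

lemma vchar_not_annihilator:
  assumes "p > 1" "x \<in> vilenkin p" "x \<notin> vnbhd p (- l)"
  obtains j where "vsingle j 1 \<in> vnbhd p l" "vchar p x (vsingle j 1) \<noteq> 1"
proof -
  obtain j where j: "j \<le> - l" "x j \<noteq> 0" using assms by (auto simp: mem_vnbhd)
  show ?thesis
  proof (rule that[of "1 - j"])
    show "vsingle (1 - j) 1 \<in> vnbhd p l"
      using vsingle_in_vilenkin[of 1 p "1 - j"] assms(1) j by (auto simp: mem_vnbhd vsingle_def)
    show "vchar p x (vsingle (1 - j) 1) \<noteq> 1" using vchar_vsingle[of p x "1 - j"] assms j by simp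
  qed
qed

lemma vnbhdD: "x \<in> vnbhd p l \<Longrightarrow> x \<in> vilenkin p"
  by (simp add: mem_vnbhd)

lemma in_vnbhd_uminus: "x \<in> vilenkin p \<Longrightarrow> \<exists>l. x \<in> vnbhd p (- l)"
  using Un_vnbhd[of p] by blast

lemma vchar_const_on_vcoset:
  assumes "p > 0" "x \<in> vnbhd p (- l)" "a \<in> vilenkin p" "y \<in> vcoset p a l"
  shows "vchar p x y = vchar p x a"
proof -
  obtain u where u: "u \<in> vnbhd p l" "y = vadd p a u" using assms by (auto simp: vcoset_def)
  then have "vchar p x y = vchar p x a * vchar p x u"
    using assms by (simp add: vchar_vadd_right vnbhdD)
  then show ?thesis using vchar_annihilator[OF assms(2) u(1)] by simp
qed

context vilenkin_haar
begin

lemma vchar_measurable_mu: "x \<in> G \<Longrightarrow> vchar p x \<in> borel_measurable \<mu>"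
proof -
  assume x: "x \<in> G"
  obtain l where "x \<in> vnbhd p (- l)" using in_vnbhd_uminus[OF x] by blast
  then have "vchar p x \<in> borel_measurable (vborel p)"
    using vchar_const_on_vcoset[OF p_pos] by (intro borel_measurable_locally_constant[OF p_pos]) blast
  then show ?thesis using measurable_cong_sets[OF sets_mu refl] by blast
qed

lemma vchar_measurable: "x \<in> G \<Longrightarrow> vchar p x \<in> borel_measurable M"
  by (rule measurable_completion[OF vchar_measurable_mu])

lemma vcoset_in_M: "a \<in> G \<Longrightarrow> vcoset p a l \<in> sets M"
  using vcoset_in_mu by simp

lemma vnbhd_in_M: "vnbhd p l \<in> sets M"
  using vnbhd_in_mu by simp

lemma vnbhd_finite: "emeasure M (vnbhd p l) < \<infinity>"
  using emeasure_vnbhd vnbhd_in_mu by simp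

lemma integrable_vchar_indicator:
  assumes "x \<in> G" "A \<in> sets M" "emeasure M A < \<infinity>"
  shows "integrable M (\<lambda>w. indicator A w * vchar p x w)"
proof (rule Bochner_Integration.integrable_bound)
  show "integrable M (indicator A :: _ \<Rightarrow> real)"
    using assms sets.sets_into_space[OF assms(2)] by (simp add: integrable_indicator_iff Int_absorb2)
  show "(\<lambda>w. indicator A w * vchar p x w) \<in> borel_measurable M"
    using assms(2) vchar_measurable[OF assms(1)] by measurable
qed (auto simp: norm_mult indicator_def)

text \<open>A character in the annihilator is constant on the coset. Otherwise some \<open>u\<close>
  in the neighbourhood has nontrivial character value; translation by \<open>u\<close> preserves the
  coset and multiplies the integral by that value, so the integral is 0.\<close>

lemma integral_vcoset_vchar:
  assumes "a \<in> G" "x \<in> G"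
  shows "(LINT w|M. indicator (vcoset p a l) w * vchar p x w)
    = (if x \<in> vnbhd p (- l) then of_real (real p powi (- l)) * vchar p x a else 0)"
proof -
  let ?f = "\<lambda>a w. indicator (vcoset p a l) w * vchar p x w"
  have meas: "?f a \<in> borel_measurable M" if "a \<in> G" for a
    using vcoset_in_M[OF that] vchar_measurable[OF assms(2)] by measurable
  show ?thesis
  proof (cases "x \<in> vnbhd p (- l)")
    case True
    have "(LINT w|M. ?f a w) = (LINT w|M. indicator (vcoset p a l) w * vchar p x a)"
      using vchar_const_on_vcoset[OF p_pos True assms(1)]
      by (intro LINT_cong) (auto simp: indicator_def)
    also have "\<dots> = (LINT w|M. indicator (vcoset p a l) w) * vchar p x a"
      by simp
    also have "(LINT w|M. indicator (vcoset p a l) w :: complex) = of_real (measure M (vcoset p a l))"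
      using vcoset_in_M[OF assms(1)] by (rule integral_indicator_complex)
    also have "measure M (vcoset p a l) = real p powi (- l)"
      using emeasure_vcoset[OF assms(1), of l] vcoset_in_mu[OF assms(1)]
      by (simp add: measure_def)
    finally show ?thesis using True by simp
  next
    case False
    then obtain j where j: "vsingle j 1 \<in> vnbhd p l" "vchar p x (vsingle j 1) \<noteq> 1"
      using vchar_not_annihilator[OF p_gt_1 assms(2)] by metis
    let ?u = "vsingle j 1"
    have u: "?u \<in> G" using j by (simp add: vnbhdD)
    have "(LINT w|M. ?f a w) = (LINT w|M. ?f a (vadd p ?u w))"
      using integral_vadd[OF u meas[OF assms(1)]] by simp
    also have "\<dots> = (LINT w|M. vchar p x ?u * ?f a w)"
    proof (rule LINT_cong)
      fix w assume "w \<in> space M"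
      then have w: "w \<in> G" by simp
      have "vadd p ?u w i = w i" if "i \<le> l" for i
        using j(1) that w by (simp add: mem_vnbhd vadd_def vilenkin_mod)
      then have "vadd p ?u w \<in> vcoset p a l \<longleftrightarrow> w \<in> vcoset p a l"
        using w assms u p_pos by (simp add: mem_vcoset vadd_in_vilenkin)
      then show "?f a (vadd p ?u w) = vchar p x ?u * ?f a w"
        using w u assms p_pos by (simp add: indicator_def vchar_vadd_right)
    qed simp
    also have "\<dots> = vchar p x ?u * (LINT w|M. ?f a w)" by simp
    finally have "(1 - vchar p x ?u) * (LINT w|M. ?f a w) = 0" by (simp add: algebra_simps)
    then show ?thesis using j(2) False by simp
  qed
qed

subsection \<open>Plancherel\<close>

text \<open>A monotone class argument in two stages: Borel sets inside some \<open>vnbhd p (- k)\<close>,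
  then exhaustion.\<close>

lemma finite_measure_set_induct [consumes 2, case_names vcoset empty Diff Un incseq null]:
  assumes "A \<in> sets M" "emeasure M A < \<infinity>"
    and coset: "\<And>a l. a \<in> G \<Longrightarrow> P (vcoset p a l)"
    and empty: "P {}"
    and Diff: "\<And>A B. A \<in> sets M \<Longrightarrow> B \<in> sets M \<Longrightarrow> A \<subseteq> B \<Longrightarrow> emeasure M B < \<infinity> \<Longrightarrow> P A \<Longrightarrow> P B \<Longrightarrow> P (B - A)"
    and Un: "\<And>A B. A \<in> sets M \<Longrightarrow> B \<in> sets M \<Longrightarrow> A \<inter> B = {} \<Longrightarrow> emeasure M (A \<union> B) < \<infinity> \<Longrightarrow> P A \<Longrightarrow> P B \<Longrightarrow> P (A \<union> B)"
    and incseq: "\<And>A::nat \<Rightarrow> _. range A \<subseteq> sets M \<Longrightarrow> incseq A \<Longrightarrow> emeasure M (\<Union>i. A i) < \<infinity> \<Longrightarrow> (\<And>i. P (A i)) \<Longrightarrow> P (\<Union>i. A i)"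
    and null: "\<And>A B. A \<in> sets M \<Longrightarrow> B \<in> sets M \<Longrightarrow> emeasure M B < \<infinity> \<Longrightarrow> A - B \<union> (B - A) \<in> null_sets M \<Longrightarrow> P A \<Longrightarrow> P B"
  shows "P A"
proof -
  have fin: "emeasure M (B \<inter> vnbhd p l) < \<infinity>" for B l
    by (rule emeasure_subset_finite[OF _ vnbhd_in_M vnbhd_finite]) auto
  have local: "P (B \<inter> vnbhd p l)" if "B \<in> sigma_sets (G) (insert {} (vcosets p))" for B l
  proof -
    have "insert {} (vcosets p) \<subseteq> Pow (G)" using vcosets_Pow[OF p_pos] by blast
    have in_M: "B \<in> sets M" if "B \<in> sigma_sets (G) (insert {} (vcosets p))" for B
      using that sets_mu sets_vborel[OF p_pos] by simp
    from Int_stable_vcosets[OF p_pos] \<open>insert {} (vcosets p) \<subseteq> Pow (G)\<close> that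
    show ?thesis
    proof (induction rule: sigma_sets_induct_disjoint)
      case (basic B)
      have "vnbhd p l \<in> vcosets p"
        using vcoset_zero[OF p_pos, of l] zero_in_G unfolding vcosets_def by blast
      then have "B = {} \<or> B \<inter> vnbhd p l \<in> insert {} (vcosets p)"
        using basic vcosets_Int[OF p_pos, of B "vnbhd p l"] by blast
      then have "B \<inter> vnbhd p l = {} \<or> (\<exists>x l'. B \<inter> vnbhd p l = vcoset p x l' \<and> x \<in> G)"
        unfolding vcosets_def by blast
      then show ?case using coset assms(4) by metis
    next
      case empty
      then show ?case using assms(4) by simp
    next
      case (compl B)
      have "(G - B) \<inter> vnbhd p l = vnbhd p l - B \<inter> vnbhd p l"
        by (auto simp: mem_vnbhd)
      moreover have "P (vnbhd p l - B \<inter> vnbhd p l)"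
        using compl fin[of "vnbhd p l" l] in_M[OF compl(1)] vnbhd_in_M
          coset[OF zero_in_G, of l] vcoset_zero[OF p_pos, of l]
        by (intro Diff) auto
      ultimately show ?case by simp
    next
      case (union B)
      have B: "B i \<in> sets M" for i using union(2) in_M by auto
      \<comment> \<open>Only binary disjoint unions and increasing limits are available, so the
        countable disjoint union is reached through its partial unions.\<close>
      have P: "P ((\<Union>i<n. B i) \<inter> vnbhd p l)" for n
      proof (induction n)
        case 0
        then show ?case using assms(4) by simp
      next
        case (Suc n)
        have "((\<Union>i<n. B i) \<inter> vnbhd p l) \<inter> (B n \<inter> vnbhd p l) = {}"
        proof -
          have "B i \<inter> B n = {}" if "i < n" for i
            using union(1) that by (simp add: disjoint_family_on_def)
          then show ?thesis by blast
        qed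
        moreover have "(\<Union>i<Suc n. B i) \<inter> vnbhd p l = ((\<Union>i<n. B i) \<inter> vnbhd p l) \<union> (B n \<inter> vnbhd p l)"
          by (auto simp: lessThan_Suc)
        moreover have "(\<Union>i<n. B i) \<inter> vnbhd p l \<in> sets M" "B n \<inter> vnbhd p l \<in> sets M"
          using B vnbhd_in_M by (intro sets.Int sets.finite_UN, auto)+
        ultimately show ?case using Un Suc union(3)[of n] fin[of "\<Union>i<Suc n. B i" l] by metis
      qed
      have "P (\<Union>n. (\<Union>i<n. B i) \<inter> vnbhd p l)"
      proof (rule incseq[OF _ _ _ P])
        show "range (\<lambda>n. (\<Union>i<n. B i) \<inter> vnbhd p l) \<subseteq> sets M"
        proof clarify
          fix n show "(\<Union>i<n. B i) \<inter> vnbhd p l \<in> sets M"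
            using B vnbhd_in_M by (intro sets.Int sets.finite_UN, auto)
        qed
        show "incseq (\<lambda>n. (\<Union>i<n. B i) \<inter> vnbhd p l)"
          by (force simp: incseq_def)
        show "emeasure M (\<Union>n. (\<Union>i<n. B i) \<inter> vnbhd p l) < \<infinity>"
          using fin[of "\<Union>n. \<Union>i<n. B i" l] by (simp only: Int_UN_distrib2[symmetric] Int_commute UN_extend_simps)
      qed
      moreover have "(\<Union>n. (\<Union>i<n. B i) \<inter> vnbhd p l) = (\<Union>i. B i) \<inter> vnbhd p l"
        by auto
      ultimately show ?case by simp
    qed
  qed
  obtain S Z Z' where A: "A = S \<union> Z" "Z \<subseteq> Z'" "Z' \<in> null_sets \<mu>" "S \<in> sets \<mu>"
    using assms(1) by (rule sets_completionE)
  have S: "S \<in> sigma_sets (G) (insert {} (vcosets p))"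
    using A sets_mu sets_vborel[OF p_pos] by simp
  have S_sub: "S \<subseteq> G" using sets.sets_into_space[OF A(4)] by simp
  have SM: "S \<in> sets M" using A(4) by simp
  have S_eq: "(\<Union>k::nat. S \<inter> vnbhd p (- int k)) = S" using Un_vnbhd[of p] S_sub by blast
  have finS: "emeasure M S < \<infinity>"
    using A(1) by (intro emeasure_subset_finite[OF _ assms(1,2)]) auto
  have "P (\<Union>k::nat. S \<inter> vnbhd p (- int k))"
  proof (rule incseq)
    show "range (\<lambda>k::nat. S \<inter> vnbhd p (- int k)) \<subseteq> sets M" using SM vnbhd_in_M by auto
    show "incseq (\<lambda>k::nat. S \<inter> vnbhd p (- int k))" using incseq_vnbhd[of p] unfolding incseq_def by blast
    show "emeasure M (\<Union>k::nat. S \<inter> vnbhd p (- int k)) < \<infinity>" unfolding S_eq by (rule finS)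
  qed (rule local[OF S])
  then have "P S" unfolding S_eq .
  moreover have "S - A \<union> (A - S) \<in> null_sets M"
    using A null_sets_completion_subset[of "S - A \<union> (A - S)" Z' \<mu>] null_sets_completionI[OF A(3)] by auto
  ultimately show ?thesis using null[OF SM assms(1,2)] by blast
qed

section \<open>The transform on step functions\<close>

abbreviation "T \<equiv> inverse_fourier p M"

definition vgen :: "(int \<Rightarrow> int) \<Rightarrow> (int \<Rightarrow> int) \<Rightarrow> int \<Rightarrow> (int \<Rightarrow> int) \<Rightarrow> complex" where
  "vgen y a l = (\<lambda>w. indicator (vcoset p a l) w * vchar p y w)"

text \<open>The linear span of the restricted characters. The clause \<open>same\<close> ignores
  values outside the group, where the transform formulas say nothing.\<close>

inductive step :: "((int \<Rightarrow> int) \<Rightarrow> complex) \<Rightarrow> bool" where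
  vgen: "y \<in> G \<Longrightarrow> a \<in> G \<Longrightarrow> step (vgen y a l)"
| add: "step f \<Longrightarrow> step g \<Longrightarrow> step (\<lambda>w. f w + g w)"
| cmult: "step f \<Longrightarrow> step (\<lambda>w. c * f w)"
| same: "step f \<Longrightarrow> (\<And>w. w \<in> G \<Longrightarrow> g w = f w) \<Longrightarrow> step g"

lemma vgen_L2: "y \<in> G \<Longrightarrow> a \<in> G \<Longrightarrow> vgen y a l \<in> L2 M"
  and vgen_integrable: "y \<in> G \<Longrightarrow> a \<in> G \<Longrightarrow> integrable M (vgen y a l)"
proof -
  assume y: "y \<in> G" and a: "a \<in> G"
  have C: "vcoset p a l \<in> sets M" using a by (rule vcoset_in_M)
  have m: "vgen y a l \<in> borel_measurable M"
    unfolding vgen_def using C vchar_measurable[OF y] by measurable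
  have fin: "emeasure M (vcoset p a l) < \<infinity>" using emeasure_vcoset[OF a] vcoset_in_mu[OF a] by simp
  have "norm (vgen y a l w) \<le> indicator (vcoset p a l) w" for w
    by (simp add: vgen_def norm_mult indicator_def)
  from L2_bounded_support[OF m C fin this] show "vgen y a l \<in> L2 M" "integrable M (vgen y a l)" .
qed

lemma step_L2: "step f \<Longrightarrow> f \<in> L2 M"
proof (induction rule: step.induct)
  case (same f g)
  then show ?case using L2_cong[of M g f] by simp
qed (auto intro: vgen_L2 L2_add L2_cmult)

lemma step_integrable: "step f \<Longrightarrow> integrable M f"
proof (induction rule: step.induct)
  case (same f g)
  then show ?case using Bochner_Integration.integrable_cong[of M M g f] by simp
qed (auto intro: vgen_integrable)

lemma step_diff: "step f \<Longrightarrow> step g \<Longrightarrow> step (\<lambda>w. f w - g w)"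
  using step.add[of f "\<lambda>w. -1 * g w"] step.cmult[of g "-1"] by simp

lemma integrable_mult_vchar:
  assumes "integrable M f" "x \<in> G"
  shows "integrable M (\<lambda>w. f w * vchar p x w)"
  using assms(1)
proof (rule Bochner_Integration.integrable_bound)
  show "(\<lambda>w. f w * vchar p x w) \<in> borel_measurable M"
    using borel_measurable_integrable[OF assms(1)] vchar_measurable[OF assms(2)] by measurable
qed (simp add: norm_mult)

lemma T_add: "integrable M f \<Longrightarrow> integrable M g \<Longrightarrow> x \<in> G \<Longrightarrow> T (\<lambda>w. f w + g w) x = T f x + T g x"
  unfolding inverse_fourier_def
  using integrable_mult_vchar[of f x] integrable_mult_vchar[of g x] by (simp add: distrib_right)

lemma T_cmult: "T (\<lambda>w. c * f w) x = c * T f x"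
  unfolding inverse_fourier_def by (simp add: mult.assoc)

lemma T_cong: "(\<And>w. w \<in> G \<Longrightarrow> g w = f w) \<Longrightarrow> T g = T f"
  unfolding inverse_fourier_def by (intro ext LINT_cong) auto

lemma T_diff: "integrable M f \<Longrightarrow> integrable M g \<Longrightarrow> x \<in> G \<Longrightarrow> T (\<lambda>w. f w - g w) x = T f x - T g x"
  using T_add[of f "\<lambda>w. -1 * g w" x] T_cmult[of "-1" g x] by simp

lemma norm_T_le:
  "integrable M f \<Longrightarrow> norm (T f x) \<le> (LINT w|M. norm (f w))"
  unfolding inverse_fourier_def
  by (rule order_trans[OF integral_norm_bound]) (simp add: norm_mult)

abbreviation "vneg \<equiv> vminus p vzero"

lemma vneg_in [simp]: "x \<in> G \<Longrightarrow> vneg x \<in> G"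
  using vminus_in_G[OF zero_in_G] .

lemma vneg_vneg: "x \<in> G \<Longrightarrow> vneg (vneg x) = x"
  by (simp add: vminus_def fun_eq_iff mod_simps vilenkin_mod)

lemma vneg_eq_iff: 
  assumes "x \<in> G" "y \<in> G"
  shows "vneg x j = vneg y j \<longleftrightarrow> x j = y j"
proof -
  have "vneg (vneg x) j = vneg (vneg y) j" if "vneg x j = vneg y j"
    using that by (simp add: vminus_def)
  moreover have "vneg x j = vneg y j" if "x j = y j" using that by (simp add: vminus_def)
  ultimately show ?thesis using vneg_vneg[OF assms(1)] vneg_vneg[OF assms(2)] by auto
qed

lemma vcoset_vneg: 
  assumes "x \<in> G" "y \<in> G"
  shows "vneg x \<in> vcoset p (vneg y) l \<longleftrightarrow> x \<in> vcoset p y l"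
  using assms p_pos by (simp add: mem_vcoset vneg_eq_iff)

lemma vchar_vneg: "x \<in> G \<Longrightarrow> y \<in> G \<Longrightarrow> vchar p (vneg x) y = cnj (vchar p x y)"
  using vchar_vminus_left[OF p_pos zero_in_G, of x y] by simp

text \<open>Position and frequency trade places: the integrand is the character
  \<open>x \<oplus> y\<close> on the coset of \<open>a\<close>, whose integral survives only if
  \<open>x \<oplus> y\<close> annihilates \<open>vnbhd p l\<close>, that is, if \<open>x\<close>
  lies in a coset of \<open>\<ominus> y\<close>.\<close>

lemma T_vgen:
  assumes "y \<in> G" "a \<in> G" "x \<in> G"
  shows "T (vgen y a l) x = of_real (real p powi (- l)) * vchar p y a * vgen a (vneg y) (- l) x"
proof -
  have "T (vgen y a l) x = (LINT w|M. indicator (vcoset p a l) w * vchar p (vadd p x y) w)"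
    unfolding inverse_fourier_def vgen_def using assms p_pos
    by (intro LINT_cong) (auto simp: vchar_vadd_left)
  also have "\<dots> = (if vadd p x y \<in> vnbhd p (- l) then of_real (real p powi (- l)) * vchar p (vadd p x y) a else 0)"
    using assms vadd_in_G by (intro integral_vcoset_vchar) auto
  also have "vadd p x y \<in> vnbhd p (- l) \<longleftrightarrow> x \<in> vcoset p (vneg y) (- l)"
  proof -
    have "vminus p x (vneg y) = vadd p x y"
      by (simp add: vminus_def vadd_def mod_simps)
    then show ?thesis using assms by (simp add: mem_vcoset_vminus[OF p_pos])
  qed
  finally show ?thesis
    using assms p_pos by (simp add: vgen_def vchar_vadd_left vchar_commute[of p a x])
qed

text \<open>By nesting the product lives on the smaller coset, that of \<open>b\<close>, and
  integrates the character \<open>y \<ominus> z\<close> there.\<close>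

lemma vgen_inner_le:
  assumes "y \<in> G" "a \<in> G" "z \<in> G" "b \<in> G" "l \<le> m"
  shows "l2_inner M (vgen y a l) (vgen z b m) =
    (if b \<in> vcoset p a l \<and> y \<in> vcoset p z (- m)
     then of_real (real p powi (- m)) * vchar p y b * cnj (vchar p z b) else 0)"
proof -
  have ind: "(indicator (vcoset p a l) w * indicator (vcoset p b m) w :: complex)
      = (if b \<in> vcoset p a l then indicator (vcoset p b m) w else 0)" for w
    using vcoset_Int[OF p_pos assms(2,4,5)] unfolding indicator_inter_arith[symmetric] by simp
  have "l2_inner M (vgen y a l) (vgen z b m)
      = (LINT w|M. (if b \<in> vcoset p a l then 1 else 0) * (indicator (vcoset p b m) w * vchar p (vminus p y z) w))"
    unfolding l2_inner_def
  proof (rule LINT_cong)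
    fix w assume "w \<in> space M"
    then have w: "w \<in> G" by simp
    have "vgen y a l w * cnj (vgen z b m w)
        = (indicator (vcoset p a l) w * indicator (vcoset p b m) w) * (vchar p y w * cnj (vchar p z w))"
      by (simp add: vgen_def indicator_def)
    also have "\<dots> = (if b \<in> vcoset p a l then 1 else 0) * (indicator (vcoset p b m) w * vchar p (vminus p y z) w)"
      unfolding ind using w assms p_pos by (simp add: vchar_vminus_left)
    finally show "vgen y a l w * cnj (vgen z b m w)
        = (if b \<in> vcoset p a l then 1 else 0) * (indicator (vcoset p b m) w * vchar p (vminus p y z) w)" .
  qed simp
  also have "\<dots> = (if b \<in> vcoset p a l then 1 else 0) *
      (if vminus p y z \<in> vnbhd p (- m) then of_real (real p powi (- m)) * vchar p (vminus p y z) b else 0)"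
    using assms vminus_in_G by (simp add: integral_vcoset_vchar)
  also have "vminus p y z \<in> vnbhd p (- m) \<longleftrightarrow> y \<in> vcoset p z (- m)"
    using assms by (simp add: mem_vcoset_vminus[OF p_pos])
  finally show ?thesis using assms p_pos by (simp add: vchar_vminus_left)
qed

text \<open>The transform negates levels, so \<open>- m \<le> - l\<close> and the larger coset is
  now on the other side. \<open>vgen_inner_le\<close> is applied to the conjugate inner product, and
  the powers of \<open>p\<close> and the extra character values cancel.\<close>

lemma T_vgen_inner_le:
  assumes "y \<in> G" "a \<in> G" "z \<in> G" "b \<in> G" "l \<le> m"
  shows "l2_inner M (T (vgen y a l)) (T (vgen z b m)) = l2_inner M (vgen y a l) (vgen z b m)"
proof -
  let ?A = "of_real (real p powi (- l)) * vchar p y a" and ?B = "of_real (real p powi (- m)) * vchar p z b"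
  have "l2_inner M (T (vgen y a l)) (T (vgen z b m))
      = l2_inner M (\<lambda>x. ?A * vgen a (vneg y) (- l) x) (\<lambda>x. ?B * vgen b (vneg z) (- m) x)"
    by (rule l2_inner_cong) (simp_all add: T_vgen assms)
  also have "\<dots> = ?A * cnj ?B * l2_inner M (vgen a (vneg y) (- l)) (vgen b (vneg z) (- m))"
    by (simp add: l2_inner_cmult_left l2_inner_cmult_right)
  also have "l2_inner M (vgen a (vneg y) (- l)) (vgen b (vneg z) (- m))
      = cnj (l2_inner M (vgen b (vneg z) (- m)) (vgen a (vneg y) (- l)))"
    by (rule l2_inner_cnj[symmetric])
  also have "l2_inner M (vgen b (vneg z) (- m)) (vgen a (vneg y) (- l))
      = (if y \<in> vcoset p z (- m) \<and> b \<in> vcoset p a l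
         then of_real (real p powi l) * cnj (vchar p y b) * vchar p y a else 0)"
    using assms vgen_inner_le[of b "vneg z" a "vneg y" "- m" "- l"]
    by (simp add: vcoset_vneg vchar_commute[of p b] vchar_commute[of p a] vchar_vneg)
  finally have *: "l2_inner M (T (vgen y a l)) (T (vgen z b m)) = ?A * cnj ?B *
      cnj (if y \<in> vcoset p z (- m) \<and> b \<in> vcoset p a l
         then of_real (real p powi l) * cnj (vchar p y b) * vchar p y a else 0)" .
  have 1: "complex_of_real (real p powi l) * of_real (real p powi (- l)) = 1"
    using p_pos by (simp add: of_real_mult[symmetric] power_int_add[symmetric] del: of_real_mult)
  have "?A * cnj ?B * (of_real (real p powi l) * vchar p y b * cnj (vchar p y a))
      = (of_real (real p powi l) * of_real (real p powi (- l))) * (vchar p y a * cnj (vchar p y a)) *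
        (of_real (real p powi (- m)) * vchar p y b * cnj (vchar p z b))"
    by (simp only: complex_cnj_mult complex_cnj_complex_of_real ac_simps)
  then have "?A * cnj ?B * (of_real (real p powi l) * vchar p y b * cnj (vchar p y a))
      = of_real (real p powi (- m)) * vchar p y b * cnj (vchar p z b)"
    unfolding 1 vchar_mult_cnj by simp
  then show ?thesis
    unfolding * vgen_inner_le[OF assms] by simp
qed

lemma T_vgen_inner:
  assumes "y \<in> G" "a \<in> G" "z \<in> G" "b \<in> G"
  shows "l2_inner M (T (vgen y a l)) (T (vgen z b m)) = l2_inner M (vgen y a l) (vgen z b m)"
proof (cases "l \<le> m")
  case False
  then have "l2_inner M (T (vgen z b m)) (T (vgen y a l)) = l2_inner M (vgen z b m) (vgen y a l)"
    using assms by (intro T_vgen_inner_le) auto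
  then show ?thesis by (metis l2_inner_cnj)
qed (use T_vgen_inner_le assms in blast)

lemma step_T: "step f \<Longrightarrow> step (T f)"
proof (induction rule: step.induct)
  case (vgen y a l)
  then have "step (\<lambda>x. of_real (real p powi (- l)) * vchar p y a * vgen a (vneg y) (- l) x)"
    by (intro step.cmult step.vgen) auto
  then show ?case by (rule step.same) (rule T_vgen[OF vgen])
next
  case (add f g)
  show ?case by (rule step.same[OF step.add[OF add.IH]]) (simp add: T_add step_integrable add.hyps)
next
  case (cmult f c)
  show ?case by (rule step.same[OF step.cmult[OF cmult.IH]]) (rule T_cmult)
next
  case (same f g)
  have "T g = T f" using same.hyps(2) by (rule T_cong)
  then show ?case using same.IH by simp
qed

lemma T_step_L2: "step f \<Longrightarrow> T f \<in> L2 M"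
  by (intro step_L2 step_T)

lemma T_step_inner:
  assumes "step f" "step g"
  shows "l2_inner M (T f) (T g) = l2_inner M f g"
  using assms
proof (induction f arbitrary: g)
  case (vgen y a l)
  note y = this
  show ?case using y(3)
  proof induction
    case (vgen z b m)
    then show ?case using y by (intro T_vgen_inner)
  next
    case (add g h)
    have "l2_inner M (T (vgen y a l)) (T (\<lambda>w. g w + h w)) = l2_inner M (T (vgen y a l)) (\<lambda>x. T g x + T h x)"
      using add by (intro l2_inner_cong) (auto simp: T_add step_integrable)
    then show ?case
      using add y by (simp add: l2_inner_add_right T_step_L2 step_L2 vgen_L2 step.vgen)
  next
    case (cmult g c)
    have "l2_inner M (T (vgen y a l)) (T (\<lambda>w. c * g w)) = l2_inner M (T (vgen y a l)) (\<lambda>x. c * T g x)"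
      by (intro l2_inner_cong) (auto simp: T_cmult)
    then show ?case using cmult by (simp add: l2_inner_cmult_right)
  next
    case (same g h)
    have "T h = T g" using same.hyps(2) by (rule T_cong)
    moreover have "l2_inner M (vgen y a l) h = l2_inner M (vgen y a l) g"
      using same.hyps(2) by (intro l2_inner_cong) auto
    ultimately show ?case using same.IH by simp
  qed
next
  case (add f h)
  have "l2_inner M (T (\<lambda>w. f w + h w)) (T g) = l2_inner M (\<lambda>x. T f x + T h x) (T g)"
    using add by (intro l2_inner_cong) (auto simp: T_add step_integrable)
  then show ?case
    using add by (simp add: l2_inner_add_left T_step_L2 step_L2)
next
  case (cmult f c)
  have "l2_inner M (T (\<lambda>w. c * f w)) (T g) = l2_inner M (\<lambda>x. c * T f x) (T g)"
    by (intro l2_inner_cong) (auto simp: T_cmult)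
  then show ?case using cmult by (simp add: l2_inner_cmult_left)
next
  case (same f h)
  have "T h = T f" using same.hyps(2) by (rule T_cong)
  moreover have "l2_inner M h g = l2_inner M f g" using same.hyps(2) by (intro l2_inner_cong) auto
  ultimately show ?case using same.IH[OF same.prems] by simp
qed

lemma T_step_norm: "step f \<Longrightarrow> l2_norm M (T f) = l2_norm M f"
  by (intro l2_norm_eqI T_step_inner)

text \<open>Approximation is required in both norms: \<open>L\<^sup>1\<close> makes the transforms converge
  pointwise, \<open>L\<^sup>2\<close> makes them a Cauchy sequence.\<close>

definition L12 :: "((int \<Rightarrow> int) \<Rightarrow> complex) set" where
  "L12 = {f \<in> L2 M. integrable M f \<and>
    (\<forall>eps>0. \<exists>s. step s \<and> l1_dist M f s < eps \<and> l2_dist M f s < eps)}"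

lemma L12_L2: "f \<in> L12 \<Longrightarrow> f \<in> L2 M" and L12_integrable: "f \<in> L12 \<Longrightarrow> integrable M f"
  by (auto simp: L12_def)

lemma L12E:
  assumes "f \<in> L12" "eps > 0"
  obtains s where "step s" "l1_dist M f s < eps" "l2_dist M f s < eps"
  using assms by (auto simp: L12_def)

lemma L12_step: "step f \<Longrightarrow> f \<in> L12"
  by (auto simp: L12_def step_L2 step_integrable intro!: exI[of _ f])

lemma L12_closed:
  assumes "f \<in> L2 M" "integrable M f"
    and "\<And>eps. eps > 0 \<Longrightarrow> \<exists>g\<in>L12. l1_dist M f g < eps \<and> l2_dist M f g < eps"
  shows "f \<in> L12"
  unfolding L12_def
proof (intro CollectI conjI allI impI)
  fix eps :: real assume "eps > 0"
  then have eps: "eps / 2 > 0" by simp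
  obtain g where g: "g \<in> L12" "l1_dist M f g < eps / 2" "l2_dist M f g < eps / 2"
    using assms(3)[OF eps] by blast
  obtain s where s: "step s" "l1_dist M g s < eps / 2" "l2_dist M g s < eps / 2"
    using L12E[OF g(1) eps] by blast
  have "l2_dist M f s < eps"
    using l2_norm_triangle_diff[OF assms(1) L12_L2[OF g(1)] step_L2[OF s(1)]] g s by simp
  moreover have "l1_dist M f s < eps"
    using l1_norm_triangle[of M "\<lambda>w. f w - g w" "\<lambda>w. g w - s w"] assms(2) L12_integrable[OF g(1)]
      step_integrable[OF s(1)] g s by simp
  ultimately show "\<exists>s. step s \<and> l1_dist M f s < eps \<and> l2_dist M f s < eps"
    using s by blast
qed (use assms in auto)

lemma L12_add:
  assumes f: "f \<in> L12" and g: "g \<in> L12"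
  shows "(\<lambda>w. f w + g w) \<in> L12"
proof (rule L12_closed)
  fix eps :: real assume "eps > 0"
  then have eps: "eps / 2 > 0" by simp
  obtain s where s: "step s" "l1_dist M f s < eps / 2" "l2_dist M f s < eps / 2"
    using L12E[OF f eps] by blast
  obtain t where t: "step t" "l1_dist M g t < eps / 2" "l2_dist M g t < eps / 2"
    using L12E[OF g eps] by blast
  have eq: "f w + g w - (s w + t w) = (f w - s w) + (g w - t w)" for w by simp
  have "l2_norm M (\<lambda>w. f w + g w - (s w + t w)) < eps"
    unfolding eq using l2_norm_triangle[OF L2_diff[OF L12_L2[OF f] step_L2[OF s(1)]] L2_diff[OF L12_L2[OF g] step_L2[OF t(1)]]]
      s t by linarith
  moreover have "(LINT w|M. norm (f w + g w - (s w + t w))) < eps"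
    unfolding eq
    using l1_norm_triangle[OF Bochner_Integration.integrable_diff[OF L12_integrable[OF f] step_integrable[OF s(1)]]
        Bochner_Integration.integrable_diff[OF L12_integrable[OF g] step_integrable[OF t(1)]]] s(2) t(2)
    by linarith
  ultimately show "\<exists>h\<in>L12. (LINT w|M. norm (f w + g w - h w)) < eps \<and> l2_norm M (\<lambda>w. f w + g w - h w) < eps"
    using L12_step[OF step.add[OF s(1) t(1)]] by (intro bexI[of _ "\<lambda>w. s w + t w"]) auto
qed (use f g in \<open>auto intro: L2_add L12_L2 L12_integrable\<close>)

lemma L12_cmult:
  assumes f: "f \<in> L12" shows "(\<lambda>w. c * f w) \<in> L12"
proof (rule L12_closed)
  fix eps :: real assume "eps > 0"
  then have eps: "eps / (norm c + 1) > 0" by (simp add: add_nonneg_pos)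
  obtain s where s: "step s" "l1_dist M f s < eps / (norm c + 1)"
      "l2_dist M f s < eps / (norm c + 1)"
    using L12E[OF f eps] by blast
  note less = norm_mult_less[OF \<open>eps > 0\<close>]
  have eq: "c * f w - c * s w = c * (f w - s w)" for w by (simp add: right_diff_distrib)
  have "l2_norm M (\<lambda>w. c * f w - c * s w) < eps"
    unfolding eq l2_norm_cmult using less s by blast
  moreover have "(LINT w|M. norm (c * f w - c * s w)) < eps"
    unfolding eq norm_mult using less s by simp
  ultimately show "\<exists>h\<in>L12. (LINT w|M. norm (c * f w - h w)) < eps \<and> l2_norm M (\<lambda>w. c * f w - h w) < eps"
    using L12_step[OF step.cmult[OF s(1), of c]] by (intro bexI[of _ "\<lambda>w. c * s w"]) auto
qed (use f in \<open>auto intro: L2_cmult L12_L2 L12_integrable\<close>)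

lemma L12_diff: "f \<in> L12 \<Longrightarrow> g \<in> L12 \<Longrightarrow> (\<lambda>w. f w - g w) \<in> L12"
  using L12_add[of f "\<lambda>w. -1 * g w"] L12_cmult[of g "-1"] by simp

lemma L12_sum: "finite I \<Longrightarrow> (\<And>i. i \<in> I \<Longrightarrow> f i \<in> L12) \<Longrightarrow> (\<lambda>w. \<Sum>i\<in>I. f i w) \<in> L12"
proof (induction I rule: finite_induct)
  case empty
  have "step (\<lambda>w. 0 * vgen vzero vzero 0 w)"
    using zero_in_G by (intro step.cmult step.vgen)
  then show ?case using L12_step by simp
next
  case (insert i I)
  then show ?case unfolding sum.insert[OF insert.hyps] by (intro L12_add) auto
qed

lemma step_mult_vchar:
  assumes "step f" "z \<in> G" shows "step (\<lambda>w. vchar p z w * f w)"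
  using assms(1)
proof induction
  case (vgen y a l)
  have "step (vgen (vadd p z y) a l)" using vgen assms(2) vadd_in_G by (intro step.vgen)
  then show ?case
    by (rule step.same) (use vgen assms(2) p_pos in \<open>simp add: vgen_def vchar_vadd_left\<close>)
next
  case (add f g)
  show ?case by (rule step.same[OF step.add[OF add.IH]]) (simp add: distrib_left)
next
  case (cmult f c)
  show ?case by (rule step.same[OF step.cmult[OF cmult.IH, of c]]) (simp add: mult.left_commute)
next
  case (same f g)
  show ?case by (rule step.same[OF same.IH]) (simp add: same.hyps)
qed

text \<open>Multiplication by a unimodular function keeps both norms. This brings modulated
  indicators, hence the wavelet system, into \<open>L12\<close>.\<close>

lemma L12_mult_vchar:
  assumes f: "f \<in> L12" and z: "z \<in> G"
  shows "(\<lambda>w. vchar p z w * f w) \<in> L12"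
proof (rule L12_closed)
  show "integrable M (\<lambda>w. vchar p z w * f w)"
    using integrable_mult_vchar[OF L12_integrable[OF f] z] by (simp add: mult.commute)
  then show "(\<lambda>w. vchar p z w * f w) \<in> L2 M"
    using L12_L2[OF f] borel_measurable_integrable by (auto simp: L2_def norm_mult)
  fix eps :: real assume eps: "eps > 0"
  obtain s where s: "step s" "l1_dist M f s < eps" "l2_dist M f s < eps"
    using L12E[OF f eps] by blast
  let ?f = "\<lambda>w. vchar p z w * f w" and ?s = "\<lambda>w. vchar p z w * s w"
  have eq: "vchar p z w * f w - vchar p z w * s w = vchar p z w * (f w - s w)" for w
    by (simp add: right_diff_distrib)
  have "l1_dist M ?f ?s < eps \<and> l2_dist M ?f ?s < eps"
    using s(2,3) unfolding l2_norm_def eq norm_mult norm_vchar by simp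
  then show "\<exists>h\<in>L12. l1_dist M ?f h < eps \<and> l2_dist M ?f h < eps"
    using L12_step[OF step_mult_vchar[OF s(1) z]] by (rule bexI)
qed

lemma L12_cong:
  assumes "f \<in> L12" "\<And>w. w \<in> G \<Longrightarrow> g w = f w"
  shows "g \<in> L12"
proof (rule L12_closed)
  show "g \<in> L2 M" using L2_cong[of M g f] assms L12_L2 by simp
  show "integrable M g"
    using L12_integrable[OF assms(1)] Bochner_Integration.integrable_cong[of M M g f] assms(2) by simp
  fix eps :: real assume "eps > 0"
  moreover have "l1_dist M g f = (LINT w|M. 0)"
    using assms(2) by (intro LINT_cong) auto
  moreover have "l2_dist M g f = l2_norm M (\<lambda>w. 0)"
    using assms(2) by (intro l2_norm_cong) auto
  ultimately show "\<exists>h\<in>L12. l1_dist M g h < eps \<and> l2_dist M g h < eps"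
    using assms(1) by (intro bexI[of _ f]) auto
qed

lemma L12_indicator:
  assumes "A \<in> sets M" "emeasure M A < \<infinity>"
  shows "indicator A \<in> L12"
proof -
  have int: "integrable M (indicator A :: _ \<Rightarrow> complex)" and L2: "(indicator A :: _ \<Rightarrow> complex) \<in> L2 M"
    if "A \<in> sets M" "emeasure M A < \<infinity>" for A
  proof -
    have "(indicator A :: _ \<Rightarrow> complex) \<in> borel_measurable M" using that(1) by measurable
    from L2_bounded_support[OF this that]
    show "integrable M (indicator A :: _ \<Rightarrow> complex)" "(indicator A :: _ \<Rightarrow> complex) \<in> L2 M"
      by (auto simp: indicator_def)
  qed
  from assms show ?thesis
  proof (induction rule: finite_measure_set_induct)
    case (vcoset a l)
    have "(indicator (vcoset p a l) :: _ \<Rightarrow> complex) = vgen vzero a l"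
      by (simp add: vgen_def fun_eq_iff)
    then show ?case using L12_step[OF step.vgen[OF zero_in_G vcoset]] by metis
  next
    case empty
    show ?case using L12_sum[of "{}"] by simp
  next
    case (Diff A B)
    have "(indicator (B - A) :: _ \<Rightarrow> complex) = (\<lambda>w. indicator B w - indicator A w)"
      using Diff(3) by (intro ext) (auto simp: indicator_def)
    then show ?case using L12_diff[OF Diff(6,5)] by simp
  next
    case (Un A B)
    have "(indicator (A \<union> B) :: _ \<Rightarrow> complex) = (\<lambda>w. indicator A w + indicator B w)"
      using Un(3) by (intro ext) (auto simp: indicator_def)
    then show ?case using L12_add[OF Un(5,6)] by simp
  next
    case (incseq A)
    let ?U = "\<Union>i. A i"
    have A: "A i \<in> sets M" for i using incseq(1) by auto
    then have U: "?U \<in> sets M" by auto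
    note lim = measure_Diff_incseq[OF A incseq(2,3)]
    show ?case
    proof (rule L12_closed[OF L2 int])
      fix eps :: real assume eps: "eps > 0"
      \<comment> \<open>The L1 distance of two indicators is the measure of the symmetric
        difference, the L2 distance its square root.\<close>
      then have "min eps (eps\<^sup>2) > 0" by simp
      from order_tendstoD(2)[OF lim this] obtain i where i: "measure M (?U - A i) < min eps (eps\<^sup>2)"
        unfolding eventually_sequentially by blast
      have sd: "?U - A i \<union> (A i - ?U) = ?U - A i" by auto
      have "(LINT w|M. norm (indicator ?U w - indicator (A i) w :: complex)) < eps"
        unfolding l2_norm_indicator_diff(2)[OF U A] sd using i by simp
      moreover have "l2_dist M (indicator ?U) (indicator (A i)) < eps"
        unfolding l2_norm_indicator_diff(1)[OF U A] sd using i eps by (simp add: real_less_lsqrt)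
      ultimately show "\<exists>g\<in>L12. l1_dist M (indicator ?U) g < eps \<and> l2_dist M (indicator ?U) g < eps"
        using incseq(4) by blast
    qed (use U incseq(3) in auto)
  next
    case (null A B)
    have 0: "measure M (B - A \<union> (A - B)) = 0"
      using null(4) by (simp add: measure_eq_0_null_sets Un_commute)
    show ?case
    proof (rule L12_closed[OF L2 int])
      fix eps :: real assume eps: "eps > 0"
      show "\<exists>g\<in>L12. l1_dist M (indicator B) g < eps \<and> l2_dist M (indicator B) g < eps"
        using null(5) eps by (intro bexI[of _ "indicator A"]) (simp_all add: l2_norm_indicator_diff[OF null(2,1)] 0)
    qed (use null in auto)
  qed
qed

section \<open>Extension of Plancherel by approximation\<close>

lemma L12_approx_sequence:
  assumes "f \<in> L12"
  obtains s where "\<And>n. step (s n)" "(\<lambda>n. l1_dist M (s n) f) \<longlonglongrightarrow> 0"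
    "(\<lambda>n. l2_dist M (s n) f) \<longlonglongrightarrow> 0"
proof -
  have "\<exists>s. step s \<and> l1_dist M f s < 1 / real (Suc n) \<and> l2_dist M f s < 1 / real (Suc n)" for n
  proof -
    have "1 / real (Suc n) > 0" by simp
    from L12E[OF assms this] show ?thesis by blast
  qed
  then have "\<forall>n. \<exists>s. step s \<and> l1_dist M f s < 1 / real (Suc n) \<and> l2_dist M f s < 1 / real (Suc n)"
    by (rule allI)
  from choice[OF this] obtain s where s: "\<And>n. step (s n)" "\<And>n. l1_dist M f (s n) < 1 / real (Suc n)"
      "\<And>n. l2_dist M f (s n) < 1 / real (Suc n)" by blast
  have "l1_dist M (s n) f \<le> 1 / real (Suc n)" for n
    using s(2)[of n] by (simp add: norm_minus_commute less_imp_le)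
  then have "(\<lambda>n. l1_dist M (s n) f) \<longlonglongrightarrow> 0"
    by (intro tendsto_sandwich[OF _ _ tendsto_const LIMSEQ_Suc[OF lim_1_over_n]] always_eventually allI) auto
  moreover have "l2_dist M (s n) f \<le> 1 / real (Suc n)" for n
    using s(3)[of n] l2_norm_minus_commute[of M f "s n"] by simp
  then have "(\<lambda>n. l2_dist M (s n) f) \<longlonglongrightarrow> 0"
    by (intro tendsto_sandwich[OF _ _ tendsto_const LIMSEQ_Suc[OF lim_1_over_n]] always_eventually allI) auto
  ultimately show ?thesis using s(1) that by blast
qed

text \<open>The limit needs no construction: \<open>T f\<close> is already the pointwise limit of
  the \<open>T (s n)\<close>. Plancherel for steps bounds the distance of \<open>T (s m)\<close> and
  \<open>T (s n)\<close> by \<open>d m + d n\<close>; Fatou in \<open>m\<close> leaves the bound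
  \<open>d n\<close> for the distance to \<open>T f\<close>, which also shows that
  \<open>T f\<close> is square-integrable.\<close>

lemma T_tendsto:
  assumes f: "f \<in> L12" and s: "\<And>n. step (s n)"
    and L1: "(\<lambda>n. l1_dist M (s n) f) \<longlonglongrightarrow> 0"
    and l2: "(\<lambda>n. l2_dist M (s n) f) \<longlonglongrightarrow> 0"
  shows "T f \<in> L2 M" "(\<lambda>n. l2_dist M (T (s n)) (T f)) \<longlonglongrightarrow> 0"
proof -
  define d where "d n = l2_dist M (s n) f" for n
  have pt: "(\<lambda>n. T (s n) x) \<longlonglongrightarrow> T f x" if x: "x \<in> G" for x
  proof -
    have "norm (T (s n) x - T f x) \<le> l1_dist M (s n) f" for n
      using norm_T_le[of "\<lambda>w. s n w - f w" x] T_diff[OF step_integrable[OF s] L12_integrable[OF f] x]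
        step_integrable[OF s] L12_integrable[OF f] by simp
    from always_eventually[OF allI[OF this]] L1
    have "(\<lambda>n. T (s n) x - T f x) \<longlonglongrightarrow> 0" by (rule Lim_null_comparison)
    then show ?thesis by (simp add: LIM_zero_iff)
  qed
  have Ts: "T (s n) \<in> L2 M" for n using T_step_L2[OF s] .
  have Tsm: "T (s n) \<in> borel_measurable M" for n using Ts by (rule L2_measurable)
  have Tfm: "T f \<in> borel_measurable M"
    by (rule borel_measurable_LIMSEQ_metric[where f = "\<lambda>n. T (s n)", OF Tsm]) (simp add: pt)
  have Cauchy: "l2_dist M (T (s m)) (T (s n)) \<le> d m + d n" for m n
  proof -
    have "l2_dist M (T (s m)) (T (s n)) = l2_norm M (T (\<lambda>w. s m w - s n w))"
      by (intro l2_norm_cong) (simp add: T_diff step_integrable s)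
    also have "\<dots> = l2_dist M (s m) (s n)"
      by (rule T_step_norm[OF step_diff[OF s s]])
    also have "\<dots> \<le> l2_dist M (s m) f + l2_dist M f (s n)"
      using s f by (intro l2_norm_triangle_diff step_L2 L12_L2)
    finally show ?thesis by (simp add: d_def l2_norm_minus_commute[of M f])
  qed
  have fatou: "(\<integral>\<^sup>+x. ennreal ((norm (T f x - T (s n) x))\<^sup>2) \<partial>M) \<le> ennreal ((d n)\<^sup>2)" for n
  proof -
    have "(\<integral>\<^sup>+x. ennreal ((norm (T f x - T (s n) x))\<^sup>2) \<partial>M)
        = (\<integral>\<^sup>+x. liminf (\<lambda>m. ennreal ((norm (T (s m) x - T (s n) x))\<^sup>2)) \<partial>M)"
    proof (rule nn_integral_cong)
      fix x assume "x \<in> space M"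
      then have "(\<lambda>m. ennreal ((norm (T (s m) x - T (s n) x))\<^sup>2)) \<longlonglongrightarrow> ennreal ((norm (T f x - T (s n) x))\<^sup>2)"
        by (intro tendsto_ennrealI tendsto_intros pt) simp
      from lim_imp_Liminf[OF trivial_limit_sequentially this]
      show "ennreal ((norm (T f x - T (s n) x))\<^sup>2) = liminf (\<lambda>m. ennreal ((norm (T (s m) x - T (s n) x))\<^sup>2))"
        by (rule sym)
    qed
    also have "\<dots> \<le> liminf (\<lambda>m. \<integral>\<^sup>+x. ennreal ((norm (T (s m) x - T (s n) x))\<^sup>2) \<partial>M)"
      using Tsm by (intro nn_integral_liminf) measurable
    also have "\<dots> = liminf (\<lambda>m. ennreal ((l2_dist M (T (s m)) (T (s n)))\<^sup>2))"
      using L2_integrable_square[OF L2_diff[OF Ts Ts]]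
      by (simp add: nn_integral_eq_integral l2_norm_square)
    also have "\<dots> \<le> liminf (\<lambda>m. ennreal ((d m + d n)\<^sup>2))"
      using Cauchy by (intro Liminf_mono always_eventually allI ennreal_leI power_mono) auto
    also have "(\<lambda>m. ennreal ((d m + d n)\<^sup>2)) \<longlonglongrightarrow> ennreal ((0 + d n)\<^sup>2)"
      using l2 by (intro tendsto_ennrealI tendsto_intros) (simp add: d_def)
    from lim_imp_Liminf[OF trivial_limit_sequentially this]
    have "liminf (\<lambda>m. ennreal ((d m + d n)\<^sup>2)) = ennreal ((d n)\<^sup>2)" by simp
    finally show ?thesis .
  qed
  have diff_L2: "(\<lambda>x. T f x - T (s n) x) \<in> L2 M" for n
  proof -
    have "integrable M (\<lambda>x. (norm (T f x - T (s n) x))\<^sup>2)"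
    proof (rule integrableI_bounded)
      have "(\<integral>\<^sup>+x. ennreal (norm ((norm (T f x - T (s n) x))\<^sup>2)) \<partial>M) \<le> ennreal ((d n)\<^sup>2)"
        using fatou[of n] by simp
      then show "(\<integral>\<^sup>+x. ennreal (norm ((norm (T f x - T (s n) x))\<^sup>2)) \<partial>M) < \<infinity>"
        by (rule le_less_trans) simp
    qed (use Tsm Tfm in measurable)
    then show ?thesis using Tsm Tfm by (simp add: L2_def)
  qed
  have le: "l2_dist M (T (s n)) (T f) \<le> d n" for n
  proof -
    have "ennreal ((l2_dist M (T f) (T (s n)))\<^sup>2) \<le> ennreal ((d n)\<^sup>2)"
      using fatou[of n] L2_integrable_square[OF diff_L2, of n]
      by (simp add: nn_integral_eq_integral l2_norm_square)
    then have "(l2_dist M (T f) (T (s n)))\<^sup>2 \<le> (d n)\<^sup>2"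
      by (subst (asm) ennreal_le_iff) auto
    then have "l2_dist M (T f) (T (s n)) \<le> d n"
      by (rule power2_le_imp_le) (simp add: d_def)
    then show ?thesis by (simp add: l2_norm_minus_commute[of M "T f"])
  qed
  show "T f \<in> L2 M"
    using L2_add[OF diff_L2[of 0] Ts[of 0]] by simp
  have "norm (l2_dist M (T (s n)) (T f)) \<le> d n" for n using le[of n] by simp
  from always_eventually[OF allI[OF this]]
  show "(\<lambda>n. l2_dist M (T (s n)) (T f)) \<longlonglongrightarrow> 0"
    by (rule Lim_null_comparison) (simp only: d_def l2)
qed

lemma T_L2:
  assumes "f \<in> L12" shows "T f \<in> L2 M"
  by (rule L12_approx_sequence[OF assms]) (rule T_tendsto(1)[OF assms])

lemma plancherel:
  assumes f: "f \<in> L12" and g: "g \<in> L12"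
  shows "l2_inner M (T f) (T g) = l2_inner M f g"
proof -
  obtain s where s: "\<And>n. step (s n)" "(\<lambda>n. l1_dist M (s n) f) \<longlonglongrightarrow> 0"
    "(\<lambda>n. l2_dist M (s n) f) \<longlonglongrightarrow> 0"
    using L12_approx_sequence[OF f] by blast
  obtain t where t: "\<And>n. step (t n)" "(\<lambda>n. l1_dist M (t n) g) \<longlonglongrightarrow> 0"
    "(\<lambda>n. l2_dist M (t n) g) \<longlonglongrightarrow> 0"
    using L12_approx_sequence[OF g] by blast
  have "(\<lambda>n. l2_inner M (T (s n)) (T (t n))) \<longlonglongrightarrow> l2_inner M (T f) (T g)"
    using T_tendsto[OF f s] T_tendsto[OF g t] T_step_L2[OF s(1)] T_step_L2[OF t(1)]
    by (intro l2_inner_tendsto)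
  moreover have "(\<lambda>n. l2_inner M (s n) (t n)) \<longlonglongrightarrow> l2_inner M f g"
    using L12_L2[OF f] L12_L2[OF g] step_L2[OF s(1)] step_L2[OF t(1)] s(3) t(3)
    by (intro l2_inner_tendsto)
  ultimately show ?thesis
    using T_step_inner[OF s(1) t(1)] LIMSEQ_unique by simp
qed

lemma l2_norm_T: "f \<in> L12 \<Longrightarrow> l2_norm M (T f) = l2_norm M f"
  by (intro l2_norm_eqI plancherel)

end

subsection \<open>Folding onto \<open>vnbhd p 0\<close>\<close>

text \<open>As sets of sequences the two coincide, so one index set serves for the translations in
  the wavelet system and for the pieces of a congruence.\<close>

lemma vH_perp_eq: "vH_perp p = vH p"
  by (simp add: vH_perp_def vH_def)

lemma vHD: "h \<in> vH p \<Longrightarrow> h \<in> vilenkin p"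
  by (simp add: vH_def)

lemma zero_in_vH: "p > 0 \<Longrightarrow> vzero \<in> vH p"
  by (simp add: vH_def zero_in_vilenkin)

lemma vminus_in_vH: "p > 0 \<Longrightarrow> g \<in> vH p \<Longrightarrow> h \<in> vH p \<Longrightarrow> vminus p g h \<in> vH p"
  using vminus_in_vilenkin[of p g h] by (simp add: vH_def vminus_def)

text \<open>The representative in \<open>vnbhd p 0\<close> of a class modulo the annihilator of
  \<open>H\<close>: coordinates at positive indices are kept.\<close>

definition vfrac :: "(int \<Rightarrow> int) \<Rightarrow> int \<Rightarrow> int" where
  "vfrac x = (\<lambda>j. if j \<le> 0 then 0 else x j)"

lemma vfrac_in_vnbhd: "p > 0 \<Longrightarrow> x \<in> vilenkin p \<Longrightarrow> vfrac x \<in> vnbhd p 0"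
  unfolding mem_vnbhd vilenkin_iff vfrac_def by (auto intro!: exI[of _ 0])

lemma vfrac_id: "x \<in> vnbhd p 0 \<Longrightarrow> vfrac x = x"
  by (auto simp: vfrac_def mem_vnbhd)

lemma vfrac_vadd_vH: "h \<in> vH p \<Longrightarrow> x \<in> vilenkin p \<Longrightarrow> vfrac (vadd p h x) = vfrac x"
  by (auto simp: vfrac_def vadd_def vH_def vilenkin_mod)

text \<open>\<open>h\<close> lives at indices \<open>j \<le> 0\<close> and pairs them with
  \<open>1 - j \<ge> 1\<close>, which \<open>vfrac\<close> does not touch. Characters from
  \<open>H\<close> are thus functions on the quotient by its annihilator.\<close>

lemma vchar_vfrac:
  assumes "h \<in> vH p" shows "vchar p h (vfrac x) = vchar p h x"
proof -
  have "h j * vfrac x (1 - j) = h j * x (1 - j)" for j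
    using assms by (cases "j > 0") (auto simp: vfrac_def vH_def)
  then show ?thesis by (simp only: vchar_def)
qed

lemma vcoset_vH_inj:
  assumes "p > 0" "g \<in> vH p" "h \<in> vH p" "x \<in> vcoset p g 0" "x \<in> vcoset p h 0"
  shows "g = h"
proof
  fix j
  show "g j = h j"
  proof (cases "j \<le> 0")
    case True
    then show ?thesis using assms vHD[of g] vHD[of h] by (simp add: mem_vcoset)
  qed (use assms in \<open>simp add: vH_def\<close>)
qed

lemma countable_vH: assumes "p > 0" shows "countable (vH p)"
proof (rule countable_image_inj_on)
  show "countable ((\<lambda>h. vcoset p h 0) ` vH p)"
    using countable_vcosets[OF assms] by (rule countable_subset[rotated]) (auto simp: vcosets_def vHD)
  show "inj_on (\<lambda>h. vcoset p h 0) (vH p)"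
  proof (rule inj_onI)
    fix g h assume gh: "g \<in> vH p" "h \<in> vH p" "vcoset p g 0 = vcoset p h 0"
    have "g \<in> vcoset p g 0" using vcoset_self[OF assms vHD[OF gh(1)]] .
    moreover from this have "g \<in> vcoset p h 0" unfolding gh(3) .
    ultimately show "g = h" by (rule vcoset_vH_inj[OF assms gh(1,2)])
  qed
qed

text \<open>There are countably many overlaps, so their union \<open>Z\<close> is null and can be
  removed to make the pieces disjoint. The set \<open>B\<close> is there to measure traces of the
  pieces, in particular on preimages under \<open>vfrac\<close>.\<close>

lemma emeasure_partition_mod_null:
  assumes P: "partition_mod_null N I P E" and I: "countable I" and E: "E \<in> sets N" and B: "B \<in> sets N"
  shows "emeasure N (E \<inter> B) = (\<integral>\<^sup>+i. emeasure N (P i \<inter> B) \<partial>count_space I)"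
proof -
  have sets: "P i \<in> sets N" if "i \<in> I" for i
    using P that by (simp add: partition_mod_null_def)
  define Z where "Z = (\<Union>i\<in>I. \<Union>j\<in>I - {i}. P i \<inter> P j)"
  have Z: "Z \<in> null_sets N"
    unfolding Z_def using P I by (intro null_sets_UN') (auto simp: partition_mod_null_def)
  have ZN: "Z \<in> sets N" using Z by auto
  have un: "(\<Union>i\<in>I. P i) \<in> sets N" using sets I by (intro sets.countable_UN') auto
  have d: "(\<Union>i\<in>I. P i) - E \<in> null_sets N" "E - (\<Union>i\<in>I. P i) \<in> null_sets N"
    using P by (simp_all add: partition_mod_null_def)
  from AE_not_in[OF Z] AE_not_in[OF d(1)] AE_not_in[OF d(2)] have "AE x in N. x \<in> E \<inter> B \<longleftrightarrow> x \<in> (\<Union>i\<in>I. P i \<inter> B - Z)"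
    by eventually_elim auto
  then have "emeasure N (E \<inter> B) = emeasure N (\<Union>i\<in>I. P i \<inter> B - Z)"
  proof (rule emeasure_eq_AE)
    show "(\<Union>i\<in>I. P i \<inter> B - Z) \<in> sets N"
      using sets I B ZN by (intro sets.countable_UN') auto
  qed (use E B in auto)
  also have "\<dots> = (\<integral>\<^sup>+i. emeasure N (P i \<inter> B - Z) \<partial>count_space I)"
  proof (rule emeasure_UN_countable)
    show "disjoint_family_on (\<lambda>i. P i \<inter> B - Z) I"
      unfolding disjoint_family_on_def Z_def by blast
  qed (use sets B ZN I in auto)
  also have "\<dots> = (\<integral>\<^sup>+i. emeasure N (P i \<inter> B) \<partial>count_space I)"
    using sets B Z by (intro nn_integral_cong emeasure_Diff_null_set) auto
  finally show ?thesis .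
qed

context vilenkin_haar
begin

declare vHD [simp]

lemmas zero_in_H = zero_in_vH[OF p_pos] and countable_H = countable_vH[OF p_pos]
  and vfrac_in_U = vfrac_in_vnbhd[OF p_pos]

abbreviation "U \<equiv> vnbhd p 0"
abbreviation "H \<equiv> vH p"

lemma H_vneg: "h \<in> H \<Longrightarrow> vneg h \<in> H"
  by (rule vminus_in_vH[OF p_pos zero_in_H])

lemma vadd_vneg_cancel: "x \<in> G \<Longrightarrow> vadd p (vneg y) (vadd p y x) = x"
  using vadd_vminus_self[of p y] vadd_zero[of x p] by (metis vadd_assoc vadd_commute)

lemma vfrac_decomp:
  assumes x: "x \<in> G"
  obtains h where "h \<in> H" "vadd p h x = vfrac x" "x \<in> vcoset p (vneg h) 0"
proof -
  let ?h = "vminus p (vfrac x) x"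
  have f: "vfrac x \<in> G" using vfrac_in_U[OF x] by (rule vnbhdD)
  have "?h \<in> H"
    using vminus_in_G[OF f x] by (simp add: vH_def vminus_def vfrac_def del: vHD)
  moreover have "vadd p ?h x = vfrac x"
    using vadd_vminus_cancel[OF f, of x] by (simp add: vadd_commute)
  moreover have "x \<in> vcoset p (vneg ?h) 0"
  proof -
    have "x j = vneg ?h j" if "j \<le> 0" for j
      using that x by (simp add: vminus_def vfrac_def mod_simps vilenkin_mod)
    then show ?thesis using x f vminus_in_G[OF f x] by (simp add: mem_vcoset[OF p_pos])
  qed
  ultimately show ?thesis by (rule that)
qed

lemma vadd_in_U:
  assumes h: "h \<in> H" and x: "x \<in> vcoset p (vneg h) 0"
  shows "vadd p h x \<in> U" "vadd p h x = vfrac x"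
proof -
  have hv: "h \<in> G" "x \<in> G" using h x by (simp_all add: mem_vcoset[OF p_pos])
  have "vadd p h x j = 0" if "j \<le> 0" for j
  proof -
    have "x j = vneg h j" using that x hv by (simp add: mem_vcoset[OF p_pos])
    then show ?thesis by (simp add: vadd_def vminus_def mod_simps)
  qed
  then show U: "vadd p h x \<in> U" using hv by (simp add: mem_vnbhd vadd_in_G)
  show "vadd p h x = vfrac x"
    using vfrac_id[OF U] vfrac_vadd_vH[OF h hv(2)] by simp
qed

text \<open>Displays the preimage as countably many translates of one set; measurability and nullity
  are both read off from this.\<close>

lemma vfrac_vimage_eq: "vfrac -` A \<inter> G = (\<Union>h\<in>H. vadd p h ` (A \<inter> U))"
proof (intro equalityI subsetI)
  fix x assume x: "x \<in> vfrac -` A \<inter> G"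
  then obtain h where h: "h \<in> H" "vadd p h x = vfrac x" using vfrac_decomp by blast
  then have "x = vadd p (vneg h) (vfrac x)" using x vadd_vneg_cancel[of x h] by simp
  moreover have "vfrac x \<in> A \<inter> U" using x vfrac_in_U by simp
  ultimately show "x \<in> (\<Union>h\<in>H. vadd p h ` (A \<inter> U))" using H_vneg[OF h(1)] by blast
next
  fix x assume "x \<in> (\<Union>h\<in>H. vadd p h ` (A \<inter> U))"
  then obtain h y where hy: "h \<in> H" "y \<in> A" "y \<in> U" "x = vadd p h y" by blast
  then have y: "y \<in> G" by (simp add: vnbhdD)
  have "vfrac x = y" using hy vfrac_vadd_vH[OF hy(1) y] vfrac_id[OF hy(3)] by simp
  then show "x \<in> vfrac -` A \<inter> G"
    using hy y by (simp add: vadd_in_G)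
qed

lemma vfrac_vimage_sets: "A \<in> sets M \<Longrightarrow> vfrac -` A \<inter> G \<in> sets M"
  unfolding vfrac_vimage_eq using countable_H vnbhd_in_M
  by (intro sets.countable_UN') (auto intro!: sets_vadd_image)

lemma vfrac_measurable: "vfrac \<in> M \<rightarrow>\<^sub>M M"
  using vfrac_vimage_sets vfrac_in_U by (intro measurableI) (auto simp: mem_vnbhd)

lemma vfrac_vimage_null: "A \<in> null_sets M \<Longrightarrow> vfrac -` A \<inter> G \<in> null_sets M"
proof -
  assume A: "A \<in> null_sets M"
  have "A \<inter> U \<in> null_sets M" using A vnbhd_in_M by (rule null_set_Int2)
  then have "vadd p h ` (A \<inter> U) \<in> null_sets M" if "h \<in> H" for h
    using that emeasure_vadd_image[of h "A \<inter> U"] sets_vadd_image[of h "A \<inter> U"] by (simp add: null_sets_def)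
  then show ?thesis unfolding vfrac_vimage_eq using countable_H by (intro null_sets_UN') auto
qed

text \<open>Translation congruence with \<open>U\<close>, restated without reference to a partition: the
  restriction of the measure to \<open>\<Omega>\<close> is pushed forward by \<open>vfrac\<close> to its restriction to \<open>U\<close>.\<close>

definition folds :: "(int \<Rightarrow> int) set \<Rightarrow> bool" where
  "folds \<Omega> \<longleftrightarrow> (\<forall>A\<in>sets M. emeasure M (\<Omega> \<inter> vfrac -` A) = emeasure M (U \<inter> A))"

lemma sets_sub_G: "A \<in> sets M \<Longrightarrow> A \<subseteq> G"
  using sets.sets_into_space[of A M] by simp

lemma Int_vfrac: "\<Omega> \<in> sets M \<Longrightarrow> \<Omega> \<inter> vfrac -` A = \<Omega> \<inter> (vfrac -` A \<inter> G)"
  using sets_sub_G[of \<Omega>] by blast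

lemma Int_vfrac_sets: "\<Omega> \<in> sets M \<Longrightarrow> A \<in> sets M \<Longrightarrow> \<Omega> \<inter> vfrac -` A \<in> sets M"
  using Int_vfrac[of \<Omega> A] vfrac_vimage_sets[of A] by simp

definition folded :: "(int \<Rightarrow> int) set \<Rightarrow> (int \<Rightarrow> int) measure" where
  "folded \<Omega> = distr (density M (indicator \<Omega>)) M vfrac"

lemma sets_folded [simp]: "sets (folded \<Omega>) = sets M"
  by (simp add: folded_def)

lemma emeasure_folded:
  assumes \<Omega>: "\<Omega> \<in> sets M" and A: "A \<in> sets M"
  shows "emeasure (folded \<Omega>) A = emeasure M (\<Omega> \<inter> vfrac -` A)"
proof -
  have "vfrac \<in> density M (indicator \<Omega>) \<rightarrow>\<^sub>M M" using vfrac_measurable by simp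
  from emeasure_distr[OF this A] show ?thesis
    using emeasure_restricted[OF \<Omega> vfrac_vimage_sets[OF A]] Int_vfrac[OF \<Omega>] by (simp add: folded_def)
qed

text \<open>\<open>vfrac\<close> is invariant under translation by \<open>H\<close>, so moving a
  piece by \<open>h\<close> does not change the measure of its part over \<open>A\<close>. Summing
  gives \<open>\<Omega>\<close> on one side and \<open>U\<close> on the other, where
  \<open>vfrac\<close> is the identity.\<close>

lemma folds_if_translation_congruent:
  assumes \<Omega>: "\<Omega> \<in> sets M" and tc: "translation_congruent p M \<Omega> U"
  shows "folds \<Omega>"
  unfolding folds_def
proof
  fix A assume A: "A \<in> sets M"
  obtain P where P: "partition_mod_null M H P \<Omega>" "partition_mod_null M H (\<lambda>h. vadd p h ` P h) U"
    using tc by (auto simp: translation_congruent_def vH_perp_eq)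
  let ?B = "vfrac -` A \<inter> G"
  have B: "?B \<in> sets M" using A by (rule vfrac_vimage_sets)
  have "emeasure M (\<Omega> \<inter> vfrac -` A) = (\<integral>\<^sup>+h. emeasure M (P h \<inter> ?B) \<partial>count_space H)"
    unfolding Int_vfrac[OF \<Omega>]
    by (rule emeasure_partition_mod_null[OF P(1) countable_H \<Omega> B])
  also have "\<dots> = (\<integral>\<^sup>+h. emeasure M (vadd p h ` P h \<inter> ?B) \<partial>count_space H)"
  proof (rule nn_integral_cong)
    fix h assume "h \<in> space (count_space H)"
    then have h: "h \<in> H" by simp
    have Ph: "P h \<in> sets M" using P(1) h by (simp add: partition_mod_null_def)
    have "vadd p h ` P h \<inter> ?B = vadd p h ` (P h \<inter> ?B)"
      using sets_sub_G[OF Ph] vfrac_vadd_vH[OF h] vadd_in_G[OF vHD[OF h]]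
      by (auto simp: subset_iff)
    then show "emeasure M (P h \<inter> ?B) = emeasure M (vadd p h ` P h \<inter> ?B)"
      using emeasure_vadd_image[of h "P h \<inter> ?B"] h Ph B by simp
  qed
  also have "\<dots> = emeasure M (U \<inter> ?B)"
    by (rule emeasure_partition_mod_null[OF P(2) countable_H vnbhd_in_M B, symmetric])
  also have "U \<inter> ?B = U \<inter> A" using vfrac_id[of _ p] by (auto simp: mem_vnbhd)
  finally show "emeasure M (\<Omega> \<inter> vfrac -` A) = emeasure M (U \<inter> A)" .
qed

text \<open>The part of \<open>\<Omega>\<close> that translation by \<open>h\<close> carries into
  \<open>U\<close>. These pieces are the canonical candidate for the partition in a
  congruence.\<close>

definition vpiece :: "(int \<Rightarrow> int) set \<Rightarrow> (int \<Rightarrow> int) \<Rightarrow> (int \<Rightarrow> int) set" where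
  "vpiece \<Omega> h = \<Omega> \<inter> vcoset p (vneg h) 0"

lemma vpiece_sets: "\<Omega> \<in> sets M \<Longrightarrow> h \<in> H \<Longrightarrow> vpiece \<Omega> h \<in> sets M"
  unfolding vpiece_def by (intro sets.Int vcoset_in_M) auto

lemma vpiece_Int:
  assumes "g \<in> H" "h \<in> H" "g \<noteq> h"
  shows "vpiece \<Omega> g \<inter> vpiece \<Omega> h = {}"
proof (rule equals0I)
  fix x assume "x \<in> vpiece \<Omega> g \<inter> vpiece \<Omega> h"
  then have "x \<in> vcoset p (vneg g) 0" "x \<in> vcoset p (vneg h) 0" by (auto simp: vpiece_def)
  then have "vneg g = vneg h" by (rule vcoset_vH_inj[OF p_pos H_vneg[OF assms(1)] H_vneg[OF assms(2)]])
  then show False using vneg_vneg[of g] vneg_vneg[of h] assms by simp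
qed

lemma vpieceI: "x \<in> \<Omega> \<Longrightarrow> x \<in> vcoset p (vneg h) 0 \<Longrightarrow> vadd p h x = y \<Longrightarrow> y \<in> vadd p h ` vpiece \<Omega> h"
  by (auto simp: vpiece_def)

lemma vpiece_Un: "\<Omega> \<subseteq> G \<Longrightarrow> (\<Union>h\<in>H. vpiece \<Omega> h) = \<Omega>"
  unfolding vpiece_def using vfrac_decomp by blast

lemma vadd_image_vpiece:
  assumes "h \<in> H" "A \<subseteq> vadd p h ` vpiece \<Omega> h"
  shows "vadd p h ` (vpiece \<Omega> h \<inter> vfrac -` A) = A"
proof -
  have *: "vadd p h x = vfrac x" if "x \<in> vpiece \<Omega> h" for x
    using vadd_in_U(2)[OF assms(1)] that by (simp add: vpiece_def)
  show ?thesis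
  proof (intro equalityI subsetI)
    fix y assume "y \<in> vadd p h ` (vpiece \<Omega> h \<inter> vfrac -` A)"
    then show "y \<in> A" using * by auto
  next
    fix y assume y: "y \<in> A"
    then obtain x where x: "x \<in> vpiece \<Omega> h" "y = vadd p h x" using assms by blast
    then have "x \<in> vpiece \<Omega> h \<inter> vfrac -` A" using * y by simp
    then show "y \<in> vadd p h ` (vpiece \<Omega> h \<inter> vfrac -` A)" using x by blast
  qed
qed

text \<open>Each point of the overlap has a preimage under \<open>vfrac\<close> in two disjoint
  pieces, and in each piece these preimages form a translate of the overlap. So \<open>folds\<close>
  yields 2m \<le> m for its measure m, which is finite inside \<open>U\<close>.\<close>

lemma folds_overlap_null:
  assumes \<Omega>: "\<Omega> \<in> sets M" and f: "folds \<Omega>" and gh: "g \<in> H" "h \<in> H" "g \<noteq> h"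
  shows "vadd p g ` vpiece \<Omega> g \<inter> vadd p h ` vpiece \<Omega> h \<in> null_sets M"
proof -
  let ?A = "vadd p g ` vpiece \<Omega> g \<inter> vadd p h ` vpiece \<Omega> h"
  let ?X = "\<lambda>h. vpiece \<Omega> h \<inter> vfrac -` ?A"
  have A: "?A \<in> sets M" using \<Omega> gh by (intro sets.Int sets_vadd_image vpiece_sets) auto
  have X: "?X k \<in> sets M" if "k \<in> H" for k
    by (rule Int_vfrac_sets[OF vpiece_sets[OF \<Omega> that] A])
  have eq: "emeasure M (?X k) = emeasure M ?A" if k: "k \<in> H" "?A \<subseteq> vadd p k ` vpiece \<Omega> k" for k
    using emeasure_vadd_image[OF vHD[OF k(1)] X[OF k(1)]] vadd_image_vpiece[OF k] by simp
  have AU: "?A \<subseteq> U" using vadd_in_U(1)[OF gh(1)] by (auto simp: vpiece_def)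
  have disj: "?X g \<inter> ?X h = {}" using vpiece_Int[OF gh] by blast
  have "emeasure M ?A + emeasure M ?A = emeasure M (?X g) + emeasure M (?X h)"
    using eq[OF gh(1)] eq[OF gh(2)] by simp
  also have "\<dots> = emeasure M (?X g \<union> ?X h)"
    using plus_emeasure[OF X[OF gh(1)] X[OF gh(2)] disj] .
  also have "\<dots> \<le> emeasure M (\<Omega> \<inter> vfrac -` ?A)"
    using Int_vfrac_sets[OF \<Omega> A] by (intro emeasure_mono) (auto simp: vpiece_def)
  also have "\<dots> = emeasure M (U \<inter> ?A)" using f A unfolding folds_def by blast
  also have "U \<inter> ?A = ?A" using AU by blast
  finally have le: "emeasure M ?A + emeasure M ?A \<le> emeasure M ?A" .
  have "emeasure M ?A \<le> emeasure M U" using AU vnbhd_in_M by (rule emeasure_mono)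
  also have "emeasure M U = 1" using emeasure_vnbhd[of 0] vnbhd_in_mu by simp
  finally have "emeasure M ?A \<noteq> \<infinity>" by (rule neq_top_trans[rotated, simplified infinity_ennreal_def[symmetric]]) simp
  then have "emeasure M ?A = 0"
    using le ennreal_add_left_cancel_le[of "emeasure M ?A" "emeasure M ?A" 0] by simp
  then show ?thesis using A by (rule null_setsI)
qed

lemma translation_congruent_if_folds:
  assumes \<Omega>: "\<Omega> \<in> sets M" and f: "folds \<Omega>"
  shows "translation_congruent p M \<Omega> U"
proof -
  let ?Q = "\<lambda>h. vadd p h ` vpiece \<Omega> h"
  have Q: "?Q h \<in> sets M" if "h \<in> H" for h
    using \<Omega> that by (intro sets_vadd_image vpiece_sets) auto
  have "partition_mod_null M H (vpiece \<Omega>) \<Omega>"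
    unfolding partition_mod_null_def
  proof (intro conjI ballI impI)
    show "vpiece \<Omega> h \<in> sets M" if "h \<in> H" for h using \<Omega> that by (rule vpiece_sets)
    show "vpiece \<Omega> g \<inter> vpiece \<Omega> h \<in> null_sets M" if "g \<in> H" "h \<in> H" "g \<noteq> h" for g h
      using vpiece_Int[OF that] by simp
  qed (simp_all add: vpiece_Un[OF sets_sub_G[OF \<Omega>]])
  moreover have "partition_mod_null M H ?Q U"
    unfolding partition_mod_null_def
  proof (intro conjI ballI impI)
    have "(\<Union>h\<in>H. ?Q h) - U = {}" using vadd_in_U(1) by (auto simp: vpiece_def)
    then show "(\<Union>h\<in>H. ?Q h) - U \<in> null_sets M" by (simp only: null_sets.empty_sets)
    let ?A = "U - (\<Union>h\<in>H. ?Q h)"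
    have A: "?A \<in> sets M"
      using Q countable_H vnbhd_in_M by (intro sets.Diff sets.countable_UN') auto
    \<comment> \<open>No point of \<open>\<Omega>\<close> folds onto the uncovered part of
      \<open>U\<close>, so \<open>folds\<close> gives that part measure 0.\<close>
    have "\<Omega> \<inter> vfrac -` ?A = {}"
    proof (rule equals0I)
      fix x assume x: "x \<in> \<Omega> \<inter> vfrac -` ?A"
      then obtain h where "h \<in> H" "vadd p h x = vfrac x" "x \<in> vcoset p (vneg h) 0"
        using vfrac_decomp sets_sub_G[OF \<Omega>] by blast
      then have "vfrac x \<in> ?Q h" using x by (intro vpieceI) auto
      then show False using x \<open>h \<in> H\<close> by blast
    qed
    moreover have "emeasure M (\<Omega> \<inter> vfrac -` ?A) = emeasure M (U \<inter> ?A)"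
      using f A unfolding folds_def by blast
    moreover have "U \<inter> ?A = ?A" by blast
    ultimately have "emeasure M ?A = 0" by simp
    then show "?A \<in> null_sets M" using A by (rule null_setsI)
  qed (use Q folds_overlap_null[OF \<Omega> f] in auto)
  ultimately show ?thesis unfolding translation_congruent_def vH_perp_eq by blast
qed

text \<open>\<open>vfrac\<close> is essentially injective on \<open>\<Omega>\<close>: distinct
  points with equal images come from different pieces, so their image lies in an overlap, and the
  preimage of the null set of overlaps is null. This allows subsets of \<open>\<Omega>\<close> to be
  pulled back from \<open>U\<close>.\<close>

lemma folds_vfrac_image:
  assumes \<Omega>: "\<Omega> \<in> sets M" and f: "folds \<Omega>" and E: "E \<in> sets M" "E \<subseteq> \<Omega>"
  shows "vfrac ` E \<in> sets M" "AE w in M. w \<in> E \<longleftrightarrow> w \<in> \<Omega> \<and> vfrac w \<in> vfrac ` E"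
proof -
  have eq: "vfrac ` E = (\<Union>h\<in>H. vadd p h ` vpiece E h)"
  proof (intro equalityI subsetI)
    fix y assume "y \<in> vfrac ` E"
    then obtain x where x: "x \<in> E" "y = vfrac x" by blast
    then obtain h where h: "h \<in> H" "vadd p h x = vfrac x" "x \<in> vcoset p (vneg h) 0"
      using vfrac_decomp sets_sub_G[OF E(1)] by blast
    then have "y \<in> vadd p h ` vpiece E h" using x by (intro vpieceI) auto
    then show "y \<in> (\<Union>h\<in>H. vadd p h ` vpiece E h)" using h by blast
  next
    fix y assume "y \<in> (\<Union>h\<in>H. vadd p h ` vpiece E h)"
    then show "y \<in> vfrac ` E" using vadd_in_U(2) by (auto simp: vpiece_def)
  qed
  show "vfrac ` E \<in> sets M"
    unfolding eq using E(1) countable_H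
    by (intro sets.countable_UN') (auto intro!: sets_vadd_image vpiece_sets)
  let ?Q = "\<lambda>h. vadd p h ` vpiece \<Omega> h"
  let ?D = "\<Union>g\<in>H. \<Union>h\<in>H - {g}. ?Q g \<inter> ?Q h"
  have "?D \<in> null_sets M"
    using countable_H folds_overlap_null[OF \<Omega> f] by (intro null_sets_UN') auto
  then have "AE w in M. w \<notin> vfrac -` ?D \<inter> G" by (intro AE_not_in vfrac_vimage_null)
  then show "AE w in M. w \<in> E \<longleftrightarrow> w \<in> \<Omega> \<and> vfrac w \<in> vfrac ` E"
  proof eventually_elim
    case (elim w)
    show ?case
    proof
      assume "w \<in> \<Omega> \<and> vfrac w \<in> vfrac ` E"
      then obtain e where e: "w \<in> \<Omega>" "e \<in> E" "vfrac w = vfrac e" by auto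
      then have v: "w \<in> G" "e \<in> G" using sets_sub_G \<Omega> E by blast+
      obtain g where g: "g \<in> H" "vadd p g w = vfrac w" "w \<in> vcoset p (vneg g) 0" using vfrac_decomp[OF v(1)] .
      obtain h where h: "h \<in> H" "vadd p h e = vfrac e" "e \<in> vcoset p (vneg h) 0" using vfrac_decomp[OF v(2)] .
      have "vfrac w \<in> ?Q g" using g e(1) by (intro vpieceI)
      moreover have "vfrac w \<in> ?Q h" using h e E(2) by (intro vpieceI) auto
      ultimately have "g = h" using elim v(1) g(1) h(1) by blast
      then have "w = e"
        using g(2) h(2) e(3) vadd_vneg_cancel[OF v(1), of g] vadd_vneg_cancel[OF v(2), of h] by simp
      then show "w \<in> E" using e by simp
    qed (use E in auto)
  qed
qed

lemma folds_integral:
  fixes g :: "(int \<Rightarrow> int) \<Rightarrow> 'b :: {banach, second_countable_topology}"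
  assumes \<Omega>: "\<Omega> \<in> sets M" and f: "folds \<Omega>" and g: "g \<in> borel_measurable M"
  shows "(LINT w|M. indicator \<Omega> w *\<^sub>R g (vfrac w)) = (LINT w|M. indicator U w *\<^sub>R g w)"
proof -
  have D: "folded \<Omega> = density M (indicator U)"
    using f by (intro measure_eqI)
      (simp_all add: emeasure_folded[OF \<Omega>] folds_def emeasure_restricted[OF vnbhd_in_M])
  have "(LINT w|M. indicator \<Omega> w *\<^sub>R g (vfrac w)) = (LINT w|density M (\<lambda>w. ennreal (indicator \<Omega> w)). g (vfrac w))"
    using \<Omega> g vfrac_measurable by (subst integral_density) auto
  also have "\<dots> = (LINT w|folded \<Omega>. g w)"
    unfolding folded_def using g vfrac_measurable by (subst integral_distr) (auto simp: ennreal_indicator)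
  also have "\<dots> = (LINT w|density M (\<lambda>w. ennreal (indicator U w)). g w)"
    unfolding D by (simp add: ennreal_indicator)
  also have "\<dots> = (LINT w|M. indicator U w *\<^sub>R g w)"
    using g vnbhd_in_M by (subst integral_density) auto
  finally show ?thesis .
qed

text \<open>Orthonormality and approximation errors transfer by Plancherel. Completeness of the
  transformed family also needs the range of \<open>T\<close> to be dense, which holds because every
  \<open>vgen\<close> is a multiple of the transform of one.\<close>

lemma orthonormal_basis_T_iff:
  assumes e: "\<And>i. i \<in> I \<Longrightarrow> e i \<in> L12"
  shows "orthonormal_basis_L2 M I (\<lambda>i. T (e i)) \<longleftrightarrow> orthonormal_basis_L2 M I e"
proof -
  have eL: "\<And>i. i \<in> I \<Longrightarrow> e i \<in> L2 M" and TeL: "\<And>i. i \<in> I \<Longrightarrow> T (e i) \<in> L2 M"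
    using e L12_L2 T_L2 by auto
  have norm_eq: "l2_norm M (\<lambda>x. T f x - (\<Sum>i\<in>J. c i * T (e i) x)) = l2_err M f J c e"
    if f: "f \<in> L12" and J: "finite J" "J \<subseteq> I" for f J c
  proof -
    have sV: "(\<lambda>x. \<Sum>i\<in>J. c i * e i x) \<in> L12" using J e by (intro L12_sum L12_cmult) auto
    have Tsum: "T (\<lambda>x. \<Sum>i\<in>J. c i * e i x) x = (\<Sum>i\<in>J. c i * T (e i) x)" if x: "x \<in> G" for x
      unfolding inverse_fourier_def sum_distrib_right
    proof (subst Bochner_Integration.integral_sum)
      show "integrable M (\<lambda>w. c i * e i w * vchar p x w)" if "i \<in> J" for i
        using integrable_mult_vchar[OF L12_integrable[OF L12_cmult[OF e]] x, of i "c i"] that J by auto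
    qed (simp add: mult.assoc)
    have "l2_norm M (\<lambda>x. T f x - (\<Sum>i\<in>J. c i * T (e i) x)) = l2_norm M (T (\<lambda>x. f x - lincomb J c e x))"
      by (intro l2_norm_cong) (simp add: T_diff[OF L12_integrable[OF f] L12_integrable[OF sV]] Tsum)
    also have "\<dots> = l2_err M f J c e"
      by (rule l2_norm_T[OF L12_diff[OF f sV]])
    finally show ?thesis .
  qed
  have span_iff: "T f \<in> l2_span M I (\<lambda>i. T (e i)) \<longleftrightarrow> f \<in> l2_span M I e" if f: "f \<in> L12" for f
    unfolding l2_span_def using norm_eq[OF f] L12_L2[OF f] T_L2[OF f] by (simp cong: conj_cong)
  have "L2 M \<subseteq> l2_span M I (\<lambda>i. T (e i)) \<longleftrightarrow> L2 M \<subseteq> l2_span M I e"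
  proof
    assume *: "L2 M \<subseteq> l2_span M I (\<lambda>i. T (e i))"
    show "L2 M \<subseteq> l2_span M I e"
    proof (rule L2_subset_closed_span[OF eL])
      fix A assume "A \<in> sets M" "emeasure M A < \<infinity>"
      then have "indicator A \<in> L12" by (rule L12_indicator)
      then show "indicator A \<in> l2_span M I e" using * span_iff T_L2 by blast
    qed
  next
    assume *: "L2 M \<subseteq> l2_span M I e"
    let ?S = "l2_span M I (\<lambda>i. T (e i))"
    have gen: "vgen y a l \<in> ?S" if y: "y \<in> G" and a: "a \<in> G" for y a l
    proof -
      \<comment> \<open>The factor that \<open>T_vgen\<close> produces for the frequency
        \<open>\<ominus> a\<close>, the position \<open>y\<close> and the level
        \<open>- l\<close>.\<close>
      let ?c = "of_real (real p powi l) * vchar p (vneg a) y"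
      have "vgen (vneg a) y (- l) \<in> L12" using y a by (intro L12_step step.vgen) auto
      then have "T (vgen (vneg a) y (- l)) \<in> ?S" using * span_iff L12_L2 by blast
      then have "(\<lambda>x. (1 / ?c) * T (vgen (vneg a) y (- l)) x) \<in> ?S" by (rule l2_span_cmult)
      moreover have "vgen y a l x = (1 / ?c) * T (vgen (vneg a) y (- l)) x" if "x \<in> G" for x
        using that y a p_pos by (simp add: T_vgen vneg_vneg)
      ultimately show ?thesis by (rule l2_span_cong) simp
    qed
    have st: "f \<in> ?S" if "step f" for f
      using that
    proof induction
      case (same f g)
      from same.IH show ?case by (rule l2_span_cong) (simp add: same.hyps)
    qed (auto intro: gen l2_span_add[OF TeL] l2_span_cmult)
    show "L2 M \<subseteq> ?S"
    proof (rule L2_subset_closed_span[OF TeL])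
      fix A assume A: "A \<in> sets M" "emeasure M A < \<infinity>"
      then have L12: "indicator A \<in> L12" by (rule L12_indicator)
      show "indicator A \<in> ?S"
      proof (rule l2_span_closed[OF TeL L12_L2[OF L12]])
        fix eps :: real assume "eps > 0"
        from L12E[OF L12 this] st show "\<exists>g\<in>?S. l2_dist M (indicator A) g < eps" by metis
      qed
    qed
  qed
  then show ?thesis
    unfolding orthonormal_basis_L2_iff using eL TeL plancherel[OF e e] by auto
qed

subsection \<open>Walsh functions\<close>

text \<open>Orthogonality on the finite group \<open>K\<close>, the elements of \<open>H\<close>
  supported between \<open>1 - l\<close> and 0: translating the sum by some \<open>h0\<close> with
  nontrivial value at \<open>u\<close> multiplies it by that value.\<close>

lemma walsh_sum:
  fixes l :: int
  defines "K \<equiv> H \<inter> vnbhd p (- l)"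
  shows "finite K" "K \<noteq> {}"
    "u \<in> U \<Longrightarrow> (\<Sum>h\<in>K. vchar p h u) = (if u \<in> vnbhd p l then of_nat (card K) else 0)"
proof -
  have "K \<subseteq> {f. \<forall>j. (j \<in> {- l<..0} \<longrightarrow> f j \<in> {0..<int p}) \<and> (j \<notin> {- l<..0} \<longrightarrow> f j = 0)}"
    unfolding K_def vH_def vnbhd_def vilenkin_def by auto
  then show fin: "finite K"
    by (rule finite_subset) (intro finite_set_of_finite_funs, auto)
  show "K \<noteq> {}" using zero_in_H by (auto simp: K_def mem_vnbhd)
  assume u: "u \<in> U"
  show "(\<Sum>h\<in>K. vchar p h u) = (if u \<in> vnbhd p l then of_nat (card K) else 0)"
  proof (cases "u \<in> vnbhd p l")
    case True
    have "(\<Sum>h\<in>K. vchar p h u) = (\<Sum>h\<in>K. 1)"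
      using vchar_annihilator[OF _ True] by (intro sum.cong) (auto simp: K_def)
    then show ?thesis using True by simp
  next
    case False
    then obtain j where j: "j \<le> l" "u j \<noteq> 0" using u by (auto simp: mem_vnbhd)
    then have j0: "j > 0" using u by (auto simp: mem_vnbhd not_le)
    \<comment> \<open>The digit sits at the index paired with \<open>j\<close>;
      \<open>0 < j \<le> l\<close> puts it in the range allowed for \<open>K\<close>.\<close>
    define h0 where "h0 = vsingle (1 - j) 1"
    have h0v: "h0 \<in> G" unfolding h0_def using p_gt_1 by (intro vsingle_in_vilenkin) auto
    have h0: "h0 \<in> K"
      using h0v j j0 by (auto simp: K_def vH_def mem_vnbhd h0_def vsingle_def simp del: vHD)
    have ne: "vchar p h0 u \<noteq> 1"
      using vchar_vsingle[OF p_pos vnbhdD[OF u], of "1 - j"] j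
      by (simp add: h0_def vchar_commute[of p _ u])
    have closed: "vadd p g h \<in> K" if "g \<in> K" "h \<in> K" for g h
      using that vadd_in_G[of g h] by (auto simp: K_def vH_def mem_vnbhd vadd_def simp del: vHD)
    have inj: "inj_on (vadd p h0) K"
      using inj_on_vadd[of p h0] by (rule inj_on_subset) (auto simp: K_def)
    have "vadd p h0 ` K \<subseteq> K" using closed[OF h0] by blast
    then have "vadd p h0 ` K = K" using endo_inj_surj[OF fin _ inj] by blast
    then have "(\<Sum>h\<in>K. vchar p h u) = (\<Sum>h\<in>vadd p h0 ` K. vchar p h u)" by simp
    also have "\<dots> = (\<Sum>h\<in>K. vchar p (vadd p h0 h) u)" by (simp add: sum.reindex[OF inj])
    also have "\<dots> = vchar p h0 u * (\<Sum>h\<in>K. vchar p h u)"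
      unfolding sum_distrib_left using h0v vnbhdD[OF u]
      by (intro sum.cong vchar_vadd_left[OF p_pos]) (auto simp: K_def)
    finally have "(1 - vchar p h0 u) * (\<Sum>h\<in>K. vchar p h u) = 0" by (simp add: algebra_simps)
    then show ?thesis using ne False by simp
  qed
qed

text \<open>Finite Fourier inversion on the quotient of \<open>U\<close> by
  \<open>vnbhd p l\<close>, so indicators of cosets are exact Walsh polynomials on
  \<open>U\<close>.\<close>

lemma indicator_vcoset_walsh:
  fixes l :: int
  defines "K \<equiv> H \<inter> vnbhd p (- l)"
  assumes "b \<in> U" "w \<in> U"
  shows "indicator (vcoset p b l) w = (\<Sum>h\<in>K. (1 / of_nat (card K)) * cnj (vchar p h b) * vchar p h w)"
proof -
  have v: "b \<in> G" "w \<in> G" using assms by (auto intro: vnbhdD)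
  have wb: "vminus p w b \<in> U"
    using assms vminus_in_G[OF v(2,1)] by (simp add: mem_vnbhd vminus_def)
  have "(\<Sum>h\<in>K. (1 / of_nat (card K)) * cnj (vchar p h b) * vchar p h w)
      = (1 / of_nat (card K)) * (\<Sum>h\<in>K. vchar p h (vminus p w b))"
    unfolding sum_distrib_left
    by (intro sum.cong) (use v in \<open>auto simp: K_def vchar_vminus_right[OF p_pos v(2,1)]\<close>)
  also have "\<dots> = (if vminus p w b \<in> vnbhd p l then 1 else 0)"
    using walsh_sum[where l = l] wb by (simp add: K_def)
  also have "\<dots> = indicator (vcoset p b l) w"
    using v by (simp add: indicator_def mem_vcoset_vminus[OF p_pos])
  finally show ?thesis by simp
qed

text \<open>The conjugate is what the inverse transform turns into translation by
  \<open>\<ominus> h\<close>, matching the form of the wavelet system.\<close>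

definition walsh :: "(int \<Rightarrow> int) set \<Rightarrow> (int \<Rightarrow> int) \<Rightarrow> (int \<Rightarrow> int) \<Rightarrow> complex" where
  "walsh \<Omega> h w = indicator \<Omega> w * cnj (vchar p h w)"

lemma cnj_vchar_measurable: "h \<in> G \<Longrightarrow> (\<lambda>w. cnj (vchar p h w)) \<in> borel_measurable M"
  by (rule borel_measurable_continuous_on[OF _ vchar_measurable]) (intro continuous_intros)

lemma walsh_L2:
  assumes "\<Omega> \<in> sets M" "emeasure M \<Omega> < \<infinity>" "h \<in> G"
  shows "walsh \<Omega> h \<in> L2 M"
proof (rule L2_bounded_support(1)[OF _ assms(1,2)])
  show "walsh \<Omega> h \<in> borel_measurable M"
    unfolding walsh_def using assms(1) cnj_vchar_measurable[OF assms(3)] by measurable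
qed (simp add: walsh_def norm_mult indicator_def)

lemma emeasure_U: "emeasure M U = 1"
  using emeasure_vnbhd[of 0] vnbhd_in_mu by simp

lemma vcoset_Int_U:
  assumes "a \<in> G"
  shows "vcoset p a l \<inter> U = {} \<or> (\<exists>b m. b \<in> U \<and> vcoset p a l \<inter> U = vcoset p b m)"
proof -
  have z: "vzero \<in> G" by (rule zero_in_G)
  show ?thesis
  proof (cases "l \<le> 0")
    case True
    have "vzero \<in> U" using z by (simp add: mem_vnbhd)
    then show ?thesis
      using vcoset_Int[OF p_pos assms z True] unfolding vcoset_zero[OF p_pos]
      by (metis vcoset_zero[OF p_pos])
  next
    case False
    then have "vcoset p vzero 0 \<inter> vcoset p a l = (if a \<in> vcoset p vzero 0 then vcoset p a l else {})"
      using z assms by (intro vcoset_Int[OF p_pos]) auto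
    then show ?thesis unfolding vcoset_zero[OF p_pos] Int_commute[of U] by metis
  qed
qed

abbreviation "coef \<Omega> h \<equiv> LINT w|M. indicator \<Omega> w * vchar p h w"

lemma integral_U_vchar:
  assumes h: "h \<in> H"
  shows "coef U h = (if h = vzero then 1 else 0)"
proof -
  have "h \<in> vnbhd p 0 \<longleftrightarrow> h = vzero"
    using h by (auto simp: mem_vnbhd vH_def fun_eq_iff simp del: vHD) (metis linorder_not_less)
  then show ?thesis
    using integral_vcoset_vchar[OF zero_in_G vHD[OF h], of 0]
    by (simp add: vcoset_zero[OF p_pos] vchar_commute[of p h])
qed

text \<open>The coefficients determine the folded measure: coset indicators are Walsh polynomials,
  and pulling them back along \<open>vfrac\<close> leaves the characters unchanged. So
  \<open>\<Omega>\<close> and \<open>U\<close> give equal measure to preimages of cosets, and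
  uniqueness of measures finishes.\<close>

lemma folds_if_integral_vchar:
  assumes \<Omega>: "\<Omega> \<in> sets M" "emeasure M \<Omega> < \<infinity>"
    and int: "\<And>h. h \<in> H \<Longrightarrow> coef \<Omega> h = (if h = vzero then 1 else 0)"
  shows "folds \<Omega>"
proof -
  have coset: "emeasure M (\<Omega> \<inter> vfrac -` vcoset p b l) = emeasure M (U \<inter> vcoset p b l)" if b: "b \<in> U" for b l
  proof -
    have C: "vcoset p b l \<in> sets M" using b by (intro vcoset_in_M vnbhdD)
    let ?K = "H \<inter> vnbhd p (- l)"
    let ?c = "\<lambda>h. (1 / of_nat (card ?K)) * cnj (vchar p h b)"
    have *: "complex_of_real (measure M (E \<inter> vfrac -` vcoset p b l))
        = (\<Sum>h\<in>?K. ?c h * coef E h)"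
      if E: "E \<in> sets M" "emeasure M E < \<infinity>" for E
    proof -
      have "complex_of_real (measure M (E \<inter> vfrac -` vcoset p b l)) = (LINT w|M. indicator (E \<inter> vfrac -` vcoset p b l) w)"
        using Int_vfrac_sets[OF E(1) C] by (rule integral_indicator_complex[symmetric])
      also have "\<dots> = (LINT w|M. (\<Sum>h\<in>?K. ?c h * (indicator E w * vchar p h w)))"
      proof (rule LINT_cong)
        fix w assume "w \<in> space M"
        then have w: "w \<in> G" by simp
        have "(indicator (E \<inter> vfrac -` vcoset p b l) w :: complex) = indicator E w * indicator (vcoset p b l) (vfrac w)"
          by (auto simp: indicator_def)
        also have "indicator (vcoset p b l) (vfrac w) = (\<Sum>h\<in>?K. ?c h * vchar p h (vfrac w))"
          by (rule indicator_vcoset_walsh[OF b vfrac_in_U[OF w]])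
        also have "indicator E w * (\<Sum>h\<in>?K. ?c h * vchar p h (vfrac w)) = (\<Sum>h\<in>?K. ?c h * (indicator E w * vchar p h w))"
          unfolding sum_distrib_left by (intro sum.cong) (auto simp: vchar_vfrac)
        finally show "(indicator (E \<inter> vfrac -` vcoset p b l) w :: complex) = (\<Sum>h\<in>?K. ?c h * (indicator E w * vchar p h w))" .
      qed simp
      also have "\<dots> = (\<Sum>h\<in>?K. (LINT w|M. ?c h * (indicator E w * vchar p h w)))"
        using E by (intro Bochner_Integration.integral_sum integrable_mult_right integrable_vchar_indicator) auto
      finally show ?thesis by simp
    qed
    have "complex_of_real (measure M (\<Omega> \<inter> vfrac -` vcoset p b l)) = of_real (measure M (U \<inter> vfrac -` vcoset p b l))"
      using *[OF \<Omega>] *[OF vnbhd_in_M, of 0] emeasure_U int integral_U_vchar by simp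
    then have "measure M (\<Omega> \<inter> vfrac -` vcoset p b l) = measure M (U \<inter> vfrac -` vcoset p b l)"
      by (simp only: of_real_eq_iff)
    also have "U \<inter> vfrac -` vcoset p b l = U \<inter> vcoset p b l" using vfrac_id[of _ p] by auto
    finally have m: "measure M (\<Omega> \<inter> vfrac -` vcoset p b l) = measure M (U \<inter> vcoset p b l)" .
    have fin: "emeasure M (E \<inter> X) \<noteq> \<infinity>" if "E \<in> sets M" "emeasure M E < \<infinity>" for E X
      by (intro less_imp_neq emeasure_subset_finite[OF Int_lower1] that)
    show ?thesis
      using m fin[OF \<Omega>, of "vfrac -` vcoset p b l"] fin[OF vnbhd_in_M vnbhd_finite, of 0 "vcoset p b l"]
      by (simp add: emeasure_eq_ennreal_measure)
  qed
  \<comment> \<open>Both push-forwards are taken to the Borel sets, because the cosets generate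
    these and not the completion; arbitrary measurable sets follow by changing them on null
    sets.\<close>
  define N1 where "N1 = distr (density M (indicator \<Omega>)) \<mu> vfrac"
  define N2 where "N2 = distr (density M (indicator U)) \<mu> (\<lambda>x. x)"
  have id: "(\<lambda>x. x) \<in> M \<rightarrow>\<^sub>M \<mu>" by (rule measurable_completion) simp
  have fr: "vfrac \<in> M \<rightarrow>\<^sub>M \<mu>" using measurable_compose[OF vfrac_measurable id] .
  have N1: "emeasure N1 A = emeasure M (\<Omega> \<inter> vfrac -` A)" if A: "A \<in> sets \<mu>" for A
  proof -
    have "vfrac \<in> density M (indicator \<Omega>) \<rightarrow>\<^sub>M \<mu>" using fr by simp
    from emeasure_distr[OF this A] show ?thesis
      using emeasure_restricted[OF \<Omega>(1) vfrac_vimage_sets[of A]] A Int_vfrac[OF \<Omega>(1)] by (simp add: N1_def)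
  qed
  have N2: "emeasure N2 A = emeasure M (U \<inter> A)" if A: "A \<in> sets \<mu>" for A
  proof -
    have "(\<lambda>x. x) \<in> density M (indicator U) \<rightarrow>\<^sub>M \<mu>" using id by simp
    from emeasure_distr[OF this A] show ?thesis
      using emeasure_restricted[OF vnbhd_in_M, of A] A sets.sets_into_space[OF A]
      by (simp add: N2_def Int_absorb2)
  qed
  have "N1 = N2"
  proof (rule vborel_measure_eqI[OF p_pos])
    fix a l assume a: "a \<in> G"
    have C: "vcoset p a l \<in> sets \<mu>" using a by (rule vcoset_in_mu)
    have "\<Omega> \<inter> vfrac -` vcoset p a l = \<Omega> \<inter> vfrac -` (vcoset p a l \<inter> U)"
      using sets_sub_G[OF \<Omega>(1)] vfrac_in_U by auto
    moreover have "emeasure M (\<Omega> \<inter> vfrac -` (vcoset p a l \<inter> U)) = emeasure M (U \<inter> (vcoset p a l \<inter> U))"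
      using vcoset_Int_U[OF a, of l] coset by fastforce
    moreover have "U \<inter> (vcoset p a l \<inter> U) = U \<inter> vcoset p a l" by blast
    ultimately show "emeasure N1 (vcoset p a l) = emeasure N2 (vcoset p a l)" by (simp only: N1[OF C] N2[OF C])
  next
    fix l
    show "emeasure N1 (vnbhd p l) \<noteq> \<infinity>"
      unfolding N1[OF vnbhd_in_mu] by (intro less_imp_neq emeasure_subset_finite[OF Int_lower1] \<Omega>)
  qed (simp_all add: N1_def N2_def sets_mu)
  show ?thesis
    unfolding folds_def
  proof
    fix A assume A: "A \<in> sets M"
    then obtain S Z Z' where S: "A = S \<union> Z" "Z \<subseteq> Z'" "Z' \<in> null_sets \<mu>" "S \<in> sets \<mu>"
      by (rule sets_completionE)
    have SM: "S \<in> sets M" and Z: "Z' \<in> null_sets M" using S by (auto intro: null_sets_completionI)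
    have "AE x in M. x \<in> \<Omega> \<inter> vfrac -` A \<longleftrightarrow> x \<in> \<Omega> \<inter> vfrac -` S"
      using AE_not_in[OF vfrac_vimage_null[OF Z]]
      by eventually_elim (use S sets_sub_G[OF \<Omega>(1)] in blast)
    then have "emeasure M (\<Omega> \<inter> vfrac -` A) = emeasure M (\<Omega> \<inter> vfrac -` S)"
      by (intro emeasure_eq_AE Int_vfrac_sets \<Omega> A SM)
    moreover have "AE x in M. x \<in> U \<inter> A \<longleftrightarrow> x \<in> U \<inter> S"
      using AE_not_in[OF Z] by eventually_elim (use S in blast)
    then have "emeasure M (U \<inter> A) = emeasure M (U \<inter> S)"
      by (intro emeasure_eq_AE sets.Int vnbhd_in_M A SM)
    ultimately show "emeasure M (\<Omega> \<inter> vfrac -` A) = emeasure M (U \<inter> A)"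
      using N1[OF S(4)] N2[OF S(4)] \<open>N1 = N2\<close> by simp
  qed
qed

text \<open>Completeness of the Walsh functions on \<open>U\<close>: exact for cosets, then carried
  to all measurable sets by the induction on sets of finite measure.\<close>

lemma indicator_in_walsh_span_U:
  assumes "E \<in> sets M"
  shows "indicator (E \<inter> U) \<in> l2_span M H (walsh U)"
proof -
  let ?S = "l2_span M H (walsh U)"
  have finU: "emeasure M U < \<infinity>" by (rule vnbhd_finite)
  have e: "\<And>h. h \<in> H \<Longrightarrow> walsh U h \<in> L2 M" using walsh_L2[OF vnbhd_in_M finU] by simp
  have z: "(\<lambda>w. 0) \<in> ?S" using l2_span_sum[of H "walsh U" M "{}"] e by simp
  have finI: "emeasure M (A \<inter> U) < \<infinity>" for A
    by (rule emeasure_subset_finite[OF _ vnbhd_in_M finU]) auto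
  have main: "indicator (A \<inter> U) \<in> ?S" if "A \<in> sets M" "emeasure M A < \<infinity>" for A
    using that
  proof (induction rule: finite_measure_set_induct)
    case (vcoset a l)
    have gen: "indicator (vcoset p b m \<inter> U) \<in> ?S" if b: "b \<in> U" for b m
    proof -
      let ?K = "H \<inter> vnbhd p (- m)"
      \<comment> \<open>The inversion formula is conjugated, since \<open>walsh\<close> contains
        conjugate characters and the indicator is real.\<close>
      have "(\<lambda>w. \<Sum>h\<in>?K. cnj ((1 / of_nat (card ?K)) * cnj (vchar p h b)) * walsh U h w) \<in> ?S"
        using e walsh_sum(1) by (intro l2_span_sum) auto
      moreover have "indicator (vcoset p b m \<inter> U) w
          = (\<Sum>h\<in>?K. cnj ((1 / of_nat (card ?K)) * cnj (vchar p h b)) * walsh U h w)" for w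
      proof (cases "w \<in> U")
        case True
        have "(indicator (vcoset p b m \<inter> U) w :: complex) = cnj (indicator (vcoset p b m) w)"
          using True by (simp add: indicator_def)
        also have "\<dots> = (\<Sum>h\<in>?K. cnj ((1 / of_nat (card ?K)) * cnj (vchar p h b)) * cnj (vchar p h w))"
          unfolding indicator_vcoset_walsh[OF b True] cnj_sum by simp
        finally show ?thesis using True by (simp add: walsh_def)
      qed (simp add: walsh_def)
      ultimately show ?thesis by (rule l2_span_cong)
    qed
    from vcoset_Int_U[OF vcoset, of l] show ?case
    proof
      assume "vcoset p a l \<inter> U = {}"
      then show ?thesis using z by simp
    next
      assume "\<exists>b m. b \<in> U \<and> vcoset p a l \<inter> U = vcoset p b m"
      then obtain b m where "b \<in> U" "vcoset p a l \<inter> U = vcoset p b m \<inter> U" by (metis inf.right_idem)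
      then show ?thesis using gen by metis
    qed
  next
    case empty
    then show ?case using z by simp
  next
    case (Diff A B)
    have "indicator ((B - A) \<inter> U) w = indicator (B \<inter> U) w + (-1) * (indicator (A \<inter> U) w :: complex)" for w
      using Diff(3) by (auto simp: indicator_def)
    from l2_span_cong[OF l2_span_add[OF e Diff(6) l2_span_cmult[OF Diff(5), of "-1"]] this]
    show ?case .
  next
    case (Un A B)
    have "indicator ((A \<union> B) \<inter> U) w = indicator (A \<inter> U) w + (indicator (B \<inter> U) w :: complex)" for w
      using Un(3) by (auto simp: indicator_def)
    from l2_span_cong[OF l2_span_add[OF e Un(5,6)] this] show ?case .
  next
    case (incseq A)
    have A: "A n \<in> sets M" for n using incseq(1) by auto
    show ?case
    proof (rule indicator_incseq_in_closed_span[OF e])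
      show "incseq (\<lambda>n. A n \<inter> U)" using incseq(2) by (auto simp: incseq_def)
      show "(\<Union>n. A n) \<inter> U \<in> sets M" using A vnbhd_in_M by auto
      show "emeasure M ((\<Union>n. A n) \<inter> U) < \<infinity>" by (rule finI)
    qed (use A vnbhd_in_M incseq(4) in auto)
  next
    case (null A B)
    show ?case
    proof (rule indicator_incseq_in_closed_span[OF e, where A = "\<lambda>_. A \<inter> U"])
      show "emeasure M (B \<inter> U) < \<infinity>" by (rule finI)
      show "AE x in M. x \<in> B \<inter> U \<longleftrightarrow> x \<in> (\<Union>n::nat. A \<inter> U)"
        using AE_not_in[OF null(4)] by eventually_elim auto
    qed (use null vnbhd_in_M in auto)
  qed
  \<comment> \<open>\<open>E\<close> may have infinite measure, so the induction is applied to its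
    intersection with \<open>U\<close>.\<close>
  have "indicator ((E \<inter> U) \<inter> U) \<in> ?S"
  proof (rule main)
    show "E \<inter> U \<in> sets M" using assms vnbhd_in_M by auto
  qed (rule finI)
  then show ?thesis by (simp only: Int_assoc Int_absorb)
qed

text \<open>Almost everywhere on \<open>\<Omega>\<close>, the indicator of \<open>E\<close> is the
  pullback along \<open>vfrac\<close> of the indicator of its image. Pulling back preserves
  integrals by \<open>folds_integral\<close>, so a Walsh approximation on \<open>U\<close> has the
  same error on \<open>\<Omega>\<close>.\<close>

lemma indicator_in_walsh_span:
  assumes \<Omega>: "\<Omega> \<in> sets M" "emeasure M \<Omega> < \<infinity>" and f: "folds \<Omega>" and E: "E \<in> sets M" "E \<subseteq> \<Omega>"
  shows "indicator E \<in> l2_span M H (walsh \<Omega>)"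
proof (rule l2_spanI)
  show "indicator E \<in> L2 M" using E(1) emeasure_subset_finite[OF E(2) \<Omega>] by (rule L2_indicator)
  fix eps :: real assume eps: "eps > 0"
  let ?E = "vfrac ` E"
  note fE = folds_vfrac_image[OF \<Omega>(1) f E]
  obtain J c where J: "finite J" "J \<subseteq> H"
      and le: "l2_norm M (\<lambda>x. indicator (?E \<inter> U) x - lincomb J c (walsh U) x) < eps"
    using indicator_in_walsh_span_U[OF fE(1)] eps by (rule l2_spanE)
  let ?g = "\<lambda>w. indicator ?E w - (\<Sum>h\<in>J. c h * cnj (vchar p h w))"
  have meas: "?g \<in> borel_measurable M"
  proof (intro borel_measurable_diff borel_measurable_sum borel_measurable_times borel_measurable_const)
    show "(indicator ?E :: _ \<Rightarrow> complex) \<in> borel_measurable M" using fE(1) by (rule borel_measurable_indicator)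
    show "(\<lambda>w. cnj (vchar p h w)) \<in> borel_measurable M" if "h \<in> J" for h
      using that J by (intro cnj_vchar_measurable) auto
  qed
  have wm: "walsh \<Omega> h \<in> borel_measurable M" if "h \<in> J" for h
    using walsh_L2[OF \<Omega>, of h] that J by (intro L2_measurable) auto
  have "(LINT w|M. (norm (indicator E w - lincomb J c (walsh \<Omega>) w))\<^sup>2)
      = (LINT w|M. indicator \<Omega> w *\<^sub>R (norm (?g (vfrac w)))\<^sup>2)"
  proof (rule integral_cong_AE)
    show "AE w in M. (norm (indicator E w - lincomb J c (walsh \<Omega>) w))\<^sup>2 = indicator \<Omega> w *\<^sub>R (norm (?g (vfrac w)))\<^sup>2"
      using fE(2)
    proof eventually_elim
      case (elim w)
      have "lincomb J c (walsh \<Omega>) w = indicator \<Omega> w * (\<Sum>h\<in>J. c h * cnj (vchar p h (vfrac w)))"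
        unfolding sum_distrib_left using J(2) by (intro sum.cong) (auto simp: walsh_def vchar_vfrac)
      then show ?case using elim by (auto simp: indicator_def)
    qed
    have "(indicator E :: _ \<Rightarrow> complex) \<in> borel_measurable M"
      using E(1) by (rule borel_measurable_indicator)
    then have "(\<lambda>w. indicator E w - lincomb J c (walsh \<Omega>) w) \<in> borel_measurable M"
      by (intro borel_measurable_diff borel_measurable_sum borel_measurable_times borel_measurable_const wm)
    then show "(\<lambda>w. (norm (indicator E w - lincomb J c (walsh \<Omega>) w))\<^sup>2) \<in> borel_measurable M"
      by measurable
    show "(\<lambda>w. indicator \<Omega> w *\<^sub>R (norm (?g (vfrac w)))\<^sup>2) \<in> borel_measurable M"
      using measurable_compose[OF vfrac_measurable meas] \<Omega>(1) by measurable
  qed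
  also have "\<dots> = (LINT w|M. indicator U w *\<^sub>R (norm (?g w))\<^sup>2)"
  proof (rule folds_integral[OF \<Omega>(1) f])
    show "(\<lambda>w. (norm (?g w))\<^sup>2) \<in> borel_measurable M"
      by (rule measurable_compose[OF meas]) measurable
  qed
  also have "\<dots> = (LINT w|M. (norm (indicator (?E \<inter> U) w - lincomb J c (walsh U) w))\<^sup>2)"
  proof (rule LINT_cong)
    fix w
    have "lincomb J c (walsh U) w = indicator U w * (\<Sum>h\<in>J. c h * cnj (vchar p h w))"
      unfolding sum_distrib_left by (intro sum.cong) (auto simp: walsh_def)
    then show "indicator U w *\<^sub>R (norm (?g w))\<^sup>2 = (norm (indicator (?E \<inter> U) w - lincomb J c (walsh U) w))\<^sup>2"
      by (auto simp: indicator_def)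
  qed simp
  finally have "l2_err M (indicator E) J c (walsh \<Omega>) < eps"
    using le by (simp only: l2_norm_def)
  then show "\<exists>J c. finite J \<and> J \<subseteq> H \<and> l2_err M (indicator E) J c (walsh \<Omega>) < eps"
    using J by blast
qed

subsection \<open>Wavelet systems\<close>

abbreviation "vdc j \<equiv> real p powr (- real_of_int j / 2)"

text \<open>The unitary dilation on the dual side: \<open>vshift (- j)\<close> multiplies integrals
  by \<open>p\<close> to the power \<open>j\<close>, which the squared factor undoes.\<close>

definition vdil :: "int \<Rightarrow> ((int \<Rightarrow> int) \<Rightarrow> complex) \<Rightarrow> (int \<Rightarrow> int) \<Rightarrow> complex" where
  "vdil j f w = of_real (vdc j) * f (vshift (- j) w)"

lemma powr_half_square: "(real p powr (real_of_int j / 2))\<^sup>2 = real p powi j"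
proof -
  have "(real p powr (real_of_int j / 2))\<^sup>2 = real p powr (real_of_int j / 2 + real_of_int j / 2)"
    unfolding powr_add power2_eq_square ..
  then show ?thesis using p_pos by (simp add: powr_real_of_int')
qed

lemma vdil_measurable: "f \<in> borel_measurable M \<Longrightarrow> vdil j f \<in> borel_measurable M"
  unfolding vdil_def
  by (intro borel_measurable_times borel_measurable_const measurable_compose[OF measurable_vshift_M])

lemma vdil_L2: assumes "f \<in> L2 M" shows "vdil j f \<in> L2 M"
proof -
  have "integrable M (\<lambda>w. (vdc j)\<^sup>2 * (norm (f (vshift (- j) w)))\<^sup>2)"
    using integrable_vshift[OF L2_integrable_square[OF assms], of "- j"] by simp
  then have "integrable M (\<lambda>w. (norm (vdil j f w))\<^sup>2)"
    by (simp add: vdil_def norm_mult power_mult_distrib)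
  then show ?thesis using vdil_measurable[OF L2_measurable[OF assms]] by (simp add: L2_def)
qed

lemma vdil_inner:
  assumes f: "f \<in> borel_measurable M" and g: "g \<in> borel_measurable M"
  shows "l2_inner M (vdil j f) (vdil j g) = l2_inner M f g"
proof -
  let ?c = "vdc j"
  have cg: "(\<lambda>w. cnj (g w)) \<in> borel_measurable M"
    by (rule borel_measurable_continuous_on[OF _ g]) (intro continuous_intros)
  have m: "(\<lambda>w. f w * cnj (g w)) \<in> borel_measurable M"
    using f cg by (rule borel_measurable_times)
  have "l2_inner M (vdil j f) (vdil j g)
      = (LINT w|M. of_real (?c\<^sup>2) * (f (vshift (- j) w) * cnj (g (vshift (- j) w))))"
    unfolding l2_inner_def vdil_def by (simp add: power2_eq_square mult_ac)
  also have "\<dots> = of_real (?c\<^sup>2) * (LINT w|M. f (vshift (- j) w) * cnj (g (vshift (- j) w)))"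
    by simp
  also have "(LINT w|M. f (vshift (- j) w) * cnj (g (vshift (- j) w))) = real p powi j *\<^sub>R l2_inner M f g"
    using integral_vshift[OF m, of "- j"] by (simp add: l2_inner_def)
  also have "?c\<^sup>2 = real p powi (- j)"
    using powr_half_square[of "- j"] by simp
  also have "of_real (real p powi (- j)) * (real p powi j *\<^sub>R l2_inner M f g) = l2_inner M f g"
    using p_pos by (simp add: scaleR_conv_of_real power_int_minus)
  finally show ?thesis .
qed

lemma vdil_norm: "f \<in> L2 M \<Longrightarrow> l2_norm M (vdil j f) = l2_norm M f"
  by (intro l2_norm_eqI vdil_inner L2_measurable)

lemma vshift_finite:
  "\<Omega> \<in> sets M \<Longrightarrow> emeasure M \<Omega> < \<infinity> \<Longrightarrow> emeasure M (vshift j ` \<Omega>) < \<infinity>"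
  by (simp only: emeasure_vshift_image) (simp add: ennreal_mult_less_top)

text \<open>The shift crosses the pairing, so a dilated Walsh function is a character times the
  indicator of a dilate of \<open>\<Omega>\<close>.\<close>

lemma vdil_walsh_step_closure:
  assumes \<Omega>: "\<Omega> \<in> sets M" "emeasure M \<Omega> < \<infinity>" and h: "h \<in> H"
  shows "vdil j (walsh \<Omega> h) \<in> L12"
proof -
  let ?z = "vneg (vshift (- j) h)"
  have hv: "h \<in> G" using h by simp
  then have z: "?z \<in> G" by simp
  have "indicator (vshift j ` \<Omega>) \<in> L12"
    by (intro L12_indicator sets_vshift_image vshift_finite \<Omega>)
  then have "(\<lambda>w. of_real (vdc j) * (vchar p ?z w * indicator (vshift j ` \<Omega>) w)) \<in> L12"
    using z by (intro L12_cmult L12_mult_vchar)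
  then show ?thesis
  proof (rule L12_cong)
    fix w assume w: "w \<in> G"
    have "vchar p ?z w = cnj (vchar p h (vshift (- j) w))"
      using w hv by (simp add: vchar_vneg vchar_vshift)
    moreover have "(indicator (vshift j ` \<Omega>) w :: complex) = indicator \<Omega> (vshift (- j) w)"
      by (simp add: indicator_def mem_vshift_image)
    ultimately show "vdil j (walsh \<Omega> h) w
        = of_real (vdc j) * (vchar p ?z w * indicator (vshift j ` \<Omega>) w)"
      by (simp add: vdil_def walsh_def)
  qed
qed

text \<open>Substituting in the integral moves the dilation onto \<open>x\<close> and contributes
  \<open>p\<close> to the power \<open>j\<close>; with the factor of exponent \<open>- j / 2\<close>
  this leaves the normalization \<open>j / 2\<close> of the wavelet system.\<close>

lemma T_vdil_walsh:
  assumes \<Omega>: "\<Omega> \<in> sets M" and h: "h \<in> H" and x: "x \<in> G"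
  shows "T (vdil j (walsh \<Omega> h)) x
    = of_real (real p powr (real_of_int j / 2)) * T (indicator \<Omega>) (vminus p (vshift j x) h)"
proof -
  let ?c = "vdc j"
  have hv: "h \<in> G" using h by simp
  have y: "vshift j x \<in> G" using x by simp
  define F where "F w = indicator \<Omega> w * vchar p (vminus p (vshift j x) h) w" for w
  have F: "F \<in> borel_measurable M"
    unfolding F_def using \<Omega> vchar_measurable[OF vminus_in_G[OF y hv]] by measurable
  have "T (vdil j (walsh \<Omega> h)) x = (LINT w|M. of_real ?c * F (vshift (- j) w))"
    unfolding inverse_fourier_def
  proof (rule LINT_cong)
    fix w assume "w \<in> space M"
    then have w: "vshift (- j) w \<in> G" by simp
    have "vchar p x w = vchar p (vshift j x) (vshift (- j) w)"
      using vchar_vshift[of p "vshift j x" "- j" w] by simp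
    then show "vdil j (walsh \<Omega> h) w * vchar p x w = of_real ?c * F (vshift (- j) w)"
      using vchar_vminus_left[OF p_pos y hv w] by (simp add: vdil_def walsh_def F_def mult_ac)
  qed simp
  also have "\<dots> = of_real ?c * (LINT w|M. F (vshift (- j) w))" by simp
  also have "\<dots> = of_real ?c * (real p powi j *\<^sub>R (LINT w|M. F w))"
    using integral_vshift[OF F, of "- j"] by simp
  also have "\<dots> = of_real (?c * real p powi j) * (LINT w|M. F w)"
    by (simp add: scaleR_conv_of_real)
  also have "?c * real p powi j = real p powr (real_of_int j / 2)"
    using p_pos powr_add[of "real p" "- real_of_int j / 2" "real_of_int j"] by (simp add: powr_real_of_int')
  finally show ?thesis by (simp add: F_def inverse_fourier_def)
qed

abbreviation "wsys \<Omega> \<equiv> (\<lambda>(j, h). vdil j (walsh \<Omega> h))"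
abbreviation "wsys_basis \<Omega> \<equiv> orthonormal_basis_L2 M (UNIV \<times> H) (wsys \<Omega>)"

lemma wavelet_iff_wsys:
  assumes \<Omega>: "\<Omega> \<in> sets M" "emeasure M \<Omega> < \<infinity>"
  shows "wavelet p M (T (indicator \<Omega>)) \<longleftrightarrow> wsys_basis \<Omega>"
proof -
  have "wsys_basis \<Omega>
      \<longleftrightarrow> orthonormal_basis_L2 M (UNIV \<times> H) (\<lambda>i. T (wsys \<Omega> i))"
    using vdil_walsh_step_closure[OF \<Omega>] by (intro orthonormal_basis_T_iff[symmetric]) auto
  also have "\<dots> \<longleftrightarrow> orthonormal_basis_L2 M (UNIV \<times> H)
       (\<lambda>(j, h) x. of_real (real p powr (real_of_int j / 2)) * T (indicator \<Omega>) (vminus p (vshift j x) h))"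
    using T_vdil_walsh[OF \<Omega>(1)] by (intro orthonormal_basis_L2_cong) (auto simp: split_beta)
  finally show ?thesis using T_L2[OF L12_indicator[OF \<Omega>]] by (simp add: wavelet_def)
qed

lemma wsys_inner:
  assumes \<Omega>: "\<Omega> \<in> sets M" "emeasure M \<Omega> < \<infinity>" and gh: "g \<in> H" "h \<in> H"
  shows "l2_inner M (vdil j (walsh \<Omega> g)) (vdil j (walsh \<Omega> h)) = coef \<Omega> (vminus p h g)"
proof -
  have "l2_inner M (vdil j (walsh \<Omega> g)) (vdil j (walsh \<Omega> h)) = l2_inner M (walsh \<Omega> g) (walsh \<Omega> h)"
    using \<Omega> gh by (intro vdil_inner L2_measurable walsh_L2) auto
  also have "\<dots> = coef \<Omega> (vminus p h g)"
    unfolding l2_inner_def using gh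
    by (intro LINT_cong) (auto simp: walsh_def indicator_def vchar_vminus_left[OF p_pos])
  finally show ?thesis .
qed

lemma wsys_support: "w \<notin> vshift j ` \<Omega> \<Longrightarrow> vdil j (walsh \<Omega> h) w = 0"
  by (simp add: vdil_def walsh_def mem_vshift_image)

text \<open>The function with \<open>h = \<theta>\<close> is a nonzero multiple of an indicator, so its inner products
  detect overlaps of the dilates.\<close>

lemma wsys_zero_inner:
  assumes \<Omega>: "\<Omega> \<in> sets M"
  shows "\<exists>c. c \<noteq> 0 \<and> l2_inner M (vdil i (walsh \<Omega> vzero)) (vdil j (walsh \<Omega> vzero))
    = c * of_real (measure M (vshift i ` \<Omega> \<inter> vshift j ` \<Omega>))"
proof -
  let ?c = "complex_of_real (vdc i * vdc j)"
  have ind: "indicator \<Omega> (vshift (- k) w) = (indicator (vshift k ` \<Omega>) w :: complex)" for k w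
    by (simp add: indicator_def mem_vshift_image)
  have "l2_inner M (vdil i (walsh \<Omega> vzero)) (vdil j (walsh \<Omega> vzero))
      = (LINT w|M. ?c * indicator (vshift i ` \<Omega> \<inter> vshift j ` \<Omega>) w)"
    unfolding l2_inner_def vdil_def walsh_def ind
    by (intro LINT_cong) (auto simp: indicator_def)
  also have "\<dots> = ?c * of_real (measure M (vshift i ` \<Omega> \<inter> vshift j ` \<Omega>))"
    using sets_vshift_image[OF \<Omega>] by (simp add: integral_indicator_complex sets.Int)
  finally have "l2_inner M (vdil i (walsh \<Omega> vzero)) (vdil j (walsh \<Omega> vzero))
      = ?c * of_real (measure M (vshift i ` \<Omega> \<inter> vshift j ` \<Omega>))" .
  moreover have "?c \<noteq> 0" using p_pos by simp
  ultimately show ?thesis by blast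
qed

lemma basis_imp_tiling:
  assumes \<Omega>: "\<Omega> \<in> sets M" "emeasure M \<Omega> < \<infinity>"
    and basis: "wsys_basis \<Omega>"
  shows "partition_mod_null M UNIV (\<lambda>n. vshift n ` \<Omega>) (G)"
proof -
  have S: "vshift n ` \<Omega> \<in> sets M" for n using sets_vshift_image[OF \<Omega>(1)] .
  have orth: "l2_inner M (wsys \<Omega> a) (wsys \<Omega> b) = (if a = b then 1 else 0)"
    if "a \<in> UNIV \<times> H" "b \<in> UNIV \<times> H" for a b
    using basis that unfolding orthonormal_basis_L2_iff by blast
  have span: "L2 M \<subseteq> l2_span M (UNIV \<times> H) (wsys \<Omega>)"
    and eL: "\<And>i. i \<in> UNIV \<times> H \<Longrightarrow> wsys \<Omega> i \<in> L2 M"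
    using basis by (auto simp: orthonormal_basis_L2_iff)
  have z: "vzero \<in> H" by (rule zero_in_H)
  have sub: "(\<Union>n. vshift n ` \<Omega>) \<subseteq> G" using sets_sub_G[OF S] by blast
  let ?Z = "G - (\<Union>n. vshift n ` \<Omega>)"
  have G: "G \<in> sets M" using sets.top[of M] by simp
  have Z: "?Z \<in> sets M" using S G by (intro sets.Diff sets.countable_UN') auto
  \<comment> \<open>The uncovered set may a priori have infinite measure, so it is cut into parts
    whose indicators are square-integrable. Each is orthogonal to the whole system and therefore
    null.\<close>
  have Zk: "?Z \<inter> vnbhd p (- int k) \<in> null_sets M" for k
  proof -
    let ?E = "?Z \<inter> vnbhd p (- int k)"
    have E: "?E \<in> sets M" using Z vnbhd_in_M by (rule sets.Int)
    have fin: "emeasure M ?E < \<infinity>"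
      by (rule emeasure_subset_finite[OF _ vnbhd_in_M vnbhd_finite]) auto
    have "indicator ?E \<in> l2_span M (UNIV \<times> H) (wsys \<Omega>)"
      using span L2_indicator[OF E fin] by blast
    moreover have "l2_inner M (indicator ?E) (wsys \<Omega> i) = 0" for i
    proof -
      obtain j h where i: "i = (j, h)" by force
      have "indicator ?E w * cnj (vdil j (walsh \<Omega> h) w) = 0" for w
        using wsys_support[of w j \<Omega> h] by (auto simp: indicator_def)
      then show ?thesis unfolding l2_inner_def i by (simp only: prod.case integral_zero)
    qed
    ultimately have "l2_norm M (indicator ?E) = 0" by (intro l2_norm_eq_0_orthogonal[OF eL])
    then have "measure M ?E = 0"
      using l2_norm_indicator_diff(1)[OF E sets.empty_sets] by simp
    then have "emeasure M ?E = 0"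
      using emeasure_eq_ennreal_measure[OF less_imp_neq[OF fin[unfolded infinity_ennreal_def]]] by simp
    then show ?thesis using E by (rule null_setsI)
  qed
  have "?Z = ?Z \<inter> (\<Union>k::nat. vnbhd p (- int k))" unfolding Un_vnbhd by blast
  then have "?Z = (\<Union>k::nat. ?Z \<inter> vnbhd p (- int k))" unfolding Int_UN_distrib .
  moreover have "(\<Union>k::nat. ?Z \<inter> vnbhd p (- int k)) \<in> null_sets M" using Zk by (intro null_sets_UN) auto
  ultimately have Znull: "?Z \<in> null_sets M" by simp
  show ?thesis
    unfolding partition_mod_null_def
  proof (intro conjI ballI impI)
    fix i j :: int assume ij: "i \<noteq> j"
    obtain c where c: "c \<noteq> 0" "l2_inner M (vdil i (walsh \<Omega> vzero)) (vdil j (walsh \<Omega> vzero))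
      = c * of_real (measure M (vshift i ` \<Omega> \<inter> vshift j ` \<Omega>))"
      using wsys_zero_inner[OF \<Omega>(1)] by blast
    have "l2_inner M (vdil i (walsh \<Omega> vzero)) (vdil j (walsh \<Omega> vzero)) = 0"
      using orth[of "(i, vzero)" "(j, vzero)"] z ij by simp
    then have m0: "measure M (vshift i ` \<Omega> \<inter> vshift j ` \<Omega>) = 0" using c by simp
    have "emeasure M (vshift i ` \<Omega> \<inter> vshift j ` \<Omega>) \<noteq> \<infinity>"
      by (intro less_imp_neq emeasure_subset_finite[OF Int_lower1 S vshift_finite] \<Omega>)
    from emeasure_eq_ennreal_measure[OF this[unfolded infinity_ennreal_def]]
    have "emeasure M (vshift i ` \<Omega> \<inter> vshift j ` \<Omega>) = 0" unfolding m0 by simp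
    then show "vshift i ` \<Omega> \<inter> vshift j ` \<Omega> \<in> null_sets M" using S by (intro null_setsI) auto
  next
    have "(\<Union>n. vshift n ` \<Omega>) - G = {}" using sub by blast
    then show "(\<Union>n. vshift n ` \<Omega>) - G \<in> null_sets M" by (simp only: null_sets.empty_sets)
  qed (use S Znull in auto)
qed

lemma basis_imp_folds:
  assumes \<Omega>: "\<Omega> \<in> sets M" "emeasure M \<Omega> < \<infinity>"
    and basis: "wsys_basis \<Omega>"
  shows "folds \<Omega>"
proof (rule folds_if_integral_vchar[OF \<Omega>])
  fix h assume h: "h \<in> H"
  have z: "vzero \<in> H" by (rule zero_in_H)
  \<comment> \<open>Scale 0 against the index \<theta> already exhibits every coefficient.\<close>
  have "l2_inner M (wsys \<Omega> (0, vzero)) (wsys \<Omega> (0, h)) = (if (0::int, vzero) = (0, h) then 1 else 0)"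
    using basis z h unfolding orthonormal_basis_L2_iff by blast
  then show "coef \<Omega> h = (if h = vzero then 1 else 0)"
    using wsys_inner[OF \<Omega> z h, of 0] h by (auto simp: vminus_zero)
qed

text \<open>Every point folds into \<open>U\<close>, so testing the folding property on
  \<open>U\<close> itself fixes the total mass. This provides finiteness when only (a) and (b) are
  given.\<close>

lemma folds_emeasure: "\<Omega> \<in> sets M \<Longrightarrow> folds \<Omega> \<Longrightarrow> emeasure M \<Omega> = 1"
proof -
  assume \<Omega>: "\<Omega> \<in> sets M" and f: "folds \<Omega>"
  have "emeasure M (\<Omega> \<inter> vfrac -` U) = emeasure M (U \<inter> U)"
    using f vnbhd_in_M unfolding folds_def by blast
  moreover have "\<Omega> \<inter> vfrac -` U = \<Omega>"
    using sets_sub_G[OF \<Omega>] vfrac_in_U by blast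
  ultimately show ?thesis using emeasure_U by (simp only: Int_absorb)
qed

lemma folds_integral_vchar:
  assumes \<Omega>: "\<Omega> \<in> sets M" and f: "folds \<Omega>" and h: "h \<in> H"
  shows "coef \<Omega> h = (if h = vzero then 1 else 0)"
proof -
  have "coef \<Omega> h = (LINT w|M. indicator \<Omega> w *\<^sub>R vchar p h (vfrac w))"
    by (intro LINT_cong) (auto simp: indicator_def vchar_vfrac[OF h])
  also have "\<dots> = (LINT w|M. indicator U w *\<^sub>R vchar p h w)"
    using h by (intro folds_integral[OF \<Omega> f] vchar_measurable) auto
  also have "\<dots> = coef U h"
    by (intro LINT_cong) (auto simp: indicator_def)
  also have "\<dots> = (if h = vzero then 1 else 0)" by (rule integral_U_vchar[OF h])
  finally show ?thesis .
qed

lemma tiling_folds_imp_basis: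
  assumes \<Omega>: "\<Omega> \<in> sets M" and f: "folds \<Omega>"
    and tiling: "partition_mod_null M UNIV (\<lambda>n. vshift n ` \<Omega>) (G)"
  shows "wsys_basis \<Omega>"
proof -
  have fin: "emeasure M \<Omega> < \<infinity>" using folds_emeasure[OF \<Omega> f] by simp
  have S: "vshift n ` \<Omega> \<in> sets M" for n using sets_vshift_image[OF \<Omega>] .
  have wL: "walsh \<Omega> h \<in> L2 M" if "h \<in> H" for h using walsh_L2[OF \<Omega> fin] that by simp
  have eL: "wsys \<Omega> i \<in> L2 M" if "i \<in> UNIV \<times> H" for i
    using that vdil_L2[OF wL] by auto
  have orth: "l2_inner M (wsys \<Omega> a) (wsys \<Omega> b) = (if a = b then 1 else 0)"
    if ab: "a \<in> UNIV \<times> H" "b \<in> UNIV \<times> H" for a b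
  proof -
    obtain i g j h where eq: "a = (i, g)" "b = (j, h)" "g \<in> H" "h \<in> H" using ab by auto
    show ?thesis
    proof (cases "i = j")
      case True
      have "vminus p h g = vzero \<longleftrightarrow> g = h"
        using vminus_eq_0_iff[of h p g] eq(3,4) by (auto simp: fun_eq_iff)
      then show ?thesis
        using True eq wsys_inner[OF \<Omega> fin eq(3,4), of j]
          folds_integral_vchar[OF \<Omega> f vminus_in_vH[OF p_pos eq(4,3)]] by simp
    next
      case False
      then have "vshift i ` \<Omega> \<inter> vshift j ` \<Omega> \<in> null_sets M"
        using tiling by (simp add: partition_mod_null_def)
      then have "AE w in M. w \<notin> vshift i ` \<Omega> \<inter> vshift j ` \<Omega>" by (rule AE_not_in)
      then have "AE w in M. vdil i (walsh \<Omega> g) w * cnj (vdil j (walsh \<Omega> h) w) = 0"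
      proof eventually_elim
        case (elim w)
        then have "vdil i (walsh \<Omega> g) w = 0 \<or> vdil j (walsh \<Omega> h) w = 0"
          using wsys_support[of w i \<Omega> g] wsys_support[of w j \<Omega> h] by blast
        then show ?case by auto
      qed
      then have "l2_inner M (vdil i (walsh \<Omega> g)) (vdil j (walsh \<Omega> h)) = 0"
        unfolding l2_inner_def by (rule integral_eq_zero_AE)
      then show ?thesis using False eq by simp
    qed
  qed
  let ?S = "l2_span M (UNIV \<times> H) (wsys \<Omega>)"
  \<comment> \<open>\<open>X\<close> is pulled back into \<open>\<Omega>\<close>, approximated there
    by Walsh functions, and dilated again; unitarity of the dilation keeps the error.\<close>
  have piece: "indicator X \<in> ?S" if X: "X \<in> sets M" "X \<subseteq> vshift j ` \<Omega>" for X j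
  proof -
    let ?E = "vshift (- j) ` X"
    let ?c = "complex_of_real (vdc j)"
    have E: "?E \<in> sets M" using X(1) by (rule sets_vshift_image)
    have "x \<in> \<Omega>" if "x \<in> ?E" for x
      using that X(2) by (auto simp: mem_vshift_image subset_iff)
    then have E_sub: "?E \<subseteq> \<Omega>" by blast
    have span: "indicator ?E \<in> l2_span M H (walsh \<Omega>)"
      by (rule indicator_in_walsh_span[OF \<Omega> fin f E E_sub])
    have EL: "indicator ?E \<in> L2 M" using span by (rule l2_span_L2)
    have "vdil j (indicator ?E) \<in> ?S"
    proof (rule l2_spanI[OF vdil_L2[OF EL]])
      fix eps :: real assume "eps > 0"
      with span obtain J c where J: "finite J" "J \<subseteq> H"
          "l2_err M (indicator ?E) J c (walsh \<Omega>) < eps"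
        by (rule l2_spanE)
      have "(\<lambda>x. indicator ?E x - lincomb J c (walsh \<Omega>) x) \<in> L2 M"
        using EL J(2) wL by (intro L2_diff L2_sum L2_cmult) auto
      from vdil_norm[OF this, of j] J(3)
      have "l2_norm M (vdil j (\<lambda>x. indicator ?E x - lincomb J c (walsh \<Omega>) x)) < eps" by linarith
      moreover have "vdil j (\<lambda>x. indicator ?E x - lincomb J c (walsh \<Omega>) x)
          = (\<lambda>x. vdil j (indicator ?E) x - (\<Sum>i\<in>Pair j ` J. c (snd i) * wsys \<Omega> i x))"
      proof
        fix x
        have "(\<Sum>i\<in>Pair j ` J. c (snd i) * wsys \<Omega> i x) = (\<Sum>h\<in>J. c h * vdil j (walsh \<Omega> h) x)"
          by (subst sum.reindex) (auto simp: inj_on_def)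
        then show "vdil j (\<lambda>x. indicator ?E x - lincomb J c (walsh \<Omega>) x) x
            = vdil j (indicator ?E) x - (\<Sum>i\<in>Pair j ` J. c (snd i) * wsys \<Omega> i x)"
          by (simp add: vdil_def right_diff_distrib sum_distrib_left mult.left_commute)
      qed
      ultimately have "l2_norm M (\<lambda>x. vdil j (indicator ?E) x - (\<Sum>i\<in>Pair j ` J. c (snd i) * wsys \<Omega> i x)) < eps"
        by simp
      moreover have "finite (Pair j ` J)" "Pair j ` J \<subseteq> UNIV \<times> H" using J by auto
      ultimately show "\<exists>J c. finite J \<and> J \<subseteq> UNIV \<times> H \<and>
          l2_norm M (\<lambda>x. vdil j (indicator ?E) x - (\<Sum>i\<in>J. c i * wsys \<Omega> i x)) < eps"
        by (intro exI[of _ "Pair j ` J"] exI[of _ "\<lambda>i. c (snd i)"] conjI)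
    qed
    then have "(\<lambda>w. (1 / ?c) * vdil j (indicator ?E) w) \<in> ?S" by (rule l2_span_cmult)
    then show "indicator X \<in> ?S"
    proof (rule l2_span_cong)
      fix w
      have "indicator ?E (vshift (- j) w) = (indicator X w :: complex)"
        by (simp add: indicator_def mem_vshift_image)
      then show "indicator X w = (1 / ?c) * vdil j (indicator ?E) w"
        using p_pos by (simp add: vdil_def)
    qed
  qed
  have pieces: "indicator X \<in> ?S" if "finite F" "X \<in> sets M" "X \<subseteq> (\<Union>n\<in>F. vshift n ` \<Omega>)" for F X
    using that
  proof (induction F arbitrary: X rule: finite_induct)
    case empty
    then have "X \<subseteq> vshift 0 ` \<Omega>" by simp
    with empty show ?case using piece by blast
  next
    case (insert n F)
    let ?A = "X \<inter> vshift n ` \<Omega>"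
    have A: "?A \<in> sets M" using insert.prems(1) S by (rule sets.Int)
    have D: "X - vshift n ` \<Omega> \<in> sets M" using insert.prems(1) S by (rule sets.Diff)
    have 1: "indicator (X - vshift n ` \<Omega>) \<in> ?S"
      using insert.prems by (intro insert.IH D) auto
    have 2: "indicator ?A \<in> ?S" using A by (rule piece) auto
    have "(\<lambda>w. indicator (X - vshift n ` \<Omega>) w + indicator ?A w) \<in> ?S"
      by (rule l2_span_add[OF _ 1 2]) (rule eL)
    then show ?case by (rule l2_span_cong) (auto simp: indicator_def)
  qed
  have "L2 M \<subseteq> ?S"
  proof (rule L2_subset_closed_span[OF eL])
    fix A assume A: "A \<in> sets M" "emeasure M A < \<infinity>"
    \<comment> \<open>Finite windows of scales. By the tiling their dilates exhaust \<open>A\<close>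
      up to a null set as the window grows.\<close>
    let ?F = "\<lambda>n::nat. {- int n..int n}"
    let ?A = "\<lambda>n. A \<inter> (\<Union>k\<in>?F n. vshift k ` \<Omega>)"
    have As: "?A n \<in> sets M" for n
      using A(1) S by (intro sets.Int sets.countable_UN') auto
    show "indicator A \<in> ?S"
    proof (rule indicator_incseq_in_closed_span[OF eL As])
      show "incseq ?A" by (force simp: incseq_def)
      show "indicator (?A n) \<in> ?S" for n by (rule pieces[of "?F n"]) (use As in auto)
      have "G - (\<Union>n. vshift n ` \<Omega>) \<in> null_sets M"
        using tiling by (simp add: partition_mod_null_def)
      then have "AE w in M. w \<notin> G - (\<Union>n. vshift n ` \<Omega>)" by (rule AE_not_in)
      then show "AE w in M. w \<in> A \<longleftrightarrow> w \<in> (\<Union>n. ?A n)"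
      proof eventually_elim
        case (elim w)
        have "w \<in> (\<Union>n. ?A n)" if w: "w \<in> A"
        proof -
          obtain k where k: "w \<in> vshift k ` \<Omega>" using elim w sets_sub_G[OF A(1)] by blast
          have "k \<in> ?F (nat \<bar>k\<bar>)" by auto
          then show ?thesis using k w by blast
        qed
        then show ?case by blast
      qed
    qed (use A in auto)
  qed
  then show ?thesis using eL orth by (simp add: orthonormal_basis_L2_iff)
qed

end

theorem theorem3p3:
  fixes p :: nat and \<mu> \<mu>' :: "(int \<Rightarrow> int) measure" and \<Omega> :: "(int \<Rightarrow> int) set"
  assumes "prime p"
    and "haar_measure p \<mu>"  (* Haar measure on the group *)
    and "haar_measure p \<mu>'"  (* Haar measure on its dual *)
    and "\<Omega> \<in> sets (completion \<mu>')"
  shows "wavelet_set p (completion \<mu>) (completion \<mu>') \<Omega> \<longleftrightarrow>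
    partition_mod_null (completion \<mu>') UNIV (\<lambda>n. vshift n ` \<Omega>) (vilenkin p) \<and>
    translation_congruent p (completion \<mu>') \<Omega> (vnbhd p 0)"
proof -
  \<comment> \<open>All lemmas are read on the dual; \<open>haar_unique\<close> then replaces the
    measure of the group by the same one.\<close>
  interpret vilenkin_haar p \<mu>' using assms(1,3) by unfold_locales
  have eq: "completion \<mu> = M" using haar_unique[OF assms(2)] by simp
  show ?thesis
  proof
    assume "wavelet_set p (completion \<mu>) M \<Omega>"
    then have w: "indicator \<Omega> \<in> L2 M" "wavelet p M (T (indicator \<Omega>))"
      by (simp_all add: wavelet_set_def eq)
    have fin: "emeasure M \<Omega> < \<infinity>" by (rule emeasure_finite_of_L2_indicator[OF assms(4) w(1)])
    have "wsys_basis \<Omega>"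
      using w(2) wavelet_iff_wsys[OF assms(4) fin] by blast
    then show "partition_mod_null M UNIV (\<lambda>n. vshift n ` \<Omega>) (vilenkin p) \<and> translation_congruent p M \<Omega> U"
      using basis_imp_tiling[OF assms(4) fin] basis_imp_folds[OF assms(4) fin]
        translation_congruent_if_folds[OF assms(4)] by blast
  next
    assume ab: "partition_mod_null M UNIV (\<lambda>n. vshift n ` \<Omega>) (vilenkin p) \<and> translation_congruent p M \<Omega> U"
    then have f: "folds \<Omega>" using folds_if_translation_congruent[OF assms(4)] by blast
    have fin: "emeasure M \<Omega> < \<infinity>" using folds_emeasure[OF assms(4) f] by simp
    have "wavelet p M (T (indicator \<Omega>))"
      using tiling_folds_imp_basis[OF assms(4) f] ab wavelet_iff_wsys[OF assms(4) fin] by blast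
    then show "wavelet_set p (completion \<mu>) M \<Omega>"
      using assms(4) L2_indicator[OF assms(4) fin] by (simp add: wavelet_set_def eq)
  qed
qed

end
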